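(* Let $\ell_1,\ell_2,a>0$ and let $K_{\ell_1,\ell_2,a}(t):=\operatorname{Tr}\big(e^{-tL^{\mathrm{cell}}_{\ell_1,\ell_2,a}}\big)$, $t>0$, be the heat trace of the mixed cell operator on $[0,\ell_1]\times[0,\ell_2]\times[0,a]$. As $t\downarrow0$, $$K_{\ell_1,\ell_2,a}(t)=\frac{\ell_1\ell_2a}{8\pi^{3/2}}t^{-3/2}+\frac{a(\ell_1+\ell_2)-\ell_1\ell_2}{8\pi}t^{-1}+O_{\ell_1,\ell_2,a}(t^{-1/2}).$$ Under the constraint $\ell_1\ell_2=a^2$, this becomes $$K_{\ell_1,\ell_2,a}(t)=\frac{a^3}{8\pi^{3/2}}t^{-3/2}+B(\ell_1,\ell_2,a)\,t^{-1}+O_{\ell_1,\ell_2,a}(t^{-1/2}),\qquad B(\ell_1,\ell_2,a):=\frac{a(\ell_1+\ell_2)-a^2}{8\pi}.$$ For fixed $a$, the coefficient $B(\ell_1,\ell_2,a)$ is minimized over $\ell_1\ell_2=a^2$ if and only if $\ell_1=\ell_2=a$. At the minimum, $B(a,a,a)=\dfrac{a^2}{8\pi}$. Equivalently, the artificial lateral contribution $$B_{\mathrm{lat}}(\ell_1,\ell_2,a):=\frac{a(\ell_1+\ell_2)}{8\pi}$$ is, over $\ell_1\ell_2=a^2$, uniquely minimized by the cube $\ell_1=\ell_2=a$.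
   Context: $L^{\mathrm{cell}}_{\ell_1,\ell_2,a}$ is the positive self-adjoint operator on $L^2([0,\ell_1]\times[0,\ell_2]\times[0,a])$ associated with the closed quadratic form $u\mapsto\int|\nabla u|^2\,dx\,dy\,dz$ with form domain $\{u\in H^1: u|_{z=0}=u|_{z=a}=0\text{ in the trace sense}\}$, i.e. the (positive) Laplacian with Neumann conditions on the lateral faces $x=0,\ell_1$, $y=0,\ell_2$ and Dirichlet conditions on the plate faces $z=0,a$. Its eigenvalues are $\pi^2m^2/\ell_1^2+\pi^2n^2/\ell_2^2+\pi^2r^2/a^2$ for $m,n\in\{0,1,2,\dots\}$, $r\in\{1,2,\dots\}$ (counted with multiplicity over triples). $O_{\ell_1,\ell_2,a}$ means the implied constant may depend on $\ell_1,\ell_2,a$. *)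

theory Defs
  imports "HOL-Analysis.Analysis" "HOL-Library.Landau_Symbols"
begin

section \<open>Real \<open>L\<^sup>2\<close> spaces and the trace of an operator\<close>

text \<open>
  Elements of \<open>L\<^sup>2\<close> are represented by functions; equality almost everywhere is expressed by
  \<open>L2_norm M (\<lambda>x. f x - g x) = 0\<close>.  The seminorm is meaningful on \<open>L2_space M\<close> only, since
  the integral of a non-integrable function is 0.
\<close>

definition L2_space :: "'a measure \<Rightarrow> ('a \<Rightarrow> real) set" where
  "L2_space M = {f \<in> borel_measurable M. integrable M (\<lambda>x. (f x)\<^sup>2)}"

definition L2_inner :: "'a measure \<Rightarrow> ('a \<Rightarrow> real) \<Rightarrow> ('a \<Rightarrow> real) \<Rightarrow> real" where
  "L2_inner M f g = (\<integral>x. f x * g x \<partial>M)"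

definition L2_norm :: "'a measure \<Rightarrow> ('a \<Rightarrow> real) \<Rightarrow> real" where
  "L2_norm M f = sqrt (L2_inner M f f)"

definition L2_orthonormal_basis :: "'a measure \<Rightarrow> ('a \<Rightarrow> real) set \<Rightarrow> bool" where
  "L2_orthonormal_basis M B \<longleftrightarrow>
     B \<subseteq> L2_space M \<and>
     (\<forall>e\<in>B. \<forall>e'\<in>B. L2_inner M e e' = (if e = e' then 1 else 0)) \<and>
     (\<forall>f\<in>L2_space M. \<forall>\<epsilon>>0. \<exists>F c. finite F \<and> F \<subseteq> B \<and>
        L2_norm M (\<lambda>x. f x - (\<Sum>e\<in>F. c e * e x)) < \<epsilon>)"

text \<open>The common value of \<open>\<Sum>e. \<langle>e, T e\<rangle>\<close> over all orthonormal bases.\<close>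

definition L2_trace :: "'a measure \<Rightarrow> (('a \<Rightarrow> real) \<Rightarrow> 'a \<Rightarrow> real) \<Rightarrow> real" where
  "L2_trace M T = (THE s. \<forall>B. L2_orthonormal_basis M B \<longrightarrow>
     ((\<lambda>e. L2_inner M e (T e)) has_sum s) B)"


section \<open>Operators associated with forms, and the semigroup they generate\<close>

text \<open>Unbounded operators are represented by their graphs.\<close>

definition form_operator ::
  "'a measure \<Rightarrow> ('a \<Rightarrow> real) set \<Rightarrow> (('a \<Rightarrow> real) \<Rightarrow> ('a \<Rightarrow> real) \<Rightarrow> real)
     \<Rightarrow> (('a \<Rightarrow> real) \<times> ('a \<Rightarrow> real)) set" where
  "form_operator M D q =
     {(u, w). u \<in> D \<and> w \<in> L2_space M \<and> (\<forall>v\<in>D. q u v = L2_inner M w v)}"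

text \<open>
  \<open>u\<close> solves \<open>u' = - A u\<close> on \<open>(0, \<infinity>)\<close> with \<open>u 0 = f\<close>, the derivative and the
  continuity at 0 being taken in the \<open>L\<^sup>2\<close> norm.
\<close>

definition L2_evolution ::
  "'a measure \<Rightarrow> (('a \<Rightarrow> real) \<times> ('a \<Rightarrow> real)) set \<Rightarrow> ('a \<Rightarrow> real)
     \<Rightarrow> (real \<Rightarrow> 'a \<Rightarrow> real) \<Rightarrow> bool" where
  "L2_evolution M A f u \<longleftrightarrow>
     u 0 = f \<and>
     (\<forall>t\<ge>0. u t \<in> L2_space M) \<and>
     ((\<lambda>t. L2_norm M (\<lambda>x. u t x - f x)) \<longlongrightarrow> 0) (at_right 0) \<and>
     (\<forall>t>0. \<exists>w. (u t, w) \<in> A \<and>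
        ((\<lambda>s. L2_norm M (\<lambda>x. (u s x - u t x) / (s - t) + w x)) \<longlongrightarrow> 0) (at t))"

text \<open>
  \<open>exp_neg M A t\<close> is the operator \<open>exp (- t A)\<close>: for a positive self-adjoint \<open>A\<close> and any
  \<open>f\<close> in \<open>L\<^sup>2\<close>, the curve \<open>t \<mapsto> exp (- t A) f\<close> is the only solution (up to null sets) of the
  Cauchy problem above.
\<close>

definition exp_neg ::
  "'a measure \<Rightarrow> (('a \<Rightarrow> real) \<times> ('a \<Rightarrow> real)) set \<Rightarrow> real \<Rightarrow> ('a \<Rightarrow> real) \<Rightarrow> 'a \<Rightarrow> real" where
  "exp_neg M A t f = (SOME g. \<exists>u. L2_evolution M A f u \<and> g = u t)"


section \<open>The Sobolev space \<open>H\<^sup>1\<close>\<close>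

text \<open>Functions of class \<open>C\<^sup>\<infinity>\<close> on the whole space.\<close>

coinductive smooth :: "('a::euclidean_space \<Rightarrow> real) \<Rightarrow> bool" where
  "\<lbrakk>\<And>x. f differentiable (at x);
    \<And>b. b \<in> Basis \<Longrightarrow> smooth (\<lambda>x. frechet_derivative f (at x) b)\<rbrakk> \<Longrightarrow> smooth f"

definition test_function :: "'a::euclidean_space set \<Rightarrow> ('a \<Rightarrow> real) \<Rightarrow> bool" where
  "test_function S \<phi> \<longleftrightarrow>
     smooth \<phi> \<and> (\<exists>K. compact K \<and> K \<subseteq> interior S \<and> (\<forall>x. x \<notin> K \<longrightarrow> \<phi> x = 0))"

abbreviation lborel_on :: "'a::euclidean_space set \<Rightarrow> 'a measure" where
  "lborel_on S \<equiv> restrict_space lborel S"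

definition has_weak_partial ::
  "'a::euclidean_space set \<Rightarrow> 'a \<Rightarrow> ('a \<Rightarrow> real) \<Rightarrow> ('a \<Rightarrow> real) \<Rightarrow> bool" where
  "has_weak_partial S b u g \<longleftrightarrow>
     g \<in> L2_space (lborel_on S) \<and>
     (\<forall>\<phi>. test_function S \<phi> \<longrightarrow>
        L2_inner (lborel_on S) u (\<lambda>x. frechet_derivative \<phi> (at x) b)
          = - L2_inner (lborel_on S) g \<phi>)"

definition H1 :: "'a::euclidean_space set \<Rightarrow> ('a \<Rightarrow> real) set" where
  "H1 S = {u \<in> L2_space (lborel_on S). \<forall>b\<in>Basis. \<exists>g. has_weak_partial S b u g}"

definition weak_partial :: "'a::euclidean_space set \<Rightarrow> 'a \<Rightarrow> ('a \<Rightarrow> real) \<Rightarrow> 'a \<Rightarrow> real" where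
  "weak_partial S b u = (SOME g. has_weak_partial S b u g)"

definition dirichlet_form ::
  "'a::euclidean_space set \<Rightarrow> ('a \<Rightarrow> real) \<Rightarrow> ('a \<Rightarrow> real) \<Rightarrow> real" where
  "dirichlet_form S u v =
     (\<integral>x. (\<Sum>b\<in>Basis. weak_partial S b u x * weak_partial S b v x) \<partial>lborel_on S)"


section \<open>The mixed cell operator and its heat trace\<close>

definition cell :: "real \<Rightarrow> real \<Rightarrow> real \<Rightarrow> (real \<times> real \<times> real) set" where
  "cell l1 l2 a = {0..l1} \<times> {0..l2} \<times> {0..a}"

text \<open>
  \<open>g\<close> is the trace of \<open>u\<close> on the face of height \<open>z = c\<close> (with \<open>c = 0\<close> or \<open>c = a\<close>).  The trace
  operator is the extension by continuity of the restriction map from the functions that are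
  smooth up to the boundary, which are dense in \<open>H\<^sup>1\<close>.
\<close>

definition has_plate_trace ::
  "real \<Rightarrow> real \<Rightarrow> real \<Rightarrow> real \<Rightarrow> (real \<times> real \<times> real \<Rightarrow> real) \<Rightarrow> (real \<times> real \<Rightarrow> real) \<Rightarrow> bool"
  where
  "has_plate_trace l1 l2 a c u g \<longleftrightarrow>
     u \<in> H1 (cell l1 l2 a) \<and> g \<in> L2_space (lborel_on ({0..l1} \<times> {0..l2})) \<and>
     (\<exists>U :: nat \<Rightarrow> real \<times> real \<times> real \<Rightarrow> real.
        (\<forall>n. smooth (U n)) \<and>
        (\<lambda>n. L2_norm (lborel_on (cell l1 l2 a)) (\<lambda>p. U n p - u p)) \<longlonglongrightarrow> 0 \<and>
        (\<forall>b\<in>Basis. (\<lambda>n. L2_norm (lborel_on (cell l1 l2 a))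
           (\<lambda>p. frechet_derivative (U n) (at p) b - weak_partial (cell l1 l2 a) b u p))
             \<longlonglongrightarrow> 0) \<and>
        (\<lambda>n. L2_norm (lborel_on ({0..l1} \<times> {0..l2})) (\<lambda>(x, y). U n (x, y, c) - g (x, y)))
          \<longlonglongrightarrow> 0)"

definition cell_form_domain ::
  "real \<Rightarrow> real \<Rightarrow> real \<Rightarrow> (real \<times> real \<times> real \<Rightarrow> real) set" where
  "cell_form_domain l1 l2 a =
     {u \<in> H1 (cell l1 l2 a).
        has_plate_trace l1 l2 a 0 u (\<lambda>_. 0) \<and> has_plate_trace l1 l2 a a u (\<lambda>_. 0)}"

definition cell_operator ::
  "real \<Rightarrow> real \<Rightarrow> real
     \<Rightarrow> ((real \<times> real \<times> real \<Rightarrow> real) \<times> (real \<times> real \<times> real \<Rightarrow> real)) set" where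
  "cell_operator l1 l2 a =
     form_operator (lborel_on (cell l1 l2 a)) (cell_form_domain l1 l2 a)
       (dirichlet_form (cell l1 l2 a))"

definition cell_heat_trace :: "real \<Rightarrow> real \<Rightarrow> real \<Rightarrow> real \<Rightarrow> real" where
  "cell_heat_trace l1 l2 a t =
     L2_trace (lborel_on (cell l1 l2 a))
       (exp_neg (lborel_on (cell l1 l2 a)) (cell_operator l1 l2 a) t)"

definition B_coeff :: "real \<Rightarrow> real \<Rightarrow> real \<Rightarrow> real" where
  "B_coeff l1 l2 a = (a * (l1 + l2) - a\<^sup>2) / (8 * pi)"

definition B_lat :: "real \<Rightarrow> real \<Rightarrow> real \<Rightarrow> real" where
  "B_lat l1 l2 a = a * (l1 + l2) / (8 * pi)"

definition admissible :: "real \<Rightarrow> real \<times> real \<Rightarrow> bool" where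
  "admissible a = (\<lambda>(l1, l2). l1 > 0 \<and> l2 > 0 \<and> l1 * l2 = a\<^sup>2)"

end

theory Submission
  imports Defs "HOL-Probability.Distributions"
begin

text \<open>
  The cell is a product of three intervals, and the heat trace is the product of three
  one-dimensional heat traces, two with Neumann and one with Dirichlet conditions
  (\<open>cell_heat_trace_eq\<close>).  The asymptotic expansion is then the product of three elementary ones.

  The identification of the trace is a spectral argument.  The normalized products
  \<open>cos (\<pi> m x / l1) cos (\<pi> n y / l2) sin (\<pi> (r + 1) z / a)\<close> are complete in \<open>L\<^sup>2\<close>
  (\<open>cell_modes_basis\<close>, by the Stone--Weierstrass theorem), and Green's formula shows that they
  satisfy the weak eigenvalue equation against every element of the form domain (\<open>mode_green\<close>).
  Therefore each coefficient of a solution of the Cauchy problem solves \<open>c' = - lam c\<close>, which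
  determines \<open>exp (- t A) f\<close> up to null sets whatever solution is chosen.  Conversely the factors
  \<open>exp (- t lam)\<close> make the eigenfunction series converge uniformly together with its first
  derivatives, so that it stays in the operator domain and is a solution.  Finally
  \<open>\<langle>e, exp (- t A) e\<rangle> = \<Sum>k. exp (- t lam k) \<langle>e, \<phi> k\<rangle>\<^sup>2\<close>; summing over an arbitrary orthonormal
  basis and exchanging the two sums leaves \<open>\<Sum>k. exp (- t lam k)\<close>, since Parseval's identity for
  \<open>\<phi> k\<close> gives \<open>\<Sum>e. \<langle>e, \<phi> k\<rangle>\<^sup>2 = 1\<close> (\<open>trace_exp_neg\<close>).

  The one-dimensional expansions come from the trapezoid rule.  With step \<open>h = \<pi> \<surd>t / l\<close> the sum
  \<open>h (1 / 2 + \<Sum>m\<ge>1. exp (- (m h)\<^sup>2))\<close> is the trapezoid approximation of the Gaussian integral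
  \<open>\<surd>\<pi> / 2\<close> with an error of order \<open>h\<^sup>2\<close>, so that the Neumann trace is
  \<open>l / (2 \<surd>(\<pi> t)) + 1 / 2 + O(\<surd>t)\<close>.  The Dirichlet trace lacks the term \<open>m = 0\<close>, which changes
  \<open>1 / 2\<close> into \<open>- 1 / 2\<close>.  Errors of order \<open>\<surd>t\<close> are exactly good enough: in the triple product they
  are multiplied by factors of order \<open>1 / t\<close>.

  The minimization is the identity \<open>(x + y)\<^sup>2 = 4 x y + (x - y)\<^sup>2\<close>.
\<close>


section \<open>Calculus in the seminormed space of square integrable functions\<close>

lemma L2_spaceD:
  assumes "f \<in> L2_space M"
  shows "f \<in> borel_measurable M" "integrable M (\<lambda>x. (f x)\<^sup>2)"
  using assms by (auto simp: L2_space_def)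

lemma L2_integrable_mult:
  assumes f: "f \<in> L2_space M" and g: "g \<in> L2_space M"
  shows "integrable M (\<lambda>x. f x * g x)"
proof (rule Bochner_Integration.integrable_bound)
  show "integrable M (\<lambda>x. (f x)\<^sup>2 + (g x)\<^sup>2)"
    using f g by (auto dest: L2_spaceD)
  show "(\<lambda>x. f x * g x) \<in> borel_measurable M"
    using L2_spaceD(1)[OF f] L2_spaceD(1)[OF g] by simp
  have "\<bar>a * b\<bar> \<le> a\<^sup>2 + b\<^sup>2" for a b :: real
  proof -
    have "2 * (\<bar>a\<bar> * \<bar>b\<bar>) \<le> a\<^sup>2 + b\<^sup>2"
      using sum_squares_bound[of "\<bar>a\<bar>" "\<bar>b\<bar>"] by (simp add: mult.assoc)
    moreover have "0 \<le> \<bar>a\<bar> * \<bar>b\<bar>" by simp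
    ultimately show ?thesis unfolding abs_mult by linarith
  qed
  then show "AE x in M. norm (f x * g x) \<le> norm ((f x)\<^sup>2 + (g x)\<^sup>2)"
    by (intro AE_I2) (simp add: sum_power2_ge_zero)
qed

lemma L2_add:
  assumes f: "f \<in> L2_space M" and g: "g \<in> L2_space M"
  shows "(\<lambda>x. f x + g x) \<in> L2_space M"
proof -
  have "integrable M (\<lambda>x. (f x)\<^sup>2 + (g x)\<^sup>2 + 2 * (f x * g x))"
    using L2_spaceD(2)[OF f] L2_spaceD(2)[OF g] L2_integrable_mult[OF f g] by simp
  also have "(\<lambda>x. (f x)\<^sup>2 + (g x)\<^sup>2 + 2 * (f x * g x)) = (\<lambda>x. (f x + g x)\<^sup>2)"
    by (auto simp: power2_sum)
  finally show ?thesis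
    using f g by (auto simp: L2_space_def)
qed

lemma L2_cmult:
  assumes "f \<in> L2_space M"
  shows "(\<lambda>x. c * f x) \<in> L2_space M"
  using assms by (auto simp: L2_space_def power_mult_distrib)

lemma L2_uminus: "f \<in> L2_space M \<Longrightarrow> (\<lambda>x. - f x) \<in> L2_space M"
  using L2_cmult[of f M "-1"] by simp

lemma L2_diff:
  assumes f: "f \<in> L2_space M" and g: "g \<in> L2_space M"
  shows "(\<lambda>x. f x - g x) \<in> L2_space M"
  using L2_add[OF f L2_uminus[OF g]] by simp

lemma L2_zero: "(\<lambda>x. 0) \<in> L2_space M"
  by (simp add: L2_space_def)

lemma L2_sum:
  assumes "\<And>i. i \<in> F \<Longrightarrow> f i \<in> L2_space M"
  shows "(\<lambda>x. \<Sum>i\<in>F. f i x) \<in> L2_space M"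
  using assms by (induction F rule: infinite_finite_induct) (auto intro: L2_zero L2_add)

lemma L2_mult_bounded:
  assumes f: "f \<in> L2_space M" and g: "g \<in> borel_measurable M"
    and b: "\<And>x. x \<in> space M \<Longrightarrow> \<bar>g x\<bar> \<le> c"
  shows "(\<lambda>x. g x * f x) \<in> L2_space M"
proof -
  have "integrable M (\<lambda>x. (g x * f x)\<^sup>2)"
  proof (rule Bochner_Integration.integrable_bound)
    show "integrable M (\<lambda>x. c\<^sup>2 * (f x)\<^sup>2)"
      using f by (auto dest: L2_spaceD)
    show "(\<lambda>x. (g x * f x)\<^sup>2) \<in> borel_measurable M"
      using f g by (auto dest: L2_spaceD)
    have "(g x)\<^sup>2 \<le> c\<^sup>2" if "x \<in> space M" for x
      using power_mono[OF b[OF that], of 2] by simp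
    then show "AE x in M. norm ((g x * f x)\<^sup>2) \<le> norm (c\<^sup>2 * (f x)\<^sup>2)"
      by (intro AE_I2) (simp add: power_mult_distrib mult_right_mono)
  qed
  then show ?thesis
    using f g by (auto simp: L2_space_def)
qed

lemma L2_bounded:
  assumes M: "finite_measure M" and g: "g \<in> borel_measurable M"
    and b: "\<And>x. x \<in> space M \<Longrightarrow> \<bar>g x\<bar> \<le> c"
  shows "g \<in> L2_space M"
proof -
  interpret finite_measure M by fact
  have "(\<lambda>x. 1) \<in> L2_space M" by (simp add: L2_space_def)
  from L2_mult_bounded[OF this g b] show ?thesis by simp
qed

lemma L2_inner_commute: "L2_inner M f g = L2_inner M g f"
  by (simp add: L2_inner_def mult.commute)

lemma L2_inner_add_left:
  assumes "f \<in> L2_space M" "g \<in> L2_space M" "h \<in> L2_space M"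
  shows "L2_inner M (\<lambda>x. f x + g x) h = L2_inner M f h + L2_inner M g h"
  using assms by (simp add: L2_inner_def distrib_right L2_integrable_mult)

lemma L2_inner_diff_left:
  assumes "f \<in> L2_space M" "g \<in> L2_space M" "h \<in> L2_space M"
  shows "L2_inner M (\<lambda>x. f x - g x) h = L2_inner M f h - L2_inner M g h"
  using assms by (simp add: L2_inner_def left_diff_distrib L2_integrable_mult)

lemma L2_inner_cmult_left: "L2_inner M (\<lambda>x. c * f x) h = c * L2_inner M f h"
  by (simp add: L2_inner_def mult.assoc)

lemma L2_inner_cmult_right: "L2_inner M h (\<lambda>x. c * f x) = c * L2_inner M h f"
  using L2_inner_cmult_left[of M c f h] by (simp add: L2_inner_commute)

lemma L2_inner_sum_left:
  assumes "\<And>i. i \<in> F \<Longrightarrow> f i \<in> L2_space M" "h \<in> L2_space M"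
  shows "L2_inner M (\<lambda>x. \<Sum>i\<in>F. f i x) h = (\<Sum>i\<in>F. L2_inner M (f i) h)"
  using assms unfolding L2_inner_def sum_distrib_right
  by (intro Bochner_Integration.integral_sum) (auto intro: L2_integrable_mult)

lemma L2_inner_diff_right:
  assumes "f \<in> L2_space M" "g \<in> L2_space M" "h \<in> L2_space M"
  shows "L2_inner M h (\<lambda>x. f x - g x) = L2_inner M h f - L2_inner M h g"
  using L2_inner_diff_left[OF assms] by (simp add: L2_inner_commute[of M h])

lemma L2_inner_add_right:
  assumes "f \<in> L2_space M" "g \<in> L2_space M" "h \<in> L2_space M"
  shows "L2_inner M h (\<lambda>x. f x + g x) = L2_inner M h f + L2_inner M h g"
  using L2_inner_add_left[OF assms] by (simp add: L2_inner_commute[of M h])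

lemma L2_inner_nonneg: "0 \<le> L2_inner M f f"
  by (simp add: L2_inner_def)

lemma L2_norm_nonneg: "0 \<le> L2_norm M f"
  by (simp add: L2_norm_def L2_inner_nonneg)

lemma L2_norm_power2: "(L2_norm M f)\<^sup>2 = L2_inner M f f"
  by (simp add: L2_norm_def L2_inner_nonneg)

lemma L2_inner_diff_self:
  assumes "f \<in> L2_space M" "g \<in> L2_space M"
  shows "L2_inner M (\<lambda>x. f x - g x) (\<lambda>x. f x - g x)
    = L2_inner M f f - 2 * L2_inner M f g + L2_inner M g g"
proof -
  have "L2_inner M (\<lambda>x. f x - g x) (\<lambda>x. f x - g x)
     = L2_inner M f (\<lambda>x. f x - g x) - L2_inner M g (\<lambda>x. f x - g x)"
    using assms by (simp add: L2_inner_diff_left L2_diff)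
  also have "\<dots> = (L2_inner M f f - L2_inner M g f) - (L2_inner M f g - L2_inner M g g)"
    using assms by (simp add: L2_inner_diff_right)
  finally show ?thesis by (simp add: L2_inner_commute[of M g f])
qed

lemma L2_Cauchy_Schwarz:
  assumes f: "f \<in> L2_space M" and g: "g \<in> L2_space M"
  shows "\<bar>L2_inner M f g\<bar> \<le> L2_norm M f * L2_norm M g"
proof -
  have q: "0 \<le> L2_inner M f f - 2 * s * L2_inner M f g + s\<^sup>2 * L2_inner M g g" for s
  proof -
    have "L2_inner M (\<lambda>x. s * g x) (\<lambda>x. s * g x) = s\<^sup>2 * L2_inner M g g"
      by (simp add: L2_inner_cmult_left L2_inner_cmult_right power2_eq_square)
    moreover have "L2_inner M f (\<lambda>x. s * g x) = s * L2_inner M f g"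
      by (rule L2_inner_cmult_right)
    ultimately show ?thesis
      using L2_inner_nonneg[of M "\<lambda>x. f x - s * g x"]
        L2_inner_diff_self[OF f L2_cmult[OF g], of s] by simp
  qed
  have "(L2_inner M f g)\<^sup>2 \<le> L2_inner M f f * L2_inner M g g"
  proof (cases "L2_inner M g g = 0")
    case True
    have "L2_inner M f g = 0"
    proof (rule ccontr)
      assume "L2_inner M f g \<noteq> 0"
      then show False
        using q[of "(L2_inner M f f + 1) / (2 * L2_inner M f g)"] True by (simp add: field_simps)
    qed
    then show ?thesis using True by simp
  next
    case False
    then have pos: "L2_inner M g g > 0" using L2_inner_nonneg[of M g] by simp
    from q[of "L2_inner M f g / L2_inner M g g"] pos
    have "0 \<le> L2_inner M f f - (L2_inner M f g)\<^sup>2 / L2_inner M g g"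
      by (simp add: power2_eq_square divide_simps)
    then show ?thesis using pos by (simp add: field_simps)
  qed
  then have "\<bar>L2_inner M f g\<bar>\<^sup>2 \<le> (L2_norm M f * L2_norm M g)\<^sup>2"
    by (simp add: power_mult_distrib L2_norm_power2)
  then show ?thesis
    by (rule power2_le_imp_le) (simp add: L2_norm_nonneg)
qed

lemma L2_norm_triangle:
  assumes f: "f \<in> L2_space M" and g: "g \<in> L2_space M"
  shows "L2_norm M (\<lambda>x. f x + g x) \<le> L2_norm M f + L2_norm M g"
proof (rule power2_le_imp_le)
  have "L2_inner M (\<lambda>x. f x + g x) (\<lambda>x. f x + g x)
      = L2_inner M f f + 2 * L2_inner M f g + L2_inner M g g"
    using f g
    by (simp add: L2_inner_add_left L2_inner_add_right L2_add L2_inner_commute[of M g f])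
  also have "\<dots> \<le> L2_inner M f f + 2 * (L2_norm M f * L2_norm M g) + L2_inner M g g"
    using L2_Cauchy_Schwarz[OF f g] by linarith
  also have "\<dots> = (L2_norm M f + L2_norm M g)\<^sup>2"
    by (simp add: power2_sum L2_norm_power2)
  finally show "(L2_norm M (\<lambda>x. f x + g x))\<^sup>2 \<le> (L2_norm M f + L2_norm M g)\<^sup>2"
    by (simp add: L2_norm_power2)
qed (simp add: L2_norm_nonneg)

lemma L2_norm_diff_triangle:
  assumes "f \<in> L2_space M" "g \<in> L2_space M" "h \<in> L2_space M"
  shows "L2_norm M (\<lambda>x. f x - h x) \<le> L2_norm M (\<lambda>x. f x - g x) + L2_norm M (\<lambda>x. g x - h x)"
  using L2_norm_triangle[OF L2_diff[OF assms(1,2)] L2_diff[OF assms(2,3)]] by simp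

lemma L2_norm_le_bound:
  assumes M: "finite_measure M" and g: "g \<in> borel_measurable M"
    and b: "\<And>x. x \<in> space M \<Longrightarrow> \<bar>g x\<bar> \<le> c" and c: "0 \<le> c"
  shows "L2_norm M g \<le> c * sqrt (measure M (space M))"
proof -
  interpret finite_measure M by fact
  have gL: "g \<in> L2_space M" by (rule L2_bounded[OF M g b])
  have "L2_inner M g g \<le> (\<integral>x. c\<^sup>2 \<partial>M)"
    unfolding L2_inner_def
  proof (rule integral_mono)
    show "g x * g x \<le> c\<^sup>2" if "x \<in> space M" for x
      using power_mono[OF b[OF that], of 2] by (simp add: power2_eq_square)
  qed (use gL in \<open>auto intro: L2_integrable_mult\<close>)
  then have "L2_norm M g \<le> sqrt (c\<^sup>2 * measure M (space M))"
    by (simp add: L2_norm_def mult.commute)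
  also have "\<dots> = c * sqrt (measure M (space M))"
    using c by (simp add: real_sqrt_mult)
  finally show ?thesis .
qed

lemma L2_norm_eq_0_iff_AE:
  assumes "f \<in> L2_space M"
  shows "L2_norm M f = 0 \<longleftrightarrow> (AE x in M. f x = 0)"
proof -
  have "(\<lambda>x. f x * f x) = (\<lambda>x. (f x)\<^sup>2)" by (simp add: power2_eq_square)
  then show ?thesis
    using integral_nonneg_eq_0_iff_AE[of M "\<lambda>x. (f x)\<^sup>2"] L2_spaceD[OF assms]
    by (simp add: L2_norm_def L2_inner_def)
qed

lemma L2_inner_cong_AE:
  assumes "f \<in> borel_measurable M" "f' \<in> borel_measurable M" "g \<in> borel_measurable M"
    and "AE x in M. f x = f' x"
  shows "L2_inner M f g = L2_inner M f' g"
  unfolding L2_inner_def using assms by (intro integral_cong_AE) auto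

lemma L2_norm_cong_AE:
  assumes "f \<in> borel_measurable M" "f' \<in> borel_measurable M"
    and "AE x in M. f x = f' x"
  shows "L2_norm M f = L2_norm M f'"
  unfolding L2_norm_def
  using L2_inner_cong_AE[of f M f' f] L2_inner_cong_AE[of f M f' f'] assms
  by (simp add: L2_inner_commute)

text \<open>
  Limits are taken along an arbitrary filter because the lemma serves both for approximating
  sequences and for difference quotients in time, where the approximants need to be square
  integrable only eventually.
\<close>

lemma L2_inner_tendsto:
  assumes U: "eventually (\<lambda>n. U n \<in> L2_space M) F" and u: "u \<in> L2_space M" and v: "v \<in> L2_space M"
    and lim: "((\<lambda>n. L2_norm M (\<lambda>x. U n x - u x)) \<longlongrightarrow> 0) F"
  shows "((\<lambda>n. L2_inner M (U n) v) \<longlongrightarrow> L2_inner M u v) F"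
proof (rule Lim_null[THEN iffD2], rule Lim_null_comparison)
  show "eventually (\<lambda>n. norm (L2_inner M (U n) v - L2_inner M u v)
      \<le> L2_norm M (\<lambda>x. U n x - u x) * L2_norm M v) F"
    using U
  proof eventually_elim
    case (elim n)
    then show ?case
      using L2_Cauchy_Schwarz[OF L2_diff[OF elim u] v] u v by (simp add: L2_inner_diff_left)
  qed
  show "((\<lambda>n. L2_norm M (\<lambda>x. U n x - u x) * L2_norm M v) \<longlongrightarrow> 0) F"
    using tendsto_mult_right[OF lim, of "L2_norm M v"] by simp
qed

section \<open>Parseval's identity\<close>

text \<open>
  Completing the square: among all combinations of a finite orthonormal family the Fourier
  coefficients give the best approximation.  This yields Bessel's inequality and, combined with
  density, Parseval's identity.
\<close>

lemma L2_orthonormal_sum_diff: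
  assumes f: "f \<in> L2_space M" and F: "finite F" "F \<subseteq> L2_space M"
    and orth: "\<And>e e'. e \<in> F \<Longrightarrow> e' \<in> F \<Longrightarrow> L2_inner M e e' = (if e = e' then 1 else 0)"
  shows "L2_inner M (\<lambda>x. f x - (\<Sum>e\<in>F. c e * e x)) (\<lambda>x. f x - (\<Sum>e\<in>F. c e * e x))
    = L2_inner M f f - (\<Sum>e\<in>F. (L2_inner M f e)\<^sup>2) + (\<Sum>e\<in>F. (c e - L2_inner M f e)\<^sup>2)"
proof -
  have S: "(\<lambda>x. \<Sum>e\<in>F. c e * e x) \<in> L2_space M"
    using F by (auto intro!: L2_sum L2_cmult)
  have inn: "L2_inner M (\<lambda>x. \<Sum>e\<in>F. c e * e x) h = (\<Sum>e\<in>F. c e * L2_inner M e h)"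
    if "h \<in> L2_space M" for h
    using F that by (subst L2_inner_sum_left) (auto intro!: L2_cmult simp: L2_inner_cmult_left)
  have 1: "L2_inner M f (\<lambda>x. \<Sum>e\<in>F. c e * e x) = (\<Sum>e\<in>F. c e * L2_inner M f e)"
    using inn[OF f] by (simp add: L2_inner_commute)
  have "L2_inner M (\<lambda>x. \<Sum>e\<in>F. c e * e x) (\<lambda>x. \<Sum>e\<in>F. c e * e x)
      = (\<Sum>e\<in>F. c e * L2_inner M (\<lambda>x. \<Sum>e\<in>F. c e * e x) e)"
    using inn[OF S] by (simp add: L2_inner_commute)
  also have "\<dots> = (\<Sum>e\<in>F. c e * c e)"
  proof (rule sum.cong[OF refl])
    fix e assume e: "e \<in> F"
    have "L2_inner M (\<lambda>x. \<Sum>e\<in>F. c e * e x) e = (\<Sum>e'\<in>F. c e' * L2_inner M e' e)"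
      using inn e F by auto
    also have "\<dots> = (\<Sum>e'\<in>F. if e' = e then c e' else 0)"
      using orth e by (intro sum.cong) auto
    also have "\<dots> = c e" using e F by simp
    finally show "c e * L2_inner M (\<lambda>x. \<Sum>e\<in>F. c e * e x) e = c e * c e" by simp
  qed
  finally have 2: "L2_inner M (\<lambda>x. \<Sum>e\<in>F. c e * e x) (\<lambda>x. \<Sum>e\<in>F. c e * e x)
      = (\<Sum>e\<in>F. c e * c e)" .
  have "(\<Sum>e\<in>F. (c e - L2_inner M f e)\<^sup>2) - (\<Sum>e\<in>F. (L2_inner M f e)\<^sup>2)
     = (\<Sum>e\<in>F. c e * c e - 2 * (c e * L2_inner M f e))"
    by (simp add: sum_subtractf[symmetric] power2_diff power2_eq_square algebra_simps)
  then show ?thesis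
    using L2_inner_diff_self[OF f S] 1 2 by (simp add: sum_subtractf sum_distrib_left)
qed

theorem L2_Parseval:
  assumes B: "L2_orthonormal_basis M B" and f: "f \<in> L2_space M"
  shows "((\<lambda>e. (L2_inner M f e)\<^sup>2) has_sum L2_inner M f f) B"
proof -
  have BL: "B \<subseteq> L2_space M" and orth: "\<And>e e'. e \<in> B \<Longrightarrow> e' \<in> B \<Longrightarrow> L2_inner M e e' = (if e = e' then 1 else 0)"
    and dense: "\<And>\<epsilon>. \<epsilon> > 0 \<Longrightarrow> \<exists>F c. finite F \<and> F \<subseteq> B \<and> L2_norm M (\<lambda>x. f x - (\<Sum>e\<in>F. c e * e x)) < \<epsilon>"
    using B f by (auto simp: L2_orthonormal_basis_def)
  have expand: "L2_inner M (\<lambda>x. f x - (\<Sum>e\<in>F. c e * e x)) (\<lambda>x. f x - (\<Sum>e\<in>F. c e * e x))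
    = L2_inner M f f - (\<Sum>e\<in>F. (L2_inner M f e)\<^sup>2) + (\<Sum>e\<in>F. (c e - L2_inner M f e)\<^sup>2)"
    if "finite F" "F \<subseteq> B" for F c
    using that BL by (intro L2_orthonormal_sum_diff f orth) auto
  have Bessel: "(\<Sum>e\<in>F. (L2_inner M f e)\<^sup>2) \<le> L2_inner M f f" if "finite F" "F \<subseteq> B" for F
    using expand[OF that, of "\<lambda>e. L2_inner M f e"]
      L2_inner_nonneg[of M "\<lambda>x. f x - (\<Sum>e\<in>F. L2_inner M f e * e x)"] by simp
  show ?thesis
    unfolding has_sum_def tendsto_iff
  proof (intro allI impI)
    fix \<epsilon> :: real assume "\<epsilon> > 0"
    then obtain F c where F: "finite F" "F \<subseteq> B"
      and lt: "L2_norm M (\<lambda>x. f x - (\<Sum>e\<in>F. c e * e x)) < sqrt \<epsilon>"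
      using dense[of "sqrt \<epsilon>"] by auto
    from lt have "L2_inner M (\<lambda>x. f x - (\<Sum>e\<in>F. c e * e x)) (\<lambda>x. f x - (\<Sum>e\<in>F. c e * e x)) < \<epsilon>"
      by (simp add: L2_norm_def)
    moreover have "0 \<le> (\<Sum>e\<in>F. (c e - L2_inner M f e)\<^sup>2)" by (simp add: sum_nonneg)
    ultimately have 1: "L2_inner M f f - (\<Sum>e\<in>F. (L2_inner M f e)\<^sup>2) < \<epsilon>"
      using expand[OF F, of c] by simp
    \<comment> \<open>Once the partial sum is within \<open>\<epsilon>\<close> of \<open>L2_inner M f f\<close> it stays so when the index
      set grows, since it increases and Bessel's inequality bounds it from above.\<close>
    show "\<forall>\<^sub>F x in finite_subsets_at_top B. dist (\<Sum>e\<in>x. (L2_inner M f e)\<^sup>2) (L2_inner M f f) < \<epsilon>"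
      unfolding eventually_finite_subsets_at_top
    proof (intro exI[of _ F] conjI allI impI F)
      fix Y assume Y: "finite Y \<and> F \<subseteq> Y \<and> Y \<subseteq> B"
      then have "(\<Sum>e\<in>F. (L2_inner M f e)\<^sup>2) \<le> (\<Sum>e\<in>Y. (L2_inner M f e)\<^sup>2)"
        by (intro sum_mono2) auto
      then show "dist (\<Sum>e\<in>Y. (L2_inner M f e)\<^sup>2) (L2_inner M f f) < \<epsilon>"
        using Bessel[of Y] Y 1 by (simp add: dist_real_def)
    qed
  qed
qed

text \<open>
  Polarization of the preceding identity.
\<close>

lemma L2_Parseval_inner:
  assumes B: "L2_orthonormal_basis M B" and f: "f \<in> L2_space M" and g: "g \<in> L2_space M"
  shows "((\<lambda>e. L2_inner M f e * L2_inner M g e) has_sum L2_inner M f g) B"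
proof -
  have BL: "B \<subseteq> L2_space M" using B by (simp add: L2_orthonormal_basis_def)
  have "((\<lambda>e. (1/2) * ((L2_inner M f e)\<^sup>2 + (L2_inner M g e)\<^sup>2 + - (L2_inner M (\<lambda>x. f x - g x) e)\<^sup>2))
     has_sum (1/2) * (L2_inner M f f + L2_inner M g g + - L2_inner M (\<lambda>x. f x - g x) (\<lambda>x. f x - g x))) B"
    by (intro has_sum_cmult_right has_sum_add has_sum_uminus[THEN iffD2] L2_Parseval[OF B] L2_diff f g)
       (use L2_Parseval[OF B L2_diff[OF f g]] in \<open>simp\<close>)
  also have "(1/2) * (L2_inner M f f + L2_inner M g g + - L2_inner M (\<lambda>x. f x - g x) (\<lambda>x. f x - g x))
     = L2_inner M f g"
    by (simp add: L2_inner_diff_self f g)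
  finally show ?thesis
    by (rule has_sum_cong[THEN iffD1, rotated])
       (use BL in \<open>auto simp: L2_inner_diff_left f g power2_eq_square algebra_simps subset_iff\<close>)
qed

section \<open>Dominated series of functions\<close>

lemma summable_dominated:
  fixes g :: "'k \<Rightarrow> real"
  assumes d: "d summable_on UNIV" and gd: "\<And>k. \<bar>g k\<bar> \<le> d k"
  shows "g summable_on UNIV"
proof (rule abs_summable_summable)
  show "(\<lambda>k. norm (g k)) summable_on UNIV"
    by (rule summable_on_comparison_test[OF d]) (use gd in auto)
qed

lemma infsum_dominated_bound:
  fixes g :: "'k \<Rightarrow> real"
  assumes d: "d summable_on UNIV" and gd: "\<And>k. \<bar>g k\<bar> \<le> d k"
  shows "\<bar>infsum g UNIV\<bar> \<le> infsum d UNIV"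
  using norm_infsum_le[OF has_sum_infsum[OF summable_dominated[OF d gd]] has_sum_infsum[OF d]] gd
  by auto

lemma infsum_diff_finite_sum:
  fixes g :: "'k \<Rightarrow> real"
  assumes d: "d summable_on UNIV" and gd: "\<And>k. \<bar>g k\<bar> \<le> d k" and G: "finite G"
  shows "\<bar>infsum g UNIV - sum g G\<bar> \<le> infsum d UNIV - sum d G"
proof -
  have split: "infsum h UNIV = sum h G + infsum h (-G)" if "h summable_on UNIV" for h :: "'k \<Rightarrow> real"
  proof -
    have "infsum h (G \<union> -G) = infsum h G + infsum h (-G)"
      using that G by (intro infsum_Un_disjoint) (auto intro: summable_on_subset_banach)
    then show ?thesis using G by (simp add: Compl_partition)
  qed
  have s: "g summable_on UNIV" by (rule summable_dominated[OF d gd])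
  have "norm (infsum g (-G)) \<le> infsum d (-G)"
    by (rule norm_infsum_le[OF has_sum_infsum has_sum_infsum])
       (use s d gd in \<open>auto intro: summable_on_subset_banach\<close>)
  then show ?thesis using split[OF s] split[OF d] by simp
qed

text \<open>
  Sums over an arbitrary index type are limits of nets.  The sets \<open>G n\<close> turn every series dominated
  by \<open>d\<close> into the limit of a sequence, which measurability and the traces on the plates require.
\<close>

lemma summable_exhaustion:
  fixes d :: "'k \<Rightarrow> real"
  assumes "d summable_on UNIV"
  obtains G :: "nat \<Rightarrow> 'k set" where "\<And>n. finite (G n)" "(\<lambda>n. infsum d UNIV - sum d (G n)) \<longlonglongrightarrow> 0"
proof -
  have "\<exists>F. finite F \<and> dist (sum d F) (infsum d UNIV) \<le> inverse (real (Suc n))" for n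
    using infsum_finite_approximation[OF assms, of "inverse (real (Suc n))"] by auto
  then obtain G where G: "\<And>n. finite (G n)" "\<And>n. dist (sum d (G n)) (infsum d UNIV) \<le> inverse (real (Suc n))"
    by metis
  have "(\<lambda>n. infsum d UNIV - sum d (G n)) \<longlonglongrightarrow> 0"
    by (rule Lim_null_comparison[OF _ LIMSEQ_inverse_real_of_nat])
       (use G(2) in \<open>auto simp: dist_real_def abs_minus_commute\<close>)
  with G(1) show thesis by (rule that)
qed

text \<open>
  Weierstrass' test: the tail of \<open>d\<close> bounds the remainder uniformly, and on a space of finite
  measure uniform convergence implies convergence in the \<open>L\<^sup>2\<close> norm.
\<close>

lemma dominated_series_L2:
  fixes \<psi> :: "'k \<Rightarrow> 'a \<Rightarrow> real"
  assumes M: "finite_measure M" and meas: "\<And>k. \<psi> k \<in> borel_measurable M"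
    and d: "d summable_on UNIV" and bound: "\<And>k x. x \<in> space M \<Longrightarrow> \<bar>\<psi> k x\<bar> \<le> d k"
    and G: "\<And>n. finite (G n)" and lim: "(\<lambda>n. infsum d UNIV - sum d (G n)) \<longlonglongrightarrow> 0"
  shows "(\<lambda>x. \<Sum>\<^sub>\<infinity>k. \<psi> k x) \<in> L2_space M"
    and "(\<lambda>n. L2_norm M (\<lambda>x. (\<Sum>k\<in>G n. \<psi> k x) - (\<Sum>\<^sub>\<infinity>k. \<psi> k x))) \<longlonglongrightarrow> 0"
proof -
  define r where "r n = infsum d UNIV - sum d (G n)" for n
  have r: "r \<longlonglongrightarrow> 0" using lim by (simp add: r_def[abs_def])
  have near: "\<bar>(\<Sum>k\<in>G n. \<psi> k x) - (\<Sum>\<^sub>\<infinity>k. \<psi> k x)\<bar> \<le> r n" if "x \<in> space M" for n x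
    using infsum_diff_finite_sum[OF d bound[OF that] G, of n] by (simp add: r_def abs_minus_commute)
  have meas': "(\<lambda>x. \<Sum>\<^sub>\<infinity>k. \<psi> k x) \<in> borel_measurable M"
  proof (rule borel_measurable_LIMSEQ_real)
    show "(\<lambda>n. \<Sum>k\<in>G n. \<psi> k x) \<longlonglongrightarrow> (\<Sum>\<^sub>\<infinity>k. \<psi> k x)" if "x \<in> space M" for x
      by (rule Lim_null[THEN iffD2], rule Lim_null_comparison[OF _ r]) (use near that in simp)
    show "(\<lambda>x. \<Sum>k\<in>G n. \<psi> k x) \<in> borel_measurable M" for n
      using meas by (intro borel_measurable_sum)
  qed
  show "(\<lambda>x. \<Sum>\<^sub>\<infinity>k. \<psi> k x) \<in> L2_space M"
    by (rule L2_bounded[OF M meas', of "infsum d UNIV"]) (intro infsum_dominated_bound d bound)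
  show "(\<lambda>n. L2_norm M (\<lambda>x. (\<Sum>k\<in>G n. \<psi> k x) - (\<Sum>\<^sub>\<infinity>k. \<psi> k x))) \<longlonglongrightarrow> 0"
  proof (cases "space M = {}")
    case True
    then show ?thesis by (simp add: L2_norm_def L2_inner_def Bochner_Integration.integral_empty)
  next
    case False
    then have r0: "0 \<le> r n" for n
      using near[of _ n] by (meson abs_ge_zero ex_in_conv order_trans)
    show ?thesis
    proof (rule Lim_null_comparison)
      show "\<forall>\<^sub>F n in sequentially. norm (L2_norm M (\<lambda>x. (\<Sum>k\<in>G n. \<psi> k x) - (\<Sum>\<^sub>\<infinity>k. \<psi> k x)))
          \<le> r n * sqrt (measure M (space M))"
        using near r0 meas meas'
        by (intro always_eventually allI) (auto simp: L2_norm_nonneg intro!: L2_norm_le_bound M)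
      show "(\<lambda>n. r n * sqrt (measure M (space M))) \<longlonglongrightarrow> 0"
        using tendsto_mult_right[OF r, of "sqrt (measure M (space M))"] by simp
    qed
  qed
qed

lemma exp_remainder2: "\<bar>exp z - 1 - z\<bar> \<le> z\<^sup>2 * exp \<bar>z\<bar>" for z :: real
proof -
  obtain s where s: "\<bar>s\<bar> \<le> \<bar>z\<bar>"
    and e: "exp z = (\<Sum>m<2. z ^ m / fact m) + exp s / fact 2 * z ^ 2"
    using Maclaurin_exp_le[of z 2] by blast
  have "exp s \<le> exp \<bar>z\<bar>" using s by simp
  then have "exp s * z\<^sup>2 \<le> exp \<bar>z\<bar> * z\<^sup>2" by (rule mult_right_mono) simp
  moreover have "exp z - 1 - z = exp s * z\<^sup>2 / 2"
    using e by (simp add: numeral_2_eq_2)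
  moreover have "0 \<le> exp s * z\<^sup>2" by simp
  ultimately have "\<bar>exp z - 1 - z\<bar> \<le> exp \<bar>z\<bar> * z\<^sup>2" by linarith
  then show ?thesis by (simp add: mult.commute)
qed

section \<open>The heat trace of an operator with an eigenbasis\<close>

text \<open>
  The properties of an operator, given by its graph, that determine its heat trace.  The assumption
  on inner products is symmetry tested on eigenfunctions and gives uniqueness of the evolution; the
  last assumption puts uniformly convergent eigenfunction series into the graph and gives existence.
\<close>

locale L2_eigenbasis =
  fixes M :: "'a measure" and A :: "(('a \<Rightarrow> real) \<times> ('a \<Rightarrow> real)) set"
    and \<phi> :: "'k \<Rightarrow> 'a \<Rightarrow> real" and lam :: "'k \<Rightarrow> real" and C :: real
  assumes finite_M: "finite_measure M"
    and inj_phi: "inj \<phi>"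
    and basis: "L2_orthonormal_basis M (range \<phi>)"
    and phi_bound: "\<And>k x. \<bar>\<phi> k x\<bar> \<le> C"
    and lam_nonneg: "\<And>k. 0 \<le> lam k"
    and heat_summable: "\<And>t. 0 < t \<Longrightarrow> (\<lambda>k. exp (- t * lam k)) summable_on UNIV"
    and operator_L2: "\<And>u w. (u, w) \<in> A \<Longrightarrow> u \<in> L2_space M \<and> w \<in> L2_space M"
    and operator_inner: "\<And>u w k. (u, w) \<in> A \<Longrightarrow> L2_inner M w (\<phi> k) = lam k * L2_inner M u (\<phi> k)"
    and operator_series: "\<And>c. (\<lambda>k. \<bar>c k\<bar> * (1 + lam k)) summable_on UNIV \<Longrightarrow>
       ((\<lambda>x. \<Sum>\<^sub>\<infinity>k. c k * \<phi> k x), (\<lambda>x. \<Sum>\<^sub>\<infinity>k. lam k * c k * \<phi> k x)) \<in> A"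
begin

lemma phi_L2: "\<phi> k \<in> L2_space M"
  using basis by (auto simp: L2_orthonormal_basis_def)

lemma phi_inner: "L2_inner M (\<phi> j) (\<phi> k) = (if j = k then 1 else 0)"
  using basis inj_phi by (auto simp: L2_orthonormal_basis_def inj_def)

lemma phi_norm: "L2_norm M (\<phi> k) = 1"
  by (simp add: L2_norm_def phi_inner)

lemma C_nonneg: "0 \<le> C"
  using phi_bound[of undefined undefined] by linarith

lemma inner_phi_bound: "f \<in> L2_space M \<Longrightarrow> \<bar>L2_inner M f (\<phi> k)\<bar> \<le> L2_norm M f"
  using L2_Cauchy_Schwarz[of f M "\<phi> k"] by (simp add: phi_L2 phi_norm)

lemma Parseval: "f \<in> L2_space M \<Longrightarrow> ((\<lambda>k. (L2_inner M f (\<phi> k))\<^sup>2) has_sum L2_inner M f f) UNIV"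
  using L2_Parseval[OF basis, of f] has_sum_reindex[OF inj_phi, of "\<lambda>e. (L2_inner M f e)\<^sup>2"]
  by (simp add: o_def)

lemma Parseval_inner:
  "f \<in> L2_space M \<Longrightarrow> g \<in> L2_space M \<Longrightarrow>
    ((\<lambda>k. L2_inner M f (\<phi> k) * L2_inner M g (\<phi> k)) has_sum L2_inner M f g) UNIV"
  using L2_Parseval_inner[OF basis, of f g]
    has_sum_reindex[OF inj_phi, of "\<lambda>e. L2_inner M f e * L2_inner M g e"]
  by (simp add: o_def)

definition series :: "('k \<Rightarrow> real) \<Rightarrow> 'a \<Rightarrow> real" where
  "series c = (\<lambda>x. \<Sum>\<^sub>\<infinity>k. c k * \<phi> k x)"

lemma term_bound: "\<bar>c k * \<phi> k x\<bar> \<le> C * \<bar>c k\<bar>"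
  using mult_left_mono[OF phi_bound, of "\<bar>c k\<bar>" k x] by (simp add: abs_mult mult.commute)

lemma abs_summable_cmult: "(\<lambda>k. \<bar>c k\<bar>) summable_on UNIV \<Longrightarrow> (\<lambda>k. C * \<bar>c k\<bar>) summable_on UNIV"
  by (rule summable_on_cmult_right)

lemma series_bound:
  assumes "(\<lambda>k. \<bar>c k\<bar>) summable_on UNIV"
  shows "\<bar>series c x\<bar> \<le> C * (\<Sum>\<^sub>\<infinity>k. \<bar>c k\<bar>)"
  using infsum_dominated_bound[OF abs_summable_cmult[OF assms], of "\<lambda>k. c k * \<phi> k x"] term_bound
  by (simp add: series_def infsum_cmult_right')

lemma series_L2_inner:
  assumes c: "(\<lambda>k. \<bar>c k\<bar>) summable_on UNIV"
  shows series_L2: "series c \<in> L2_space M" and series_inner: "L2_inner M (series c) (\<phi> j) = c j"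
proof -
  have cC: "(\<lambda>k. C * \<bar>c k\<bar>) summable_on UNIV" by (rule abs_summable_cmult[OF c])
  obtain G :: "nat \<Rightarrow> 'k set" where G: "\<And>n. finite (G n)"
    and lim: "(\<lambda>n. (\<Sum>\<^sub>\<infinity>k. \<bar>c k\<bar>) - (\<Sum>k\<in>G n. \<bar>c k\<bar>)) \<longlonglongrightarrow> 0"
    using summable_exhaustion[OF c] by auto
  define U where "U n x = (\<Sum>k\<in>G n. c k * \<phi> k x)" for n x
  define r where "r n = (\<Sum>\<^sub>\<infinity>k. \<bar>c k\<bar>) - (\<Sum>k\<in>G n. \<bar>c k\<bar>)" for n
  have r: "r \<longlonglongrightarrow> 0" using lim by (simp add: r_def[abs_def])
  have r0: "0 \<le> r n" for n
    using infsum_diff_finite_sum[OF c _ G, of "\<lambda>_. 0" n] by (simp add: r_def)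
  have rC: "(\<lambda>n. infsum (\<lambda>k. C * \<bar>c k\<bar>) UNIV - (\<Sum>k\<in>G n. C * \<bar>c k\<bar>)) \<longlonglongrightarrow> 0"
    using tendsto_mult_left[OF lim, of C]
    by (simp add: infsum_cmult_right' sum_distrib_left[symmetric] right_diff_distrib)
  have UL: "U n \<in> L2_space M" for n
    unfolding U_def by (intro L2_sum L2_cmult phi_L2)
  have meas: "(\<lambda>x. c k * \<phi> k x) \<in> borel_measurable M" for k
    using L2_spaceD(1)[OF phi_L2] by simp
  note dom = dominated_series_L2[of M "\<lambda>k x. c k * \<phi> k x", OF finite_M meas cC _ G rC, OF term_bound[of c]]
  show SL: "series c \<in> L2_space M"
    unfolding series_def by (rule dom(1))
  have "(\<lambda>n. L2_norm M (\<lambda>x. U n x - series c x)) \<longlonglongrightarrow> 0"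
    unfolding series_def U_def by (rule dom(2))
  then have 1: "(\<lambda>n. L2_inner M (U n) (\<phi> j)) \<longlonglongrightarrow> L2_inner M (series c) (\<phi> j)"
    using UL by (intro L2_inner_tendsto SL phi_L2) auto
  have Uj: "L2_inner M (U n) (\<phi> j) = (if j \<in> G n then c j else 0)" for n
  proof -
    have "L2_inner M (U n) (\<phi> j) = (\<Sum>k\<in>G n. c k * L2_inner M (\<phi> k) (\<phi> j))"
      unfolding U_def by (subst L2_inner_sum_left) (auto intro: L2_cmult phi_L2 simp: L2_inner_cmult_left)
    also have "\<dots> = (\<Sum>k\<in>G n. if k = j then c k else 0)"
      by (intro sum.cong) (auto simp: phi_inner)
    finally show ?thesis using G by simp
  qed
  have 2: "(\<lambda>n. L2_inner M (U n) (\<phi> j)) \<longlonglongrightarrow> c j"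
  proof (rule Lim_null[THEN iffD2], rule Lim_null_comparison[OF _ r])
    have "\<bar>c j\<bar> \<le> r n" if "j \<notin> G n" for n
      using finite_sum_le_infsum[OF c, of "insert j (G n)"] that G[of n] by (simp add: r_def)
    then show "\<forall>\<^sub>F n in sequentially. norm (L2_inner M (U n) (\<phi> j) - c j) \<le> r n"
      using r0 by (intro always_eventually allI) (simp add: Uj)
  qed
  show "L2_inner M (series c) (\<phi> j) = c j"
    by (rule LIMSEQ_unique[OF 1 2])
qed

lemma series_add:
  assumes "(\<lambda>k. \<bar>c k\<bar>) summable_on UNIV" "(\<lambda>k. \<bar>d k\<bar>) summable_on UNIV"
  shows "series (\<lambda>k. c k + d k) x = series c x + series d x"
  unfolding series_def distrib_right
  by (intro infsum_add summable_dominated[OF abs_summable_cmult term_bound] assms)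

lemma series_cmult: "series (\<lambda>k. a * c k) x = a * series c x"
  unfolding series_def mult.assoc by (rule infsum_cmult_right')

text \<open>
  Half of the exponential decay absorbs any fixed power of the eigenvalue, because
  \<open>y \<le> exp y\<close> with \<open>y = t * lam k / 4\<close>.
\<close>

lemma weight_bound:
  assumes "0 < t"
  shows "(1 + lam k)\<^sup>2 * exp (- t * lam k) \<le> (1 + 4 / t)\<^sup>2 * exp (- (t / 2) * lam k)"
proof -
  have e: "t * lam k / 4 \<le> exp (t * lam k / 4)"
    using exp_ge_add_one_self[of "t * lam k / 4"] by linarith
  then have "lam k \<le> 4 / t * exp (t * lam k / 4)"
    using assms by (simp add: field_simps)
  moreover have "1 \<le> exp (t * lam k / 4)"
    using assms lam_nonneg[of k] by simp
  ultimately have "1 + lam k \<le> (1 + 4 / t) * exp (t * lam k / 4)"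
    unfolding distrib_right by linarith
  then have "(1 + lam k)\<^sup>2 \<le> ((1 + 4 / t) * exp (t * lam k / 4))\<^sup>2"
    using lam_nonneg[of k] by (intro power_mono) auto
  also have "\<dots> = (1 + 4 / t)\<^sup>2 * exp (t * lam k / 2)"
    by (simp add: power_mult_distrib exp_double[symmetric])
  finally have "(1 + lam k)\<^sup>2 * exp (- t * lam k) \<le> (1 + 4 / t)\<^sup>2 * exp (t * lam k / 2) * exp (- t * lam k)"
    by (rule mult_right_mono) simp
  also have "\<dots> = (1 + 4 / t)\<^sup>2 * exp (- (t / 2) * lam k)"
    by (simp add: mult.assoc exp_add[symmetric])
  finally show ?thesis .
qed

lemma weighted_heat_summable:
  assumes "0 < t"
  shows "(\<lambda>k. (1 + lam k)\<^sup>2 * exp (- t * lam k)) summable_on UNIV"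
  by (rule summable_on_comparison_test[OF summable_on_cmult_right[OF heat_summable[of "t/2"], of "(1 + 4 / t)\<^sup>2"]])
     (use assms weight_bound[OF assms] in auto)

definition heat_coeff :: "('a \<Rightarrow> real) \<Rightarrow> real \<Rightarrow> 'k \<Rightarrow> real" where
  "heat_coeff f t k = exp (- t * lam k) * L2_inner M f (\<phi> k)"

lemma heat_coeff_summable:
  assumes f: "f \<in> L2_space M" and t: "0 < t"
  shows heat_coeff_summable2: "(\<lambda>k. \<bar>heat_coeff f t k\<bar> * (1 + lam k)\<^sup>2) summable_on UNIV"
    and heat_coeff_summable1: "(\<lambda>k. \<bar>heat_coeff f t k\<bar> * (1 + lam k)) summable_on UNIV"
    and heat_coeff_summable0: "(\<lambda>k. \<bar>heat_coeff f t k\<bar>) summable_on UNIV"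
    and heat_coeff_summable_lam: "(\<lambda>k. \<bar>lam k * heat_coeff f t k\<bar>) summable_on UNIV"
proof -
  have "\<bar>heat_coeff f t k\<bar> * (1 + lam k)\<^sup>2 \<le> L2_norm M f * ((1 + lam k)\<^sup>2 * exp (- t * lam k))" for k
    using mult_right_mono[OF inner_phi_bound[OF f, of k], of "(1 + lam k)\<^sup>2 * exp (- t * lam k)"]
    by (simp add: heat_coeff_def abs_mult mult_ac)
  then show 2: "(\<lambda>k. \<bar>heat_coeff f t k\<bar> * (1 + lam k)\<^sup>2) summable_on UNIV"
    by (intro summable_on_comparison_test[OF summable_on_cmult_right[OF weighted_heat_summable[OF t], of "L2_norm M f"]])
       auto
  have w: "1 + lam k \<le> (1 + lam k)\<^sup>2" for k
    using lam_nonneg[of k] by (simp add: power2_eq_square algebra_simps)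
  show 1: "(\<lambda>k. \<bar>heat_coeff f t k\<bar> * (1 + lam k)) summable_on UNIV"
    by (rule summable_on_comparison_test[OF 2]) (use w lam_nonneg in \<open>auto intro!: mult_left_mono\<close>)
  show "(\<lambda>k. \<bar>heat_coeff f t k\<bar>) summable_on UNIV"
    by (rule summable_on_comparison_test[OF 1]) (use lam_nonneg in \<open>auto simp: algebra_simps\<close>)
  show "(\<lambda>k. \<bar>lam k * heat_coeff f t k\<bar>) summable_on UNIV"
    by (rule summable_on_comparison_test[OF 1])
       (use lam_nonneg in \<open>auto simp: abs_mult algebra_simps\<close>)
qed

text \<open>
  The solution of the Cauchy problem.  At time 0 it has to be \<open>f\<close> itself, not merely equal to \<open>f\<close>
  almost everywhere, and there the eigenfunction series need not converge pointwise.
\<close>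

definition heat :: "('a \<Rightarrow> real) \<Rightarrow> real \<Rightarrow> 'a \<Rightarrow> real" where
  "heat f t = (if t = 0 then f else series (heat_coeff f t))"

lemma heat_L2: "f \<in> L2_space M \<Longrightarrow> 0 \<le> t \<Longrightarrow> heat f t \<in> L2_space M"
  by (cases "t = 0") (simp_all add: heat_def series_L2[OF heat_coeff_summable0])

text \<open>
  By Parseval's identity the squared distance is
  \<open>\<Sum>k. (1 - exp (- t * lam k))\<^sup>2 * (c k)\<^sup>2\<close>.  The terms are dominated by \<open>(c k)\<^sup>2\<close>, so the tail is
  small uniformly in \<open>t\<close>, and the finitely many remaining terms tend to 0.
\<close>

lemma heat_continuous_at_0:
  assumes f: "f \<in> L2_space M"
  shows "((\<lambda>t. L2_norm M (\<lambda>x. heat f t x - f x)) \<longlongrightarrow> 0) (at_right 0)"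
proof -
  define c where "c k = L2_inner M f (\<phi> k)" for k
  define N where "N t = L2_inner M (\<lambda>x. heat f t x - f x) (\<lambda>x. heat f t x - f x)" for t
  have c: "((\<lambda>k. (c k)\<^sup>2) has_sum L2_inner M f f) UNIV"
    unfolding c_def by (rule Parseval[OF f])
  have N: "((\<lambda>k. (1 - exp (- t * lam k))\<^sup>2 * (c k)\<^sup>2) has_sum N t) UNIV" if "0 < t" for t
  proof -
    have "L2_inner M (\<lambda>x. heat f t x - f x) (\<phi> k) = (exp (- t * lam k) - 1) * c k" for k
      using that f
      by (simp add: L2_inner_diff_left heat_L2 phi_L2)
         (simp add: heat_def series_inner[OF heat_coeff_summable0[OF f that]],
          simp add: heat_coeff_def c_def algebra_simps)
    then show ?thesis
      using Parseval[OF L2_diff[OF heat_L2[OF f] f], of t] that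
      by (simp add: N_def power_mult_distrib power2_commute)
  qed
  have "(N \<longlongrightarrow> 0) (at_right 0)"
    unfolding tendsto_iff
  proof (intro allI impI)
    fix \<epsilon> :: real assume "0 < \<epsilon>"
    then obtain F where F: "finite F" and Fe: "L2_inner M f f - (\<Sum>k\<in>F. (c k)\<^sup>2) \<le> \<epsilon> / 2"
    proof -
      obtain F where "finite F" "dist (\<Sum>k\<in>F. (c k)\<^sup>2) (L2_inner M f f) \<le> \<epsilon> / 2"
        using has_sum_finite_approximation[OF c, of "\<epsilon> / 2"] \<open>0 < \<epsilon>\<close> by auto
      then show thesis unfolding dist_real_def by (intro that[of F]) (simp, linarith)
    qed
    have bound: "N t \<le> (\<Sum>k\<in>F. (1 - exp (- t * lam k))\<^sup>2 * (c k)\<^sup>2) + \<epsilon> / 2" if t: "0 < t" for t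
    proof -
      \<comment> \<open>\<open>(c k)\<^sup>2 + g k\<close> is the true term on \<open>F\<close> and the dominating term elsewhere.\<close>
      define g where "g k = (if k \<in> F then (1 - exp (- t * lam k))\<^sup>2 * (c k)\<^sup>2 - (c k)\<^sup>2 else 0)" for k
      have "(g has_sum (\<Sum>k\<in>F. g k)) UNIV"
        using has_sum_finite[OF F, of g]
        by (rule has_sum_cong_neutral[THEN iffD1, rotated -1]) (auto simp: g_def)
      then have "((\<lambda>k. (c k)\<^sup>2 + g k) has_sum (L2_inner M f f + (\<Sum>k\<in>F. g k))) UNIV"
        by (intro has_sum_add c)
      moreover have "(1 - exp (- t * lam k))\<^sup>2 * (c k)\<^sup>2 \<le> (c k)\<^sup>2 + g k" for k
      proof -
        have "(1 - exp (- t * lam k))\<^sup>2 \<le> 1\<^sup>2"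
          using t lam_nonneg[of k] by (intro power_mono) auto
        then have "(1 - exp (- t * lam k))\<^sup>2 * (c k)\<^sup>2 \<le> 1 * (c k)\<^sup>2"
          by (intro mult_right_mono) auto
        then show ?thesis by (simp add: g_def)
      qed
      ultimately have "N t \<le> L2_inner M f f + (\<Sum>k\<in>F. g k)"
        by (intro has_sum_mono[OF N[OF t]]) auto
      also have "(\<Sum>k\<in>F. g k) = (\<Sum>k\<in>F. (1 - exp (- t * lam k))\<^sup>2 * (c k)\<^sup>2) - (\<Sum>k\<in>F. (c k)\<^sup>2)"
        by (simp add: g_def sum_subtractf)
      finally show ?thesis using Fe by simp
    qed
    have "((\<lambda>t. \<Sum>k\<in>F. (1 - exp (- t * lam k))\<^sup>2 * (c k)\<^sup>2) \<longlongrightarrow>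
        (\<Sum>k\<in>F. (1 - exp (- 0 * lam k))\<^sup>2 * (c k)\<^sup>2)) (at_right 0)"
      by (intro tendsto_intros)
    then have "\<forall>\<^sub>F t in at_right 0. dist (\<Sum>k\<in>F. (1 - exp (- t * lam k))\<^sup>2 * (c k)\<^sup>2) 0 < \<epsilon> / 2"
      using \<open>0 < \<epsilon>\<close> by (intro tendstoD) auto
    then show "\<forall>\<^sub>F t in at_right 0. dist (N t) 0 < \<epsilon>"
      using eventually_at_right_less[of 0]
    proof eventually_elim
      case (elim t)
      then show ?case
        using bound[of t] L2_inner_nonneg[of M "\<lambda>x. heat f t x - f x"]
        by (simp add: N_def dist_real_def)
    qed
  qed
  from tendsto_real_sqrt[OF this] show ?thesis
    by (simp add: N_def L2_norm_def)
qed

text \<open>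
  The second order Taylor remainder of the exponential, with \<open>z = - (s - t) * lam k\<close>.  The
  restriction on \<open>s\<close> leaves half of the decay, \<open>exp (- (t / 2) * lam k)\<close>, to make the bound summable.
\<close>

lemma heat_coeff_derivative_bound:
  assumes f: "f \<in> L2_space M" and t: "0 < t" and s: "s \<noteq> t" "\<bar>s - t\<bar> \<le> t / 2"
  shows "\<bar>(heat_coeff f s k - heat_coeff f t k) / (s - t) + lam k * heat_coeff f t k\<bar>
    \<le> \<bar>s - t\<bar> * (\<bar>heat_coeff f (t / 2) k\<bar> * (1 + lam k)\<^sup>2)"
proof -
  define z where "z = - (s - t) * lam k"
  have es: "exp (- s * lam k) = exp (- t * lam k) * exp z"
    by (simp add: z_def exp_add[symmetric] algebra_simps)
  have "(heat_coeff f s k - heat_coeff f t k) / (s - t) + lam k * heat_coeff f t k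
      = (heat_coeff f s k - heat_coeff f t k + (s - t) * lam k * heat_coeff f t k) / (s - t)"
    using s(1) by (simp add: field_simps)
  also have "heat_coeff f s k - heat_coeff f t k + (s - t) * lam k * heat_coeff f t k
      = exp (- t * lam k) * (exp z - 1 - z) * L2_inner M f (\<phi> k)"
    unfolding heat_coeff_def es by (simp add: z_def algebra_simps)
  finally have eq: "\<bar>(heat_coeff f s k - heat_coeff f t k) / (s - t) + lam k * heat_coeff f t k\<bar>
      = exp (- t * lam k) * \<bar>exp z - 1 - z\<bar> * \<bar>L2_inner M f (\<phi> k)\<bar> / \<bar>s - t\<bar>"
    by (simp add: abs_mult)
  have "exp (- t * lam k) * \<bar>exp z - 1 - z\<bar> \<le> exp (- t * lam k) * (z\<^sup>2 * exp \<bar>z\<bar>)"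
    by (intro mult_left_mono exp_remainder2) auto
  also have "\<dots> = z\<^sup>2 * exp (- t * lam k + \<bar>z\<bar>)"
    by (simp only: exp_add mult_ac)
  also have "\<dots> \<le> z\<^sup>2 * exp (- (t / 2) * lam k)"
  proof -
    have "\<bar>z\<bar> \<le> t / 2 * lam k"
      using mult_right_mono[OF s(2) lam_nonneg[of k]] lam_nonneg[of k]
      by (simp add: z_def abs_mult abs_minus_commute)
    then show ?thesis by (intro mult_left_mono) (auto simp: algebra_simps)
  qed
  also have "\<dots> \<le> (s - t)\<^sup>2 * (1 + lam k)\<^sup>2 * exp (- (t / 2) * lam k)"
    using lam_nonneg[of k]
    by (intro mult_right_mono)
       (auto simp: z_def power_mult_distrib power2_commute[of t s] intro!: mult_left_mono power_mono)
  finally have "exp (- t * lam k) * \<bar>exp z - 1 - z\<bar> * \<bar>L2_inner M f (\<phi> k)\<bar>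
      \<le> (s - t)\<^sup>2 * (1 + lam k)\<^sup>2 * exp (- (t / 2) * lam k) * \<bar>L2_inner M f (\<phi> k)\<bar>"
    by (rule mult_right_mono) simp
  also have "\<dots> = \<bar>s - t\<bar> * (\<bar>s - t\<bar> * (\<bar>heat_coeff f (t / 2) k\<bar> * (1 + lam k)\<^sup>2))"
    by (simp add: heat_coeff_def abs_mult power2_eq_square mult_ac)
  finally show ?thesis
    unfolding eq using s(1) by (simp add: field_simps)
qed

lemma heat_derivative:
  assumes f: "f \<in> L2_space M" and t: "0 < t"
  shows "((\<lambda>s. L2_norm M (\<lambda>x. (heat f s x - heat f t x) / (s - t)
      + series (\<lambda>k. lam k * heat_coeff f t k) x)) \<longlongrightarrow> 0) (at t)"
proof -
  define D where "D s k = (heat_coeff f s k - heat_coeff f t k) / (s - t) + lam k * heat_coeff f t k" for s k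
  define K where "K = (\<Sum>\<^sub>\<infinity>k. \<bar>heat_coeff f (t / 2) k\<bar> * (1 + lam k)\<^sup>2)"
  have K: "(\<lambda>k. \<bar>heat_coeff f (t / 2) k\<bar> * (1 + lam k)\<^sup>2) summable_on UNIV"
    using t by (intro heat_coeff_summable2 f) simp
  have "\<forall>\<^sub>F s in at t. s \<noteq> t \<and> dist s t < t / 2"
    using t unfolding eventually_at by (intro exI[of _ "t / 2"]) auto
  then have ev: "\<forall>\<^sub>F s in at t. norm (L2_norm M (\<lambda>x. (heat f s x - heat f t x) / (s - t)
      + series (\<lambda>k. lam k * heat_coeff f t k) x)) \<le> C * (\<bar>s - t\<bar> * K) * sqrt (measure M (space M))"
  proof eventually_elim
    case (elim s)
    then have s: "s \<noteq> t" "\<bar>s - t\<bar> \<le> t / 2" "0 < s"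
      by (auto simp: dist_real_def abs_if split: if_splits)
    have Dsum: "(\<lambda>k. \<bar>D s k\<bar>) summable_on UNIV"
      by (rule summable_on_comparison_test[OF summable_on_cmult_right[OF K, of "\<bar>s - t\<bar>"]])
         (use heat_coeff_derivative_bound[OF f t s(1,2)] in \<open>auto simp: D_def\<close>)
    have "(\<Sum>\<^sub>\<infinity>k. \<bar>D s k\<bar>) \<le> (\<Sum>\<^sub>\<infinity>k. \<bar>s - t\<bar> * (\<bar>heat_coeff f (t / 2) k\<bar> * (1 + lam k)\<^sup>2))"
      using heat_coeff_derivative_bound[OF f t s(1,2)]
      by (intro infsum_mono Dsum summable_on_cmult_right K) (auto simp: D_def)
    then have Dle: "(\<Sum>\<^sub>\<infinity>k. \<bar>D s k\<bar>) \<le> \<bar>s - t\<bar> * K"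
      by (simp add: infsum_cmult_right' K_def)
    have "(heat f s x - heat f t x) / (s - t) + series (\<lambda>k. lam k * heat_coeff f t k) x = series (D s) x" for x
    proof -
      have sums: "(\<lambda>k. \<bar>heat_coeff f s k\<bar>) summable_on UNIV" "(\<lambda>k. \<bar>heat_coeff f t k\<bar>) summable_on UNIV"
         "(\<lambda>k. \<bar>lam k * heat_coeff f t k\<bar>) summable_on UNIV"
        using s t f by (auto intro: heat_coeff_summable)
      have m: "(\<lambda>k. \<bar>a * c k\<bar>) summable_on UNIV" if "(\<lambda>k. \<bar>c k\<bar>) summable_on UNIV" for a and c :: "'k \<Rightarrow> real"
        using summable_on_cmult_right[OF that, of "\<bar>a\<bar>"] by (simp add: abs_mult)
      have "series (D s) x = series (\<lambda>k. (1 / (s - t) * heat_coeff f s k + (- 1 / (s - t)) * heat_coeff f t k)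
          + lam k * heat_coeff f t k) x"
        by (simp add: D_def[abs_def] diff_divide_distrib)
      also have "\<dots> = series (\<lambda>k. 1 / (s - t) * heat_coeff f s k + (- 1 / (s - t)) * heat_coeff f t k) x
          + series (\<lambda>k. lam k * heat_coeff f t k) x"
      proof (rule series_add[OF _ sums(3)])
        show "(\<lambda>k. \<bar>1 / (s - t) * heat_coeff f s k + (- 1 / (s - t)) * heat_coeff f t k\<bar>) summable_on UNIV"
          by (rule summable_on_comparison_test[OF summable_on_add[OF
                m[OF sums(1), of "1 / (s - t)"] m[OF sums(2), of "- 1 / (s - t)"]]])
             (use abs_triangle_ineq in blast, simp)
      qed
      also have "series (\<lambda>k. 1 / (s - t) * heat_coeff f s k + (- 1 / (s - t)) * heat_coeff f t k) x
          = 1 / (s - t) * series (heat_coeff f s) x + (- 1 / (s - t)) * series (heat_coeff f t) x"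
        by (subst series_add[OF m[OF sums(1)] m[OF sums(2)]]) (simp only: series_cmult)
      finally show ?thesis
        using s t by (simp add: heat_def diff_divide_distrib)
    qed
    then have "L2_norm M (\<lambda>x. (heat f s x - heat f t x) / (s - t) + series (\<lambda>k. lam k * heat_coeff f t k) x)
        = L2_norm M (series (D s))" by presburger
    also have "\<dots> \<le> C * (\<Sum>\<^sub>\<infinity>k. \<bar>D s k\<bar>) * sqrt (measure M (space M))"
      by (intro L2_norm_le_bound finite_M series_bound[OF Dsum] L2_spaceD(1)[OF series_L2[OF Dsum]]
          mult_nonneg_nonneg C_nonneg infsum_nonneg) auto
    also have "\<dots> \<le> C * (\<bar>s - t\<bar> * K) * sqrt (measure M (space M))"
      by (intro mult_right_mono mult_left_mono Dle C_nonneg) auto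
    finally show ?case by (simp add: L2_norm_nonneg)
  qed
  have "((\<lambda>s. C * (\<bar>s - t\<bar> * K) * sqrt (measure M (space M))) \<longlongrightarrow>
      C * (\<bar>t - t\<bar> * K) * sqrt (measure M (space M))) (at t)"
    by (intro tendsto_intros)
  then show ?thesis by (intro Lim_null_comparison[OF ev]) simp
qed

lemma heat_evolution:
  assumes f: "f \<in> L2_space M"
  shows "L2_evolution M A f (heat f)"
  unfolding L2_evolution_def
proof (intro conjI allI impI)
  show "heat f 0 = f" by (simp add: heat_def)
  show "heat f t \<in> L2_space M" if "0 \<le> t" for t
    using heat_L2[OF f that] .
  show "((\<lambda>t. L2_norm M (\<lambda>x. heat f t x - f x)) \<longlongrightarrow> 0) (at_right 0)"
    by (rule heat_continuous_at_0[OF f])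
  show "\<exists>w. (heat f t, w) \<in> A \<and>
      ((\<lambda>s. L2_norm M (\<lambda>x. (heat f s x - heat f t x) / (s - t) + w x)) \<longlongrightarrow> 0) (at t)" if t: "0 < t" for t
    using operator_series[OF heat_coeff_summable1[OF f t]] heat_derivative[OF f t] t
    by (intro exI[of _ "series (\<lambda>k. lam k * heat_coeff f t k)"]) (simp add: heat_def series_def)
qed

text \<open>
  Testing the evolution equation with an eigenfunction gives a scalar equation: the coefficient
  \<open>g\<close> satisfies \<open>g' = - lam k * g\<close> for positive times, so \<open>exp (t * lam k) * g t\<close> is constant, and
  continuity at 0 identifies the constant.  Hence any two solutions agree almost everywhere.
\<close>

lemma evolution_coeff:
  assumes u: "L2_evolution M A f u" and f: "f \<in> L2_space M" and t: "0 < t"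
  shows "L2_inner M (u t) (\<phi> k) = exp (- t * lam k) * L2_inner M f (\<phi> k)"
proof -
  define g where "g t = L2_inner M (u t) (\<phi> k)" for t
  have uL: "u t \<in> L2_space M" if "0 \<le> t" for t
    using u that by (simp add: L2_evolution_def)
  have deriv: "(g has_field_derivative - lam k * g t) (at t)" if t: "0 < t" for t
  proof -
    obtain w where w: "(u t, w) \<in> A"
      and lim: "((\<lambda>s. L2_norm M (\<lambda>x. (u s x - u t x) / (s - t) + w x)) \<longlongrightarrow> 0) (at t)"
      using u t by (auto simp: L2_evolution_def)
    have wL: "w \<in> L2_space M" using operator_L2[OF w] by simp
    have ev: "\<forall>\<^sub>F s in at t. 0 < s"
      using t by (intro eventually_at_in_open'[of "{0<..}" t, simplified]) auto
    have dL: "(\<lambda>x. (u s x - u t x) / (s - t)) \<in> L2_space M" if "0 < s" for s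
      using L2_cmult[OF L2_diff[OF uL[of s] uL[of t]], of "1 / (s - t)"] that t by simp
    have "((\<lambda>s. L2_inner M (\<lambda>x. (u s x - u t x) / (s - t)) (\<phi> k)) \<longlongrightarrow> L2_inner M (\<lambda>x. - w x) (\<phi> k)) (at t)"
    proof (rule L2_inner_tendsto[OF _ L2_uminus[OF wL] phi_L2])
      show "\<forall>\<^sub>F s in at t. (\<lambda>x. (u s x - u t x) / (s - t)) \<in> L2_space M"
        using ev by eventually_elim (rule dL)
      show "((\<lambda>s. L2_norm M (\<lambda>x. (u s x - u t x) / (s - t) - - w x)) \<longlongrightarrow> 0) (at t)"
        using lim by simp
    qed
    moreover have "L2_inner M (\<lambda>x. - w x) (\<phi> k) = - lam k * g t"
      using L2_inner_cmult_left[of M "-1" w "\<phi> k"] operator_inner[OF w] by (simp add: g_def)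
    moreover have "\<forall>\<^sub>F s in at t. L2_inner M (\<lambda>x. (u s x - u t x) / (s - t)) (\<phi> k) = (g s - g t) / (s - t)"
      using ev
    proof eventually_elim
      case (elim s)
      then show ?case
        using L2_inner_cmult_left[of M "1 / (s - t)" "\<lambda>x. u s x - u t x" "\<phi> k"] t
        by (simp add: g_def L2_inner_diff_left uL phi_L2)
    qed
    ultimately show ?thesis
      unfolding has_field_derivative_iff by (simp add: tendsto_cong)
  qed
  have "((\<lambda>t. exp (t * lam k) * g t) has_field_derivative 0) (at t within {0<..})" if "t \<in> {0<..}" for t
  proof -
    have "((\<lambda>t. exp (t * lam k)) has_field_derivative exp (t * lam k) * lam k) (at t)"
      by (auto intro!: derivative_eq_intros)
    from DERIV_mult[OF this deriv] that
    have "((\<lambda>t. exp (t * lam k) * g t) has_field_derivative 0) (at t)"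
      by (simp add: mult_ac)
    then show ?thesis by (rule DERIV_subset) simp
  qed
  then obtain c where c: "exp (t * lam k) * g t = c" if "0 < t" for t
    using has_field_derivative_zero_constant[of "{0<..}" "\<lambda>t. exp (t * lam k) * g t"] by auto
  have "((\<lambda>t. L2_norm M (\<lambda>x. u t x - f x)) \<longlongrightarrow> 0) (at_right 0)"
    using u by (simp add: L2_evolution_def)
  then have "(g \<longlongrightarrow> L2_inner M f (\<phi> k)) (at_right 0)"
    unfolding g_def using eventually_at_right_less[of "0::real"]
    by (intro L2_inner_tendsto f phi_L2) (auto elim!: eventually_mono intro: uL)
  then have "((\<lambda>t. exp (t * lam k) * g t) \<longlongrightarrow> exp (0 * lam k) * L2_inner M f (\<phi> k)) (at_right 0)"
    by (intro tendsto_intros)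
  moreover have "((\<lambda>t. exp (t * lam k) * g t) \<longlongrightarrow> c) (at_right 0)"
    using eventually_at_right_less[of "0::real"]
    by (intro tendsto_eventually) (auto elim!: eventually_mono intro: c)
  ultimately have "c = L2_inner M f (\<phi> k)"
    using tendsto_unique[of "at_right (0::real)"] by (auto simp: trivial_limit_at_right_real)
  with c[OF t] show ?thesis by (simp add: g_def exp_minus field_simps)
qed

text \<open>
  The choice in the definition of \<open>exp_neg\<close> is harmless: a solution exists, and all solutions
  have the same coefficients.
\<close>

lemma exp_neg_L2_inner:
  assumes f: "f \<in> L2_space M" and t: "0 < t"
  shows exp_neg_L2: "exp_neg M A t f \<in> L2_space M"
    and exp_neg_inner: "L2_inner M (exp_neg M A t f) (\<phi> k) = exp (- t * lam k) * L2_inner M f (\<phi> k)"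
proof -
  have "\<exists>u. L2_evolution M A f u \<and> exp_neg M A t f = u t"
    unfolding exp_neg_def
    by (rule someI_ex[of "\<lambda>g. \<exists>u. L2_evolution M A f u \<and> g = u t"]) (use heat_evolution[OF f] in blast)
  then obtain u where u: "L2_evolution M A f u" and e: "exp_neg M A t f = u t" by blast
  show "exp_neg M A t f \<in> L2_space M"
    using u t unfolding e by (simp add: L2_evolution_def)
  show "L2_inner M (exp_neg M A t f) (\<phi> k) = exp (- t * lam k) * L2_inner M f (\<phi> k)"
    unfolding e by (rule evolution_coeff[OF u f t])
qed

text \<open>
  The double family \<open>exp (- t * lam k) * \<langle>\<phi> k, e\<rangle>\<^sup>2\<close> is nonnegative and can be summed in either
  order.  Summing over the basis first gives \<open>exp (- t * lam k)\<close>, independently of the basis;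
  summing over \<open>k\<close> first gives the diagonal entry at \<open>e\<close>.
\<close>

theorem trace_exp_neg:
  assumes t: "0 < t"
  shows "L2_trace M (exp_neg M A t) = (\<Sum>\<^sub>\<infinity>k. exp (- t * lam k))"
proof -
  define S where "S = (\<Sum>\<^sub>\<infinity>k. exp (- t * lam k))"
  have tr: "((\<lambda>e. L2_inner M e (exp_neg M A t e)) has_sum S) B" if B: "L2_orthonormal_basis M B" for B
  proof -
    define F where "F = (\<lambda>(k, e). exp (- t * lam k) * (L2_inner M (\<phi> k) e)\<^sup>2)"
    have row: "((\<lambda>e. F (k, e)) has_sum exp (- t * lam k)) B" for k
      using has_sum_cmult_right[OF L2_Parseval[OF B phi_L2[of k]], of "exp (- t * lam k)"]
      by (simp add: F_def phi_inner)
    have "(F has_sum S) (UNIV \<times> B)"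
      unfolding S_def
      by (rule has_sum_SigmaI[OF row has_sum_infsum[OF heat_summable[OF t]]])
         (rule summable_on_SigmaI[OF row heat_summable[OF t]], simp add: F_def)
    then have swap: "((\<lambda>(e, k). F (k, e)) has_sum S) (B \<times> UNIV)"
      by (subst has_sum_swap) (simp add: case_prod_unfold)
    show ?thesis
    proof (rule has_sum_SigmaD[OF swap])
      fix e assume "e \<in> B"
      then have e: "e \<in> L2_space M" using B by (auto simp: L2_orthonormal_basis_def)
      show "((\<lambda>k. (case (e, k) of (e, k) \<Rightarrow> F (k, e))) has_sum L2_inner M e (exp_neg M A t e)) UNIV"
        using Parseval_inner[OF e exp_neg_L2[OF e t]]
        by (simp add: exp_neg_inner[OF e t] F_def L2_inner_commute[of M e] power2_eq_square mult_ac)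
    qed
  qed
  show ?thesis
    unfolding L2_trace_def S_def[symmetric]
  proof (rule the_equality)
    show "\<forall>B. L2_orthonormal_basis M B \<longrightarrow> ((\<lambda>e. L2_inner M e (exp_neg M A t e)) has_sum S) B"
      using tr by blast
    show "s = S" if "\<forall>B. L2_orthonormal_basis M B \<longrightarrow> ((\<lambda>e. L2_inner M e (exp_neg M A t e)) has_sum s) B" for s
      using that basis tr[OF basis] has_sum_unique by blast
  qed
qed

end

section \<open>The heat traces of an interval\<close>

text \<open>
  Differentiating the error \<open>E s\<close> on \<open>[a, s]\<close> leaves \<open>(s - a) * (f' y - f' s) / 2\<close> for some \<open>y\<close>
  between, and the variation of \<open>f'\<close> is controlled by that of \<open>H\<close>.  Because \<open>\<bar>f''\<bar>\<close> is
  bounded by the derivative of \<open>H\<close>, the error bounds of consecutive intervals of equal length telescope,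
  and a bounded \<open>H\<close> controls the error on the half line.
\<close>

lemma trapezoid_error:
  fixes F f f' f'' H H' :: "real \<Rightarrow> real"
  assumes F: "\<And>x. (F has_real_derivative f x) (at x)"
    and f: "\<And>x. (f has_real_derivative f' x) (at x)"
    and f': "\<And>x. (f' has_real_derivative f'' x) (at x)"
    and H: "\<And>x. (H has_real_derivative H' x) (at x)"
    and bound: "\<And>x. \<bar>f'' x\<bar> \<le> H' x"
    and ab: "a < b"
  shows "\<bar>F b - F a - (b - a) * (f a + f b) / 2\<bar> \<le> (b - a)\<^sup>2 * (H b - H a) / 2"
proof -
  have H': "0 \<le> H' x" for x using bound[of x] by linarith
  have Hmono: "H x \<le> H y" if "x \<le> y" for x y
    using that by (rule DERIV_nonneg_imp_nondecreasing) (use H H' in blast)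
  \<comment> \<open>Both \<open>H - f'\<close> and \<open>H + f'\<close> are nondecreasing.\<close>
  have var: "\<bar>f' y - f' x\<bar> \<le> H y - H x" if "x \<le> y" for x y
  proof -
    have "H x - f' x \<le> H y - f' y"
      using that
      by (rule DERIV_nonneg_imp_nondecreasing[of _ _ "\<lambda>x. H x - f' x"])
         (use DERIV_diff[OF H f'] bound in \<open>metis abs_le_D1 diff_ge_0_iff_ge\<close>)
    moreover have "H x + f' x \<le> H y + f' y"
      using that
    proof (rule DERIV_nonneg_imp_nondecreasing[of _ _ "\<lambda>x. H x + f' x"])
      fix z
      have "0 \<le> H' z + f'' z" using bound[of z] by linarith
      then show "\<exists>d. ((\<lambda>x. H x + f' x) has_real_derivative d) (at z) \<and> 0 \<le> d"
        using DERIV_add[OF H f'] by blast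
    qed
    ultimately show ?thesis by linarith
  qed
  define E where "E s = F s - F a - (s - a) * (f a + f s) / 2" for s
  define E' where "E' s = f s - ((f a + f s) + (s - a) * f' s) / 2" for s
  have E: "(E has_real_derivative E' s) (at s)" for s
    unfolding E_def[abs_def] E'_def
    by (rule derivative_eq_intros F f refl | simp add: field_simps)+
  obtain z where z: "a < z" "z < b" and Eb: "E b - E a = (b - a) * E' z"
    using MVT2[OF ab, of E E'] E by blast
  obtain y where y: "a < y" "y < z" and fy: "f z - f a = (z - a) * f' y"
    using MVT2[OF z(1), of f f'] f by blast
  have "E' z = ((f z - f a) - (z - a) * f' z) / 2" by (simp add: E'_def field_simps)
  also have "\<dots> = (z - a) * (f' y - f' z) / 2" unfolding fy by (simp add: algebra_simps)
  finally have E'z: "\<bar>E' z\<bar> = (z - a) * \<bar>f' y - f' z\<bar> / 2" using z by (simp only: abs_mult abs_divide)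
  have "\<bar>f' y - f' z\<bar> \<le> H z - H y" using var[of y z] y by simp
  also have "\<dots> \<le> H b - H a" using Hmono[of z b] Hmono[of a y] y z by simp
  finally have "(z - a) * \<bar>f' y - f' z\<bar> \<le> (b - a) * (H b - H a)"
    using y z by (intro mult_mono) auto
  then have "\<bar>E' z\<bar> \<le> (b - a) * (H b - H a) / 2" using E'z by simp
  then have "(b - a) * \<bar>E' z\<bar> \<le> (b - a) * ((b - a) * (H b - H a) / 2)"
    using ab by (intro mult_left_mono) auto
  moreover have "\<bar>E b\<bar> = (b - a) * \<bar>E' z\<bar>"
    using Eb ab by (simp add: E_def abs_mult)
  ultimately show ?thesis by (simp add: E_def power2_eq_square mult.assoc)
qed

lemma gaussian_antiderivative:
  obtains F :: "real \<Rightarrow> real" where "\<And>x. (F has_real_derivative exp (- x\<^sup>2)) (at x)"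
    and "((\<lambda>x. F x - F 0) \<longlongrightarrow> sqrt pi / 2) at_top"
proof -
  have "\<exists>F. \<forall>x. -\<infinity> < ereal x \<longrightarrow> ereal x < \<infinity> \<longrightarrow> (F has_vector_derivative exp (- x\<^sup>2)) (at x)"
    by (rule einterval_antiderivative) (auto intro!: continuous_intros)
  then obtain F where F: "(F has_real_derivative exp (- x\<^sup>2)) (at x)" for x
    by (auto simp: has_real_derivative_iff_has_vector_derivative)
  have G: "has_bochner_integral lborel (\<lambda>x::real. indicator {0..} x *\<^sub>R exp (- x\<^sup>2)) (sqrt pi / 2)"
    by (rule gaussian_moment_0)
  have "((\<lambda>y. \<integral>x. indicator {..y} (x::real) *\<^sub>R (indicator {0..} x *\<^sub>R exp (- x\<^sup>2)) \<partial>lborel) \<longlongrightarrow>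
      (\<integral>x. indicator {0..} (x::real) *\<^sub>R exp (- x\<^sup>2) \<partial>lborel)) at_top"
    by (rule tendsto_integral_at_top[OF _ integrable.intros[OF G]]) simp
  then have lim: "((\<lambda>y. \<integral>x. indicator {..y} (x::real) *\<^sub>R (indicator {0..} x *\<^sub>R exp (- x\<^sup>2)) \<partial>lborel) \<longlongrightarrow>
      sqrt pi / 2) at_top"
    by (simp only: has_bochner_integral_integral_eq[OF G])
  have "(\<integral>x. indicator {..y} (x::real) *\<^sub>R (indicator {0..} x *\<^sub>R exp (- x\<^sup>2)) \<partial>lborel) = F y - F 0"
    if "0 \<le> y" for y
  proof -
    have "(\<integral>x. indicator {..y} (x::real) *\<^sub>R (indicator {0..} x *\<^sub>R exp (- x\<^sup>2)) \<partial>lborel)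
        = (\<integral>x. exp (- x\<^sup>2) * indicator {0..y} x \<partial>lborel)"
      by (intro Bochner_Integration.integral_cong) (auto simp: indicator_def)
    also have "\<dots> = F y - F 0"
      using that F by (intro integral_FTC_Icc_real) (auto intro!: continuous_intros)
    finally show ?thesis .
  qed
  then have "\<forall>\<^sub>F y in at_top. (\<integral>x. indicator {..y} (x::real) *\<^sub>R (indicator {0..} x *\<^sub>R exp (- x\<^sup>2)) \<partial>lborel) = F y - F 0"
    by (rule eventually_mono[OF eventually_ge_at_top[of 0]])
  with lim have "((\<lambda>x. F x - F 0) \<longlongrightarrow> sqrt pi / 2) at_top"
    by (simp add: tendsto_cong)
  with F show thesis by (rule that)
qed

text \<open>
  The left side is the modulus of the second derivative of \<open>exp (- x\<^sup>2)\<close>, the right side the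
  derivative of \<open>8 * arctan x\<close>.
\<close>

lemma gaussian_second_derivative_bound:
  fixes x :: real
  shows "\<bar>(4 * x\<^sup>2 - 2) * exp (- x\<^sup>2)\<bar> \<le> 8 * inverse (1 + x\<^sup>2)"
proof -
  define y where "y = x\<^sup>2"
  have y: "0 \<le> y" by (simp add: y_def)
  have "\<bar>4 * y - 2\<bar> * (1 + y) \<le> (4 * y + 2) * (1 + y)"
    using y by (intro mult_right_mono) auto
  also have "\<dots> \<le> 8 * (1 + y + y\<^sup>2 / 2)"
    using y by (simp add: algebra_simps power2_eq_square)
  also have "\<dots> \<le> 8 * exp y"
    using exp_lower_Taylor_quadratic[OF y] by simp
  finally have "\<bar>4 * y - 2\<bar> * (1 + y) \<le> 8 * exp y" .
  then have "\<bar>(4 * y - 2) * exp (- y)\<bar> \<le> 8 * inverse (1 + y)"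
    using y by (simp add: abs_mult exp_minus field_simps)
  then show ?thesis by (simp add: y_def)
qed

lemma gaussian_sum_summable:
  assumes h: "0 < h"
  shows "(\<lambda>m::nat. exp (- (real m * h)\<^sup>2)) summable_on UNIV"
proof -
  have le: "exp (- (real m * h)\<^sup>2) \<le> (exp (- h\<^sup>2)) ^ m" for m :: nat
  proof -
    have "real m * h\<^sup>2 \<le> (real m)\<^sup>2 * h\<^sup>2"
      by (intro mult_right_mono) (auto simp: power2_eq_square simp flip: of_nat_mult)
    then show ?thesis
      by (simp add: exp_of_nat_mult[symmetric] power_mult_distrib)
  qed
  have geo: "(\<lambda>m. (exp (- h\<^sup>2)) ^ m) summable_on UNIV"
  proof (subst summable_on_UNIV_nonneg_real_iff)
    show "summable (\<lambda>m. (exp (- h\<^sup>2)) ^ m)"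
      by (rule summable_geometric) (use h in simp)
  qed simp
  show ?thesis
    by (rule summable_on_comparison_test[OF geo]) (rule le, simp)
qed

text \<open>
  The trapezoid rule with nodes \<open>m * h\<close>.  The errors telescope to at most
  \<open>h\<^sup>2 * 4 * arctan (N * h) \<le> 2 * pi * h\<^sup>2\<close>, uniformly in the number \<open>N\<close> of intervals; the node at 0
  enters with weight one half, which produces the constant term \<open>1 / 2\<close>.
\<close>

lemma gaussian_sum_asymptotics:
  assumes h: "0 < h"
  shows "\<bar>(\<Sum>\<^sub>\<infinity>m::nat. exp (- (real m * h)\<^sup>2)) - sqrt pi / (2 * h) - 1 / 2\<bar> \<le> 2 * pi * h"
proof -
  obtain F :: "real \<Rightarrow> real" where F: "\<And>x. (F has_real_derivative exp (- x\<^sup>2)) (at x)"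
    and Flim: "((\<lambda>x. F x - F 0) \<longlongrightarrow> sqrt pi / 2) at_top"
    using gaussian_antiderivative by blast
  define f :: "real \<Rightarrow> real" where "f x = exp (- x\<^sup>2)" for x
  define S where "S = (\<Sum>\<^sub>\<infinity>m::nat. f (real m * h))"
  have step: "\<bar>F (real (Suc m) * h) - F (real m * h) - h * (f (real m * h) + f (real (Suc m) * h)) / 2\<bar>
      \<le> h\<^sup>2 * (8 * arctan (real (Suc m) * h) - 8 * arctan (real m * h)) / 2" for m
  proof -
    have "\<bar>F (real (Suc m) * h) - F (real m * h) - (real (Suc m) * h - real m * h) * (f (real m * h) + f (real (Suc m) * h)) / 2\<bar>
      \<le> (real (Suc m) * h - real m * h)\<^sup>2 * (8 * arctan (real (Suc m) * h) - 8 * arctan (real m * h)) / 2"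
    proof (rule trapezoid_error[where f = f and H = "\<lambda>x. 8 * arctan x" and f' = "\<lambda>x. - 2 * x * f x"
          and f'' = "\<lambda>x. (4 * x\<^sup>2 - 2) * exp (- x\<^sup>2)" and H' = "\<lambda>x. 8 * inverse (1 + x\<^sup>2)"])
      show "(F has_real_derivative f x) (at x)" for x using F by (simp add: f_def)
      show f': "(f has_real_derivative - 2 * x * f x) (at x)" for x
        unfolding f_def[abs_def] by (auto intro!: derivative_eq_intros)
      show "((\<lambda>x. - 2 * x * f x) has_real_derivative (4 * x\<^sup>2 - 2) * exp (- x\<^sup>2)) (at x)" for x
        by (rule derivative_eq_intros f' refl | simp add: f_def power2_eq_square algebra_simps)+
      show "((\<lambda>x. 8 * arctan x) has_real_derivative 8 * inverse (1 + x\<^sup>2)) (at x)" for x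
        by (auto intro!: derivative_eq_intros)
    qed (use h gaussian_second_derivative_bound in auto)
    then show ?thesis by (simp add: algebra_simps)
  qed
  have part: "\<bar>F (real N * h) - F 0 - h * (\<Sum>m<N. f (real m * h)) + h / 2 - h * f (real N * h) / 2\<bar>
      \<le> 2 * pi * h\<^sup>2" for N
  proof -
    have tele: "(\<Sum>m<N. F (real (Suc m) * h) - F (real m * h) - h * (f (real m * h) + f (real (Suc m) * h)) / 2)
       = F (real N * h) - F 0 - h * (\<Sum>m<N. f (real m * h)) + h / 2 - h * f (real N * h) / 2"
    proof (induction N)
      case (Suc N)
      then show ?case by (simp add: field_simps del: of_nat_Suc)
    qed (simp add: f_def)
    have "\<bar>\<Sum>m<N. F (real (Suc m) * h) - F (real m * h) - h * (f (real m * h) + f (real (Suc m) * h)) / 2\<bar>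
       \<le> (\<Sum>m<N. h\<^sup>2 * (8 * arctan (real (Suc m) * h) - 8 * arctan (real m * h)) / 2)"
      by (intro order_trans[OF sum_abs] sum_mono step)
    also have "\<dots> = h\<^sup>2 * 4 * arctan (real N * h)"
    proof (induction N)
      case (Suc N)
      then show ?case by (simp add: field_simps del: of_nat_Suc)
    qed simp
    also have "\<dots> \<le> h\<^sup>2 * 4 * (pi / 2)"
      using arctan_ubound[of "real N * h"] by (intro mult_left_mono) auto
    finally show ?thesis unfolding tele by simp
  qed
  have "(\<lambda>m. f (real m * h)) sums S"
    unfolding S_def f_def by (rule has_sum_imp_sums[OF has_sum_infsum[OF gaussian_sum_summable[OF h]]])
  then have Slim: "(\<lambda>N. \<Sum>m<N. f (real m * h)) \<longlonglongrightarrow> S" and f0: "(\<lambda>N. f (real N * h)) \<longlonglongrightarrow> 0"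
    by (simp add: sums_def, rule summable_LIMSEQ_zero[OF sums_summable])
  have Nh: "filterlim (\<lambda>N. real N * h) at_top sequentially"
    using h by (intro filterlim_at_top_mult_tendsto_pos[where c = h] tendsto_intros filterlim_real_sequentially)
  have "(\<lambda>N. \<bar>(F (real N * h) - F 0) - h * (\<Sum>m<N. f (real m * h)) + h / 2 - h * f (real N * h) / 2\<bar>)
     \<longlonglongrightarrow> \<bar>sqrt pi / 2 - h * S + h / 2 - h * 0 / 2\<bar>"
    by (intro tendsto_intros Slim f0 filterlim_compose[OF Flim Nh]) simp_all
  then have "\<bar>sqrt pi / 2 - h * S + h / 2 - h * 0 / 2\<bar> \<le> 2 * pi * h\<^sup>2"
    by (rule tendsto_upperbound) (use part in auto)
  moreover have "\<bar>sqrt pi / 2 - h * S + h / 2 - h * 0 / 2\<bar> = h * \<bar>S - sqrt pi / (2 * h) - 1 / 2\<bar>"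
  proof -
    have "sqrt pi / 2 - h * S + h / 2 - h * 0 / 2 = - (h * (S - sqrt pi / (2 * h) - 1 / 2))"
      using h by (simp add: field_simps)
    then show ?thesis using h by (simp add: abs_mult)
  qed
  ultimately have "h * \<bar>S - sqrt pi / (2 * h) - 1 / 2\<bar> \<le> h * (2 * pi * h)"
    by (simp add: power2_eq_square mult_ac)
  then show ?thesis using h by (simp add: S_def f_def)
qed

definition neumann_trace :: "real \<Rightarrow> real \<Rightarrow> real" where
  "neumann_trace l t = (\<Sum>\<^sub>\<infinity>m::nat. exp (- t * (pi * real m / l)\<^sup>2))"

definition dirichlet_trace :: "real \<Rightarrow> real \<Rightarrow> real" where
  "dirichlet_trace l t = (\<Sum>\<^sub>\<infinity>m::nat. exp (- t * (pi * real (Suc m) / l)\<^sup>2))"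

lemma neumann_exponent:
  assumes "0 < t"
  shows "exp (- t * (pi * real m / l)\<^sup>2) = exp (- (real m * (pi * sqrt t / l))\<^sup>2)"
  using assms by (simp add: power_mult_distrib power_divide)

lemma neumann_summable:
  assumes "0 < l" "0 < t"
  shows "(\<lambda>m::nat. exp (- t * (pi * real m / l)\<^sup>2)) summable_on UNIV"
  unfolding neumann_exponent[OF assms(2)] using assms by (intro gaussian_sum_summable) simp

lemma dirichlet_summable:
  assumes "0 < l" "0 < t"
  shows "(\<lambda>m::nat. exp (- t * (pi * real (Suc m) / l)\<^sup>2)) summable_on UNIV"
  using summable_on_reindex[of Suc UNIV "\<lambda>m::nat. exp (- t * (pi * real m / l)\<^sup>2)"]
    summable_on_subset_banach[OF neumann_summable[OF assms], of "range Suc"]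
  by (simp add: o_def)

lemma dirichlet_trace_eq:
  assumes "0 < l" "0 < t"
  shows "dirichlet_trace l t = neumann_trace l t - 1"
proof -
  let ?f = "\<lambda>m::nat. exp (- t * (pi * real m / l)\<^sup>2)"
  have "infsum ?f ({0} \<union> range Suc) = infsum ?f {0} + infsum ?f (range Suc)"
    by (intro infsum_Un_disjoint summable_on_subset_banach[OF neumann_summable[OF assms]]) auto
  moreover have "{0} \<union> range Suc = UNIV"
    using not0_implies_Suc by auto
  moreover have "infsum ?f (range Suc) = dirichlet_trace l t"
    using infsum_reindex[of Suc UNIV ?f] by (simp add: o_def dirichlet_trace_def)
  ultimately show ?thesis by (simp add: neumann_trace_def)
qed

lemma neumann_trace_asymptotics:
  assumes l: "0 < l"
  shows "(\<lambda>t. neumann_trace l t - (l / (2 * sqrt pi) * t powr (-1/2) + 1 / 2))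
    \<in> O[at_right 0](\<lambda>t. t powr (1/2))"
proof (rule bigoI[where c = "2 * pi * pi / l"])
  show "\<forall>\<^sub>F t in at_right 0. norm (neumann_trace l t - (l / (2 * sqrt pi) * t powr (-1/2) + 1 / 2))
      \<le> 2 * pi * pi / l * norm (t powr (1/2))"
    using eventually_at_right_less[of "0::real"]
  proof eventually_elim
    case (elim t)
    have "neumann_trace l t = (\<Sum>\<^sub>\<infinity>m::nat. exp (- (real m * (pi * sqrt t / l))\<^sup>2))"
      unfolding neumann_trace_def neumann_exponent[OF elim] ..
    moreover have "l / (2 * sqrt pi) * t powr (-1/2) = sqrt pi / (2 * (pi * sqrt t / l))"
      using elim l by (simp add: powr_minus powr_half_sqrt field_simps)
    ultimately show ?case
      using gaussian_sum_asymptotics[of "pi * sqrt t / l"] elim l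
      by (simp add: powr_half_sqrt algebra_simps)
  qed
qed

lemma dirichlet_trace_asymptotics:
  assumes l: "0 < l"
  shows "(\<lambda>t. dirichlet_trace l t - (l / (2 * sqrt pi) * t powr (-1/2) + - 1 / 2))
    \<in> O[at_right 0](\<lambda>t. t powr (1/2))"
proof -
  have "\<forall>\<^sub>F t in at_right 0. dirichlet_trace l t - (l / (2 * sqrt pi) * t powr (-1/2) + - 1 / 2)
      = neumann_trace l t - (l / (2 * sqrt pi) * t powr (-1/2) + 1 / 2)"
    using eventually_at_right_less[of "0::real"]
    by eventually_elim (simp add: dirichlet_trace_eq l)
  from landau_o.big.in_cong[OF this] show ?thesis
    using neumann_trace_asymptotics[OF l] by blast
qed

section \<open>Products of one-dimensional heat traces\<close>

lemma has_sum_times: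
  fixes f :: "'b \<Rightarrow> real" and g :: "'c \<Rightarrow> real"
  assumes f: "(f has_sum a) UNIV" and g: "(g has_sum b) UNIV"
    and f0: "\<And>x. 0 \<le> f x" and g0: "\<And>y. 0 \<le> g y"
  shows "((\<lambda>(x, y). f x * g y) has_sum a * b) UNIV"
proof -
  have row: "((\<lambda>y. (case (x, y) of (x, y) \<Rightarrow> f x * g y)) has_sum f x * b) UNIV" for x
    using has_sum_cmult_right[OF g, of "f x"] by simp
  have col: "((\<lambda>x. f x * b) has_sum a * b) UNIV"
    by (rule has_sum_cmult_left[OF f])
  have "((\<lambda>(x, y). f x * g y) has_sum a * b) (UNIV \<times> UNIV)"
    by (rule has_sum_SigmaI[OF row col], rule summable_on_SigmaI[OF row])
       (use col f0 g0 in \<open>auto simp: summable_on_def\<close>)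
  then show ?thesis by simp
qed

text \<open>
  The remainder of the product telescopes into products containing exactly one remainder
  \<open>R i\<close>; each is of order \<open>t powr (1/2) * t powr (-1/2) * t powr (-1/2)\<close>.  The discarded terms of
  the product of the principal parts are of order \<open>t powr (-1/2)\<close> or bounded.
\<close>

lemma product_expansion:
  fixes A s :: "nat \<Rightarrow> real" and f :: "nat \<Rightarrow> real \<Rightarrow> real"
  assumes f: "\<And>i. (\<lambda>t. f i t - (A i * t powr (-1/2) + s i)) \<in> O[at_right 0](\<lambda>t. t powr (1/2))"
  shows "(\<lambda>t. f 0 t * f 1 t * f 2 t - (A 0 * A 1 * A 2 * t powr (-3/2)
      + (A 0 * A 1 * s 2 + A 0 * s 1 * A 2 + s 0 * A 1 * A 2) * t powr (-1)))
    \<in> O[at_right 0](\<lambda>t. t powr (-1/2))"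
proof -
  define P where "P i t = A i * t powr (-1/2) + s i" for i t
  define R where "R i t = f i t - P i t" for i t
  have ev: "\<forall>\<^sub>F t in at_right 0. 0 < t \<and> t < (1::real)"
    using eventually_at_right_real[of 0 1] by (auto elim: eventually_mono)
  have c: "(\<lambda>t. c) \<in> O[at_right 0](\<lambda>t. t powr (-1/2))" for c :: real
  proof (rule bigoI[where c = "\<bar>c\<bar>"])
    show "\<forall>\<^sub>F t::real in at_right 0. norm c \<le> \<bar>c\<bar> * norm (t powr (-1/2))"
      using ev
    proof eventually_elim
      case (elim t)
      then have "1 \<le> t powr (-1/2)" using powr_mono'[of "-1/2" 0 t] by simp
      then have "\<bar>c\<bar> * 1 \<le> \<bar>c\<bar> * t powr (-1/2)" by (intro mult_left_mono) auto
      then show ?case by simp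
    qed
  qed
  have R: "R i \<in> O[at_right 0](\<lambda>t. t powr (1/2))" for i
    unfolding R_def P_def by (rule f)
  have "(\<lambda>t::real. t powr (1/2)) \<in> O[at_right 0](\<lambda>t. t powr (-1/2))"
  proof (rule bigoI[where c = 1])
    show "\<forall>\<^sub>F t::real in at_right 0. norm (t powr (1/2)) \<le> 1 * norm (t powr (-1/2))"
      using ev by eventually_elim (simp add: powr_mono')
  qed
  then have R': "R i \<in> O[at_right 0](\<lambda>t. t powr (-1/2))" for i
    using R landau_o.big_trans by blast
  have P: "P i \<in> O[at_right 0](\<lambda>t. t powr (-1/2))" for i
  proof -
    have "(\<lambda>t. A i * t powr (-1/2)) \<in> O[at_right 0](\<lambda>t. t powr (-1/2))"
      by (rule bigoI[where c = "\<bar>A i\<bar>"]) (simp add: abs_mult)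
    then show ?thesis unfolding P_def by (intro sum_in_bigo c)
  qed
  have f': "f i \<in> O[at_right 0](\<lambda>t. t powr (-1/2))" for i
    using sum_in_bigo(1)[OF R' P, of i i] by (simp add: R_def)
  have m: "(\<lambda>t. u t * v t * w t) \<in> O[at_right 0](\<lambda>t. t powr (-1/2))"
    if "u \<in> O[at_right 0](\<lambda>t. t powr (1/2))" "v \<in> O[at_right 0](\<lambda>t. t powr (-1/2))"
      "w \<in> O[at_right 0](\<lambda>t. t powr (-1/2))" for u v w :: "real \<Rightarrow> real"
  proof -
    have "(\<lambda>t::real. t powr (1/2) * t powr (-1/2) * t powr (-1/2)) = (\<lambda>t. t powr (1/2 + -1/2 + -1/2))"
      by (simp only: powr_add)
    then show ?thesis
      using landau_o.big.mult[OF landau_o.big.mult[OF that(1,2)] that(3)] by simp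
  qed
  have "(\<lambda>t. R 0 t * f 1 t * f 2 t + R 1 t * P 0 t * f 2 t + R 2 t * P 0 t * P 1 t
      + (A 0 * s 1 * s 2 + s 0 * A 1 * s 2 + s 0 * s 1 * A 2) * t powr (-1/2) + s 0 * s 1 * s 2)
      \<in> O[at_right 0](\<lambda>t. t powr (-1/2))" (is "?E \<in> _")
    by (intro sum_in_bigo m R P f' c) simp
  also have "?E = (\<lambda>t. f 0 t * f 1 t * f 2 t - (A 0 * A 1 * A 2 * t powr (-3/2)
      + (A 0 * A 1 * s 2 + A 0 * s 1 * A 2 + s 0 * A 1 * A 2) * t powr (-1)))"
  proof
    fix t :: real
    have 3: "t powr (-3/2) = t powr (-1/2) * t powr (-1/2) * t powr (-1/2)"
      and 2: "t powr (-1) = t powr (-1/2) * t powr (-1/2)"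
      by (simp_all only: powr_add[symmetric]) simp_all
    show "?E t = f 0 t * f 1 t * f 2 t - (A 0 * A 1 * A 2 * t powr (-3/2)
      + (A 0 * A 1 * s 2 + A 0 * s 1 * A 2 + s 0 * A 1 * A 2) * t powr (-1))"
      unfolding 2 3 R_def P_def by (simp add: algebra_simps)
  qed
  finally show ?thesis .
qed

lemma cell_trace_asymptotics:
  assumes l: "0 < l1" "0 < l2" "0 < a"
  shows "(\<lambda>t. neumann_trace l1 t * neumann_trace l2 t * dirichlet_trace a t
       - (l1 * l2 * a / (8 * pi powr (3/2)) * t powr (-3/2)
             + (a * (l1 + l2) - l1 * l2) / (8 * pi) * t powr (-1)))
    \<in> O[at_right 0](\<lambda>t. t powr (-1/2))"
proof -
  define f where "f i = (if i = 0 then neumann_trace l1 else if i = 1 then neumann_trace l2 else dirichlet_trace a)" for i :: nat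
  define A where "A i = (if i = 0 then l1 else if i = 1 then l2 else a) / (2 * sqrt pi)" for i :: nat
  define s where "s i = (if i < 2 then 1 / 2 else - 1 / 2 :: real)" for i :: nat
  have *: "(\<lambda>t. f i t - (A i * t powr (-1/2) + s i)) \<in> O[at_right 0](\<lambda>t. t powr (1/2))" for i
    using neumann_trace_asymptotics[OF l(1)] neumann_trace_asymptotics[OF l(2)]
      dirichlet_trace_asymptotics[OF l(3)]
    by (auto simp: f_def A_def s_def)
  have p: "pi powr (3/2) = pi * sqrt pi"
    using powr_add[of pi 1 "1/2"] by (simp add: powr_half_sqrt)
  have A3: "A 0 * A 1 * A 2 = l1 * l2 * a / (8 * pi powr (3/2))"
    unfolding p by (simp add: A_def)
  have A2: "A 0 * A 1 * s 2 + A 0 * s 1 * A 2 + s 0 * A 1 * A 2 = (a * (l1 + l2) - l1 * l2) / (8 * pi)"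
    by (simp add: A_def s_def field_simps)
  have "f 0 = neumann_trace l1" "f 1 = neumann_trace l2" "f 2 = dirichlet_trace a"
    by (simp_all add: f_def)
  with product_expansion[of f A s, OF *] show ?thesis
    unfolding A3 A2 by simp
qed

section \<open>The cube minimizes the lateral contribution\<close>

text \<open>
  Both parts follow from \<open>(x + y)\<^sup>2 = (2 * a)\<^sup>2 + (x - y)\<^sup>2\<close>.
\<close>

lemma lateral_sum_bound:
  fixes x y a :: real
  assumes "0 < x" "0 < y" "x * y = a\<^sup>2" "0 < a"
  shows "2 * a \<le> x + y" and "x + y = 2 * a \<Longrightarrow> x = a \<and> y = a"
proof -
  have sq: "(x + y)\<^sup>2 = (2 * a)\<^sup>2 + (x - y)\<^sup>2"
    using assms(3) by (simp add: power2_eq_square algebra_simps)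
  then have "(2 * a)\<^sup>2 \<le> (x + y)\<^sup>2" by simp
  then show "2 * a \<le> x + y" by (rule power2_le_imp_le) (use assms in auto)
  show "x = a \<and> y = a" if "x + y = 2 * a"
    using sq that by simp
qed

text \<open>
  For fixed positive \<open>a\<close> both \<open>B_coeff\<close> and \<open>B_lat\<close> are increasing affine functions of the sum of the two
  side lengths.
\<close>

lemma is_arg_min_cube:
  fixes f :: "real \<times> real \<Rightarrow> real"
  assumes a: "0 < a" and f: "\<And>p. f p = c * (fst p + snd p) + d" and c: "0 < c"
  shows "is_arg_min f (admissible a) (l1, l2) \<longleftrightarrow> l1 = a \<and> l2 = a"
proof
  assume min: "is_arg_min f (admissible a) (l1, l2)"
  then have adm: "0 < l1" "0 < l2" "l1 * l2 = a\<^sup>2"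
    by (auto simp: is_arg_min_def admissible_def)
  have "admissible a (a, a)" using a by (simp add: admissible_def power2_eq_square)
  then have "\<not> f (a, a) < f (l1, l2)" using min by (auto simp: is_arg_min_def)
  then have "l1 + l2 \<le> 2 * a" using c by (simp add: f)
  then show "l1 = a \<and> l2 = a"
    using lateral_sum_bound[OF adm a] by simp
next
  assume "l1 = a \<and> l2 = a"
  moreover have "\<not> f (x, y) < f (a, a)" if "admissible a (x, y)" for x y
    using lateral_sum_bound(1)[of x y a] that a c by (simp add: f admissible_def)
  ultimately show "is_arg_min f (admissible a) (l1, l2)"
    using a by (auto simp: is_arg_min_def admissible_def power2_eq_square)
qed

section \<open>Building smooth functions\<close>

lemma frechet_derivative_eqI:
  "(f has_derivative f') (at x) \<Longrightarrow> frechet_derivative f (at x) b = f' b"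
  using frechet_derivative_at by metis

text \<open>
  The set of all polynomial expressions in members of \<open>X\<close>.  It is the invariant for coinductive
  smoothness proofs, since the product rule turns a product into a sum of products.
\<close>

inductive fun_algebra :: "('a \<Rightarrow> real) set \<Rightarrow> ('a \<Rightarrow> real) \<Rightarrow> bool" for X where
  base: "f \<in> X \<Longrightarrow> fun_algebra X f"
| const: "fun_algebra X (\<lambda>x. c)"
| add: "fun_algebra X f \<Longrightarrow> fun_algebra X g \<Longrightarrow> fun_algebra X (\<lambda>x. f x + g x)"
| mult: "fun_algebra X f \<Longrightarrow> fun_algebra X g \<Longrightarrow> fun_algebra X (\<lambda>x. f x * g x)"

text \<open>
  Coinduction up to algebraic operations: for a family of functions to be smooth it suffices that
  the partial derivatives are polynomials in members of the family.
\<close>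

lemma smooth_coinduct_algebra:
  fixes X :: "('a::euclidean_space \<Rightarrow> real) set"
  assumes diff: "\<And>f x. f \<in> X \<Longrightarrow> f differentiable (at x)"
    and part: "\<And>f b. f \<in> X \<Longrightarrow> b \<in> Basis \<Longrightarrow> fun_algebra X (\<lambda>x. frechet_derivative f (at x) b)"
    and f: "fun_algebra X f"
  shows "smooth f"
proof -
  have step: "(\<forall>x. f differentiable (at x)) \<and> (\<forall>b\<in>Basis. fun_algebra X (\<lambda>x. frechet_derivative f (at x) b))"
    if "fun_algebra X f" for f
    using that
  proof induction
    case (base f)
    then show ?case using diff part by blast
  next
    case (const c)
    then show ?case by (auto simp: frechet_derivative_const intro: fun_algebra.const)
  next
    case (add f g)
    have "frechet_derivative (\<lambda>x. f x + g x) (at x) b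
        = frechet_derivative f (at x) b + frechet_derivative g (at x) b" for x b
      using add.IH by (intro frechet_derivative_eqI has_derivative_add)
        (auto simp: frechet_derivative_works[symmetric])
    then show ?case using add.IH by (auto intro: fun_algebra.add)
  next
    case (mult f g)
    have "frechet_derivative (\<lambda>x. f x * g x) (at x) b
        = f x * frechet_derivative g (at x) b + frechet_derivative f (at x) b * g x" for x b
      using mult.IH by (intro frechet_derivative_eqI has_derivative_mult)
        (auto simp: frechet_derivative_works[symmetric])
    then show ?case
      using mult by (simp, intro ballI fun_algebra.add fun_algebra.mult) auto
  qed
  show ?thesis
    using f by (rule smooth.coinduct[of "fun_algebra X"]) (use step in blast)
qed

lemma smooth_differentiable: "smooth f \<Longrightarrow> f differentiable (at x)"
  by (erule smooth.cases) auto

lemma smooth_partial: "smooth f \<Longrightarrow> b \<in> Basis \<Longrightarrow> smooth (\<lambda>x. frechet_derivative f (at x) b)"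
  by (erule smooth.cases) auto

lemma smooth_has_derivative: "smooth f \<Longrightarrow> (f has_derivative frechet_derivative f (at x)) (at x)"
  using smooth_differentiable frechet_derivative_works by blast

lemma smooth_continuous_on: "smooth f \<Longrightarrow> continuous_on S f"
  by (meson continuous_at_imp_continuous_on differentiable_imp_continuous_within smooth_differentiable)

lemma smooth_measurable: "smooth f \<Longrightarrow> f \<in> borel_measurable borel"
  by (simp add: borel_measurable_continuous_onI smooth_continuous_on)

lemma smooth_algebra: "fun_algebra (Collect smooth) f \<Longrightarrow> smooth f"
  by (rule smooth_coinduct_algebra[of "Collect smooth"])
     (auto intro: smooth_differentiable smooth_partial fun_algebra.base)

lemma smooth_const: "smooth (\<lambda>x. c)"
  by (rule smooth_algebra) (rule fun_algebra.const)

lemma smooth_add: "smooth f \<Longrightarrow> smooth g \<Longrightarrow> smooth (\<lambda>x. f x + g x)"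
  by (rule smooth_algebra) (auto intro: fun_algebra.intros)

lemma smooth_mult: "smooth f \<Longrightarrow> smooth g \<Longrightarrow> smooth (\<lambda>x. f x * g x)"
  by (rule smooth_algebra) (auto intro: fun_algebra.intros)

lemma smooth_sum: "(\<And>i. i \<in> F \<Longrightarrow> smooth (f i)) \<Longrightarrow> smooth (\<lambda>x. \<Sum>i\<in>F. f i x)"
  by (induction F rule: infinite_finite_induct) (auto intro: smooth_const smooth_add)

lemma smooth_prod: "(\<And>i. i \<in> F \<Longrightarrow> smooth (f i)) \<Longrightarrow> smooth (\<lambda>x. \<Prod>i\<in>F. f i x)"
  by (induction F rule: infinite_finite_induct) (auto intro: smooth_const smooth_mult)

text \<open>
  Smooth functions of one linear functional.  The family \<open>g\<close> has to be closed under derivatives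
  only up to polynomial expressions, as for the pair of sine and cosine or for the functions
  \<open>y\<^sup>-\<^sup>k exp (- 1 / y)\<close>.
\<close>

lemma smooth_ridge:
  fixes g g' :: "'i \<Rightarrow> real \<Rightarrow> real" and v :: "'a::euclidean_space"
  assumes deriv: "\<And>i y. (g i has_real_derivative g' i y) (at y)"
    and alg: "\<And>i. fun_algebra (range g) (g' i)"
  shows "smooth (\<lambda>x. g i (x \<bullet> v + c))"
proof (rule smooth_coinduct_algebra[of "range (\<lambda>i x. g i (x \<bullet> v + c))"])
  have d: "((\<lambda>x. g i (x \<bullet> v + c)) has_derivative (\<lambda>h. g' i (x \<bullet> v + c) * (h \<bullet> v))) (at x)" for i x
  proof -
    have lin: "((\<lambda>x. x \<bullet> v + c) has_derivative (\<lambda>h. h \<bullet> v)) (at x)"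
      by (auto intro!: derivative_eq_intros)
    have "(g i has_derivative (*) (g' i (x \<bullet> v + c))) (at (x \<bullet> v + c))"
      using deriv[of i "x \<bullet> v + c"] by (simp add: has_field_derivative_def)
    from has_derivative_compose[OF lin this] show ?thesis .
  qed
  show "f differentiable (at x)" if "f \<in> range (\<lambda>i x. g i (x \<bullet> v + c))" for f x
    using that d by (auto simp: differentiable_def)
  have comp: "fun_algebra (range (\<lambda>i x. g i (x \<bullet> v + c))) (\<lambda>x. h (x \<bullet> v + c))"
    if "fun_algebra (range g) h" for h
    using that
  proof induction
    case (base f)
    then show ?case by (auto intro!: fun_algebra.base)
  qed (auto intro: fun_algebra.intros)
  show "fun_algebra (range (\<lambda>i x. g i (x \<bullet> v + c))) (\<lambda>x. frechet_derivative f (at x) b)"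
    if "f \<in> range (\<lambda>i x. g i (x \<bullet> v + c))" for f b
  proof -
    from that obtain i where f: "f = (\<lambda>x. g i (x \<bullet> v + c))" by blast
    have "frechet_derivative f (at x) b = g' i (x \<bullet> v + c) * (b \<bullet> v)" for x
      unfolding f by (rule frechet_derivative_eqI[OF d])
    then have "(\<lambda>x. frechet_derivative f (at x) b) = (\<lambda>x. g' i (x \<bullet> v + c) * (b \<bullet> v))"
      by blast
    then show ?thesis
      using fun_algebra.mult[OF comp[OF alg] fun_algebra.const] by simp
  qed
  show "fun_algebra (range (\<lambda>i x. g i (x \<bullet> v + c))) (\<lambda>x. g i (x \<bullet> v + c))"
    by (intro fun_algebra.base) blast
qed

lemma smooth_cos_ridge: "smooth (\<lambda>x::'a::euclidean_space. cos (x \<bullet> v))"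
  and smooth_sin_ridge: "smooth (\<lambda>x::'a::euclidean_space. sin (x \<bullet> v))"
proof -
  define g :: "bool \<Rightarrow> real \<Rightarrow> real" where "g i = (if i then cos else sin)" for i
  define g' :: "bool \<Rightarrow> real \<Rightarrow> real" where "g' i y = (if i then -1 * sin y else cos y)" for i y
  have d: "(g i has_real_derivative g' i y) (at y)" for i y
    by (cases i) (auto simp: g_def g'_def intro!: derivative_eq_intros)
  have b: "fun_algebra (range g) sin" "fun_algebra (range g) cos"
    by (auto intro!: fun_algebra.base simp: g_def image_iff)
  have alg: "fun_algebra (range g) (g' i)" for i
    using b(2) fun_algebra.mult[OF fun_algebra.const[of _ "- 1"] b(1)]
    by (cases i) (simp_all add: g'_def[abs_def])
  show "smooth (\<lambda>x::'a. cos (x \<bullet> v))" "smooth (\<lambda>x::'a. sin (x \<bullet> v))"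
    using smooth_ridge[OF d alg, of True v 0] smooth_ridge[OF d alg, of False v 0]
    by (simp_all add: g_def)
qed

section \<open>Test functions on a box\<close>

text \<open>
  The derivatives of \<open>exp (- 1 / y)\<close>, continued by 0 to \<open>y \<le> 0\<close>, are combinations of these
  functions.
\<close>

definition flat_exp :: "nat \<Rightarrow> real \<Rightarrow> real" where
  "flat_exp k y = (if 0 < y then inverse y ^ k * exp (- inverse y) else 0)"

lemma power_le_fact_exp:
  assumes "0 \<le> (x::real)"
  shows "x ^ k \<le> fact k * exp x"
proof -
  obtain s where "exp x = (\<Sum>m<Suc k. x ^ m / fact m) + exp s / fact (Suc k) * x ^ Suc k"
    using Maclaurin_exp_le[of x "Suc k"] by blast
  moreover have "x ^ k / fact k \<le> (\<Sum>m<Suc k. x ^ m / fact m)"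
    using assms by (simp add: sum_nonneg)
  moreover have "0 \<le> exp s / fact (Suc k) * x ^ Suc k"
    using assms by simp
  ultimately have "x ^ k / fact k \<le> exp x" by linarith
  then show ?thesis by (simp add: field_simps)
qed

text \<open>
  The linear bound serves for the derivative at 0: there the difference quotient of
  \<open>flat_exp k\<close> is \<open>flat_exp (Suc k)\<close>, which therefore tends to 0.
\<close>

lemma flat_exp_bound: "\<bar>flat_exp k y\<bar> \<le> fact (Suc k) * \<bar>y\<bar>"
proof (cases "0 < y")
  case True
  have "inverse y ^ Suc k \<le> fact (Suc k) * exp (inverse y)"
    using True by (intro power_le_fact_exp) simp
  then have "inverse y ^ Suc k * y * exp (- inverse y) \<le> fact (Suc k) * exp (inverse y) * y * exp (- inverse y)"
    using True by (intro mult_right_mono) auto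
  moreover have "inverse y ^ Suc k * y = inverse y ^ k" using True by simp
  moreover have "fact (Suc k) * exp (inverse y) * y * exp (- inverse y) = fact (Suc k) * y"
    by (simp add: exp_minus field_simps)
  ultimately have "inverse y ^ k * exp (- inverse y) \<le> fact (Suc k) * y" by metis
  then show ?thesis using True by (simp add: flat_exp_def)
qed (simp add: flat_exp_def mult_nonneg_nonpos)

lemma flat_exp_derivative:
  "(flat_exp k has_real_derivative flat_exp (k + 2) y + - real k * flat_exp (k + 1) y) (at y)"
proof -
  consider "0 < y" | "y < 0" | "y = 0" by linarith
  then show ?thesis
  proof cases
    case 1
    have "((\<lambda>y. inverse y ^ k * exp (- inverse y)) has_real_derivative
        flat_exp (k + 2) y + - real k * flat_exp (k + 1) y) (at y)"
    proof (rule DERIV_cong)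
      show "((\<lambda>y. inverse y ^ k * exp (- inverse y)) has_real_derivative
         (real k * (- (inverse y * 1 * inverse y) * inverse y ^ (k - Suc 0))) * exp (- inverse y)
         + (exp (- inverse y) * (- (- (inverse y * 1 * inverse y)))) * inverse y ^ k) (at y)"
        using 1 by (auto intro!: derivative_eq_intros simp: power2_eq_square)
      show "(real k * (- (inverse y * 1 * inverse y) * inverse y ^ (k - Suc 0))) * exp (- inverse y)
         + (exp (- inverse y) * (- (- (inverse y * 1 * inverse y)))) * inverse y ^ k
         = flat_exp (k + 2) y + - real k * flat_exp (k + 1) y"
        using 1 by (cases k) (simp_all add: flat_exp_def algebra_simps power2_eq_square)
    qed
    then show ?thesis
      by (rule DERIV_cong_ev[THEN iffD1, rotated -1])
         (use eventually_nhds_in_open[of "{0<..}" y] 1 in \<open>auto elim!: eventually_mono simp: flat_exp_def\<close>)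
  next
    case 2
    have "((\<lambda>y::real. 0::real) has_real_derivative 0) (at y)" by simp
    then have "(flat_exp k has_real_derivative 0) (at y)"
      by (rule DERIV_cong_ev[THEN iffD1, rotated -1])
         (use eventually_nhds_in_open[of "{..<0}" y] 2 in \<open>auto elim!: eventually_mono simp: flat_exp_def\<close>)
    then show ?thesis using 2 by (simp add: flat_exp_def)
  next
    case 3
    have "(flat_exp (Suc k) \<longlongrightarrow> 0) (at 0)"
    proof (rule Lim_null_comparison)
      show "\<forall>\<^sub>F y in at 0. norm (flat_exp (Suc k) y) \<le> fact (Suc (Suc k)) * \<bar>y\<bar>"
        using flat_exp_bound[of "Suc k"] by (intro always_eventually) simp
      have "((\<lambda>y::real. fact (Suc (Suc k)) * \<bar>y\<bar>) \<longlongrightarrow> fact (Suc (Suc k)) * \<bar>0\<bar>) (at 0)"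
        by (intro tendsto_intros)
      then show "((\<lambda>y::real. fact (Suc (Suc k)) * \<bar>y\<bar>) \<longlongrightarrow> 0) (at 0)" by simp
    qed
    moreover have "(\<lambda>y. (flat_exp k y - flat_exp k 0) / (y - 0)) = flat_exp (Suc k)"
      by (auto simp: flat_exp_def fun_eq_iff divide_inverse)
    ultimately show ?thesis
      using 3 by (simp add: has_field_derivative_iff) (simp add: flat_exp_def)
  qed
qed

lemma smooth_flat_exp_ridge: "smooth (\<lambda>x::'a::euclidean_space. flat_exp k (x \<bullet> v + c))"
proof (rule smooth_ridge[OF flat_exp_derivative])
  show "fun_algebra (range flat_exp) (\<lambda>y. flat_exp (i + 2) y + - real i * flat_exp (i + 1) y)" for i
    by (intro fun_algebra.add fun_algebra.mult fun_algebra.const) (auto intro: fun_algebra.base)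
qed

lemma flat_exp_0_bounds: "0 \<le> flat_exp 0 y" "flat_exp 0 y \<le> 1"
  by (auto simp: flat_exp_def)

text \<open>
  Positive exactly on the interior of the box shrunk by \<open>\<delta>\<close> on every side.  A function whose
  product with all these cutoffs vanishes is zero on the interior of the box.
\<close>

definition cutoff :: "'a::euclidean_space \<Rightarrow> 'a \<Rightarrow> real \<Rightarrow> 'a \<Rightarrow> real" where
  "cutoff lo hi \<delta> x =
     (\<Prod>b\<in>Basis. flat_exp 0 (x \<bullet> b - (lo \<bullet> b + \<delta>)) * flat_exp 0 ((hi \<bullet> b - \<delta>) - x \<bullet> b))"

lemma smooth_cutoff: "smooth (cutoff lo hi \<delta>)"
proof -
  have "smooth (\<lambda>x. flat_exp 0 (x \<bullet> b - (lo \<bullet> b + \<delta>)))" "smooth (\<lambda>x. flat_exp 0 ((hi \<bullet> b - \<delta>) - x \<bullet> b))"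
    for b :: 'a
    using smooth_flat_exp_ridge[of 0 b "- (lo \<bullet> b + \<delta>)"] smooth_flat_exp_ridge[of 0 "- b" "hi \<bullet> b - \<delta>"]
    by (simp_all add: algebra_simps)
  then show ?thesis
    unfolding cutoff_def[abs_def] by (intro smooth_prod smooth_mult)
qed

lemma cutoff_bounds: "0 \<le> cutoff lo hi \<delta> x" "cutoff lo hi \<delta> x \<le> 1"
  unfolding cutoff_def
  by (auto intro!: prod_nonneg prod_le_1 mult_le_one simp: flat_exp_0_bounds)

lemma cutoff_nonzero_iff:
  "cutoff lo hi \<delta> x \<noteq> 0 \<longleftrightarrow> (\<forall>b\<in>Basis. lo \<bullet> b + \<delta> < x \<bullet> b \<and> x \<bullet> b < hi \<bullet> b - \<delta>)"
  by (auto simp: cutoff_def flat_exp_def)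

lemma test_function_cutoff_mult:
  fixes lo hi :: "'a::euclidean_space"
  assumes \<delta>: "0 < \<delta>" and f: "smooth f"
  shows "test_function (cbox lo hi) (\<lambda>x. cutoff lo hi \<delta> x * f x)"
  unfolding test_function_def
proof (intro conjI exI[of _ "cbox (lo + \<delta> *\<^sub>R One) (hi - \<delta> *\<^sub>R One)"] allI impI)
  show "smooth (\<lambda>x. cutoff lo hi \<delta> x * f x)"
    by (intro smooth_mult smooth_cutoff f)
  show "cbox (lo + \<delta> *\<^sub>R One) (hi - \<delta> *\<^sub>R One) \<subseteq> interior (cbox lo hi)"
    using \<delta> unfolding interior_cbox
    by (force simp: mem_box inner_add_left inner_diff_left)
  show "cutoff lo hi \<delta> x * f x = 0" if "x \<notin> cbox (lo + \<delta> *\<^sub>R One) (hi - \<delta> *\<^sub>R One)" for x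
    using that cutoff_nonzero_iff[of lo hi \<delta> x]
    by (auto simp: mem_box inner_add_left inner_diff_left)
qed simp

section \<open>Integration over boxes\<close>

lemma finite_measure_lborel_on_cbox: "finite_measure (lborel_on (cbox lo hi))"
  by (rule finite_measureI)
     (simp add: space_restrict_space emeasure_restrict_space emeasure_lborel_cbox_eq)

lemma integral_lborel_on_cbox:
  fixes f :: "'a::euclidean_space \<Rightarrow> real"
  assumes "continuous_on UNIV f"
  shows "(\<integral>x. f x \<partial>lborel_on (cbox lo hi)) = integral (cbox lo hi) f"
proof -
  have "set_integrable lborel (cbox lo hi) f"
    unfolding set_integrable_def
    by (intro borel_integrable_compact continuous_on_subset[OF assms]) auto
  then have "(LINT x:cbox lo hi|lborel. f x) = integral (cbox lo hi) f"
    by (rule set_borel_integral_eq_integral)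
  then show ?thesis
    by (simp add: integral_restrict_space set_lebesgue_integral_def)
qed

lemma borel_measurable_lborel_on:
  "f \<in> borel_measurable borel \<Longrightarrow> f \<in> borel_measurable (lborel_on S)"
  by (intro measurable_restrict_space1) simp

lemma continuous_L2_cbox:
  fixes f :: "'a::euclidean_space \<Rightarrow> real"
  assumes "continuous_on UNIV f"
  shows "f \<in> L2_space (lborel_on (cbox lo hi))"
proof -
  have "bounded (f ` cbox lo hi)"
    using assms by (intro compact_imp_bounded compact_continuous_image continuous_on_subset[OF assms]) auto
  then obtain c where "\<And>x. x \<in> cbox lo hi \<Longrightarrow> \<bar>f x\<bar> \<le> c"
    unfolding bounded_iff by auto
  then show ?thesis
    using assms by (intro L2_bounded[OF finite_measure_lborel_on_cbox])
      (auto intro!: borel_measurable_lborel_on borel_measurable_continuous_onI simp: space_restrict_space)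
qed

lemma L2_inner_cbox:
  fixes f g :: "'a::euclidean_space \<Rightarrow> real"
  assumes "continuous_on UNIV f" "continuous_on UNIV g"
  shows "L2_inner (lborel_on (cbox lo hi)) f g = integral (cbox lo hi) (\<lambda>x. f x * g x)"
  unfolding L2_inner_def by (intro integral_lborel_on_cbox continuous_on_mult assms)

lemma AE_in_box: "AE x in lborel_on (cbox lo hi). x \<in> box lo hi"
proof -
  have "emeasure lborel (cbox lo hi - box lo hi) = 0"
    by (subst emeasure_Diff)
       (auto simp: emeasure_lborel_cbox_eq emeasure_lborel_box_eq box_subset_cbox[THEN subsetD] intro: box_subset_cbox)
  then have "cbox lo hi - box lo hi \<in> null_sets lborel"
    by (intro null_setsI) auto
  then have "AE x in lborel. x \<notin> cbox lo hi - box lo hi"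
    by (rule AE_not_in)
  then show ?thesis
    by (subst AE_restrict_space_iff) (auto elim: eventually_mono)
qed

lemma cell_eq_cbox: "cell l1 l2 a = cbox (0, 0, 0) (l1, l2, a)"
  by (simp add: cell_def cbox_Pair_eq)

lemma integral_triple_product:
  fixes f g h :: "real \<Rightarrow> real"
  assumes f: "continuous_on UNIV f" and g: "continuous_on UNIV g" and h: "continuous_on UNIV h"
  shows "integral (cell l1 l2 a) (\<lambda>(x, y, z). f x * g y * h z)
    = integral {0..l1} f * integral {0..l2} g * integral {0..a} h"
proof -
  have c: "continuous_on S (\<lambda>p. f (fst p))" "continuous_on S (\<lambda>p. g (fst (snd p)))"
    "continuous_on S (\<lambda>p. h (snd (snd p)))" for S :: "(real \<times> real \<times> real) set"
    by (intro continuous_on_compose2[OF f] continuous_on_compose2[OF g] continuous_on_compose2[OF h]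
        continuous_intros; simp)+
  have c': "continuous_on S (\<lambda>p. g (fst p))" "continuous_on S (\<lambda>p. h (snd p))" for S :: "(real \<times> real) set"
    by (intro continuous_on_compose2[OF g] continuous_on_compose2[OF h] continuous_intros; simp)+
  have "integral (cell l1 l2 a) (\<lambda>(x, y, z). f x * g y * h z)
     = integral {0..l1} (\<lambda>x. integral (cbox (0, 0) (l2, a)) (\<lambda>(y, z). f x * g y * h z))"
    unfolding cell_eq_cbox
    by (subst integral_prod_continuous)
       (auto simp: case_prod_unfold cbox_Pair_eq[symmetric] intro!: continuous_on_mult c)
  also have "\<dots> = integral {0..l1} (\<lambda>x. f x * (integral {0..l2} g * integral {0..a} h))"
  proof (rule Henstock_Kurzweil_Integration.integral_cong)
    fix x
    have "integral (cbox (0, 0) (l2, a)) (\<lambda>(y, z). f x * g y * h z)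
       = integral {0..l2} (\<lambda>y. integral {0..a} (\<lambda>z. f x * g y * h z))"
      by (subst integral_prod_continuous)
         (auto simp: case_prod_unfold intro!: continuous_on_mult c' continuous_on_const)
    then show "integral (cbox (0, 0) (l2, a)) (\<lambda>(y, z). f x * g y * h z)
       = f x * (integral {0..l2} g * integral {0..a} h)"
      by (simp add: mult_ac)
  qed
  also have "\<dots> = integral {0..l1} f * integral {0..l2} g * integral {0..a} h"
    by (simp add: mult_ac)
  finally show ?thesis .
qed

section \<open>The eigenfunctions of the mixed cell\<close>

definition neumann_mode :: "real \<Rightarrow> nat \<Rightarrow> real \<Rightarrow> real" where
  "neumann_mode l m x = sqrt ((if m = 0 then 1 else 2) / l) * cos (pi * real m / l * x)"

definition dirichlet_mode :: "real \<Rightarrow> nat \<Rightarrow> real \<Rightarrow> real" where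
  "dirichlet_mode l r x = sqrt (2 / l) * sin (pi * real (Suc r) / l * x)"

text \<open>
  Integer frequencies allow negative differences \<open>m - m'\<close> of two indices.
\<close>

lemma integral_cos_int:
  assumes "0 < l"
  shows "((\<lambda>x. cos (pi * real_of_int j / l * x)) has_integral (if j = 0 then l else 0)) {0..l}"
proof (cases "j = 0")
  case True
  then show ?thesis using has_integral_const_real[of "1::real" 0 l] assms by simp
next
  case False
  define c where "c = pi * real_of_int j / l"
  have c: "c \<noteq> 0" using False assms by (simp add: c_def)
  have "((\<lambda>x. cos (c * x)) has_integral (sin (c * l) / c - sin (c * 0) / c)) {0..l}"
    using assms c
    by (intro fundamental_theorem_of_calculus)
       (auto intro!: derivative_eq_intros simp: has_real_derivative_iff_has_vector_derivative[symmetric])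
  moreover have "sin (c * l) = 0" using assms by (simp add: c_def)
  ultimately show ?thesis using False by (simp add: c_def)
qed

lemma neumann_mode_continuous: "continuous_on S (neumann_mode l m)"
  unfolding neumann_mode_def[abs_def] by (intro continuous_intros)

lemma dirichlet_mode_continuous: "continuous_on S (dirichlet_mode l m)"
  unfolding dirichlet_mode_def[abs_def] by (intro continuous_intros)

lemma integral_neumann_modes:
  assumes l: "0 < l"
  shows "integral {0..l} (\<lambda>x. neumann_mode l m x * neumann_mode l m' x) = (if m = m' then 1 else 0)"
proof -
  let ?C = "\<lambda>j x. cos (pi * real_of_int j / l * x)"
  define c where "c = sqrt ((if m = 0 then 1 else 2) / l) * sqrt ((if m' = 0 then 1 else 2) / l)"
  have "((\<lambda>x. c / 2 * (?C (int m - int m') x + ?C (int m + int m') x))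
    has_integral c / 2 * ((if int m - int m' = 0 then l else 0) + (if int m + int m' = 0 then l else 0))) {0..l}"
    by (intro has_integral_mult_right has_integral_add integral_cos_int l)
  also have "(\<lambda>x. c / 2 * (?C (int m - int m') x + ?C (int m + int m') x))
     = (\<lambda>x. neumann_mode l m x * neumann_mode l m' x)"
  proof
    fix x
    have "cos (pi * real m / l * x) * cos (pi * real m' / l * x)
      = (?C (int m - int m') x + ?C (int m + int m') x) / 2"
      by (simp add: cos_times_cos algebra_simps diff_divide_distrib add_divide_distrib)
    then show "c / 2 * (?C (int m - int m') x + ?C (int m + int m') x)
      = neumann_mode l m x * neumann_mode l m' x"
      by (simp add: neumann_mode_def c_def mult_ac)
  qed
  also have "c / 2 * ((if int m - int m' = 0 then l else 0) + (if int m + int m' = 0 then l else 0)) = (if m = m' then 1 else 0)"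
    using l by (auto simp: c_def)
  finally show ?thesis by (rule integral_unique)
qed

lemma integral_dirichlet_modes:
  assumes l: "0 < l"
  shows "integral {0..l} (\<lambda>x. dirichlet_mode l m x * dirichlet_mode l m' x) = (if m = m' then 1 else 0)"
proof -
  let ?m = "int (Suc m)" and ?m' = "int (Suc m')"
  let ?C = "\<lambda>j x. cos (pi * real_of_int j / l * x)"
  have "((\<lambda>x. 1 / l * (?C (?m - ?m') x - ?C (?m + ?m') x))
    has_integral 1 / l * ((if ?m - ?m' = 0 then l else 0) - (if ?m + ?m' = 0 then l else 0))) {0..l}"
    by (intro has_integral_mult_right has_integral_diff integral_cos_int l)
  also have "(\<lambda>x. 1 / l * (?C (?m - ?m') x - ?C (?m + ?m') x))
     = (\<lambda>x. dirichlet_mode l m x * dirichlet_mode l m' x)"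
  proof
    fix x
    have "sin (pi * real (Suc m) / l * x) * sin (pi * real (Suc m') / l * x)
      = (?C (?m - ?m') x - ?C (?m + ?m') x) / 2"
      by (simp add: sin_times_sin algebra_simps diff_divide_distrib add_divide_distrib)
    moreover have "dirichlet_mode l m x * dirichlet_mode l m' x
      = (sqrt (2 / l) * sqrt (2 / l)) * (sin (pi * real (Suc m) / l * x) * sin (pi * real (Suc m') / l * x))"
      by (simp only: dirichlet_mode_def mult_ac)
    ultimately show "1 / l * (?C (?m - ?m') x - ?C (?m + ?m') x) = dirichlet_mode l m x * dirichlet_mode l m' x"
      using l by simp
  qed
  also have "1 / l * ((if ?m - ?m' = 0 then l else 0) - (if ?m + ?m' = 0 then l else 0)) = (if m = m' then 1 else 0)"
    using l by auto
  finally show ?thesis by (rule integral_unique)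
qed

definition cell_mode :: "real \<Rightarrow> real \<Rightarrow> real \<Rightarrow> nat \<times> nat \<times> nat \<Rightarrow> real \<times> real \<times> real \<Rightarrow> real" where
  "cell_mode l1 l2 a = (\<lambda>(m, n, r) (x, y, z). neumann_mode l1 m x * neumann_mode l2 n y * dirichlet_mode a r z)"

definition cell_eigenvalue :: "real \<Rightarrow> real \<Rightarrow> real \<Rightarrow> nat \<times> nat \<times> nat \<Rightarrow> real" where
  "cell_eigenvalue l1 l2 a =
     (\<lambda>(m, n, r). (pi * real m / l1)\<^sup>2 + (pi * real n / l2)\<^sup>2 + (pi * real (Suc r) / a)\<^sup>2)"

lemma cell_mode_continuous: "continuous_on S (cell_mode l1 l2 a k)"
proof (cases k)
  case (fields m n r)
  have "continuous_on S (\<lambda>p. neumann_mode l1 m (fst p) * neumann_mode l2 n (fst (snd p)) * dirichlet_mode a r (snd (snd p)))"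
    by (intro continuous_on_mult continuous_on_compose2[OF neumann_mode_continuous[of UNIV]]
        continuous_on_compose2[OF dirichlet_mode_continuous[of UNIV]] continuous_intros; simp)
  then show ?thesis by (simp add: fields cell_mode_def case_prod_unfold)
qed

lemma cell_mode_orthonormal:
  assumes "0 < l1" "0 < l2" "0 < a"
  shows "L2_inner (lborel_on (cell l1 l2 a)) (cell_mode l1 l2 a j) (cell_mode l1 l2 a k) = (if j = k then 1 else 0)"
proof -
  obtain m n r where j: "j = (m, n, r)" by (cases j)
  obtain m' n' r' where k: "k = (m', n', r')" by (cases k)
  have "L2_inner (lborel_on (cell l1 l2 a)) (cell_mode l1 l2 a j) (cell_mode l1 l2 a k)
    = integral (cell l1 l2 a) (\<lambda>p. cell_mode l1 l2 a j p * cell_mode l1 l2 a k p)"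
    unfolding cell_eq_cbox by (rule L2_inner_cbox[OF cell_mode_continuous cell_mode_continuous])
  also have "(\<lambda>p. cell_mode l1 l2 a j p * cell_mode l1 l2 a k p) = (\<lambda>(x, y, z).
      (neumann_mode l1 m x * neumann_mode l1 m' x) * (neumann_mode l2 n y * neumann_mode l2 n' y)
      * (dirichlet_mode a r z * dirichlet_mode a r' z))"
    by (auto simp: j k cell_mode_def fun_eq_iff)
  also have "integral (cell l1 l2 a) \<dots> = (if m = m' then 1 else 0) * (if n = n' then 1 else 0) * (if r = r' then 1 else 0)"
    by (subst integral_triple_product)
       (auto intro!: continuous_on_mult neumann_mode_continuous dirichlet_mode_continuous
         simp: integral_neumann_modes integral_dirichlet_modes assms)
  finally show ?thesis by (auto simp: j k)
qed

section \<open>Completeness of the eigenfunctions\<close>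

definition mode_span :: "real \<Rightarrow> real \<Rightarrow> real \<Rightarrow> (real \<times> real \<times> real \<Rightarrow> real) set" where
  "mode_span l1 l2 a = {f. \<exists>F c. finite F \<and> f = (\<lambda>p. \<Sum>k\<in>F. c k * cell_mode l1 l2 a k p)}"

lemma mode_span_add:
  assumes "f \<in> mode_span l1 l2 a" "g \<in> mode_span l1 l2 a"
  shows "(\<lambda>p. f p + g p) \<in> mode_span l1 l2 a"
proof -
  obtain F c G d where F: "finite F" "f = (\<lambda>p. \<Sum>k\<in>F. c k * cell_mode l1 l2 a k p)"
    and G: "finite G" "g = (\<lambda>p. \<Sum>k\<in>G. d k * cell_mode l1 l2 a k p)"
    using assms by (auto simp: mode_span_def)
  define c' where "c' k = (if k \<in> F then c k else 0)" for k
  define d' where "d' k = (if k \<in> G then d k else 0)" for k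
  have "f p = (\<Sum>k\<in>F \<union> G. c' k * cell_mode l1 l2 a k p)" for p
    unfolding F(2) using F G by (intro sum.mono_neutral_cong_left) (auto simp: c'_def)
  moreover have "g p = (\<Sum>k\<in>F \<union> G. d' k * cell_mode l1 l2 a k p)" for p
    unfolding G(2) using F G by (intro sum.mono_neutral_cong_left) (auto simp: d'_def)
  ultimately have "(\<lambda>p. f p + g p) = (\<lambda>p. \<Sum>k\<in>F \<union> G. (c' k + d' k) * cell_mode l1 l2 a k p)"
    by (simp add: sum.distrib distrib_right)
  then show ?thesis
    unfolding mode_span_def
    by (intro CollectI exI[of _ "F \<union> G"] exI[of _ "\<lambda>k. c' k + d' k"] conjI) (use F(1) G(1) in simp_all)
qed

lemma mode_span_cmult:
  assumes "f \<in> mode_span l1 l2 a"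
  shows "(\<lambda>p. b * f p) \<in> mode_span l1 l2 a"
proof -
  obtain F c where F: "finite F" "f = (\<lambda>p. \<Sum>k\<in>F. c k * cell_mode l1 l2 a k p)"
    using assms by (auto simp: mode_span_def)
  then have "(\<lambda>p. b * f p) = (\<lambda>p. \<Sum>k\<in>F. (b * c k) * cell_mode l1 l2 a k p)"
    by (simp add: sum_distrib_left mult.assoc)
  then show ?thesis
    unfolding mode_span_def
    by (intro CollectI exI[of _ F] exI[of _ "\<lambda>k. b * c k"] conjI F(1))
qed

lemma mode_span_zero: "(\<lambda>p. 0) \<in> mode_span l1 l2 a"
  unfolding mode_span_def by (auto intro!: exI[of _ "{}"])

lemma mode_span_mode: "cell_mode l1 l2 a k \<in> mode_span l1 l2 a"
  unfolding mode_span_def by (auto intro!: exI[of _ "{k}"] exI[of _ "\<lambda>_. 1"])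

lemma mode_span_sum:
  assumes "finite F" "\<And>k. k \<in> F \<Longrightarrow> f k \<in> mode_span l1 l2 a"
  shows "(\<lambda>p. \<Sum>k\<in>F. f k p) \<in> mode_span l1 l2 a"
  using assms by (induction F) (auto intro: mode_span_zero mode_span_add)

text \<open>
  Integer frequencies make the product formulas for sine and cosine uniform: a negative index
  gives the mode of opposite index up to sign, and \<open>r = 0\<close> gives the zero function.
\<close>

definition raw_mode :: "real \<Rightarrow> real \<Rightarrow> real \<Rightarrow> int \<Rightarrow> int \<Rightarrow> int \<Rightarrow> real \<times> real \<times> real \<Rightarrow> real" where
  "raw_mode l1 l2 a m n r = (\<lambda>(x, y, z).
     cos (of_int m * (pi / l1 * x)) * cos (of_int n * (pi / l2 * y)) * sin (of_int r * (pi / a * z)))"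

lemma cell_mode_raw:
  assumes "0 < l1" "0 < l2" "0 < a"
  obtains d where "d \<noteq> 0" "cell_mode l1 l2 a (m, n, r) = (\<lambda>p. d * raw_mode l1 l2 a (int m) (int n) (int (Suc r)) p)"
proof
  let ?d = "sqrt ((if m = 0 then 1 else 2) / l1) * sqrt ((if n = 0 then 1 else 2) / l2) * sqrt (2 / a)"
  show "?d \<noteq> 0" using assms by auto
  show "cell_mode l1 l2 a (m, n, r) = (\<lambda>p. ?d * raw_mode l1 l2 a (int m) (int n) (int (Suc r)) p)"
    by (auto simp: cell_mode_def raw_mode_def neumann_mode_def dirichlet_mode_def fun_eq_iff mult_ac)
qed

lemma raw_mode_in_span:
  assumes "0 < l1" "0 < l2" "0 < a"
  shows "raw_mode l1 l2 a m n r \<in> mode_span l1 l2 a"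
proof (cases "r = 0")
  case True
  then have "raw_mode l1 l2 a m n r = (\<lambda>p. 0)" by (auto simp: raw_mode_def)
  then show ?thesis by (simp add: mode_span_zero)
next
  case False
  define r' where "r' = nat (\<bar>r\<bar> - 1)"
  have r': "int (Suc r') = \<bar>r\<bar>" using False by (simp add: r'_def)
  obtain d where d: "d \<noteq> 0"
    "cell_mode l1 l2 a (nat \<bar>m\<bar>, nat \<bar>n\<bar>, r') = (\<lambda>p. d * raw_mode l1 l2 a (int (nat \<bar>m\<bar>)) (int (nat \<bar>n\<bar>)) (int (Suc r')) p)"
    using cell_mode_raw[OF assms] by blast
  have c: "cos (of_int \<bar>i\<bar> * \<theta>) = cos (of_int i * \<theta>)" and s: "sin (of_int \<bar>i\<bar> * \<theta>) = of_int (sgn i) * sin (of_int i * \<theta>)"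
    for i :: int and \<theta> :: real by (auto simp: abs_if sgn_if)
  have "raw_mode l1 l2 a \<bar>m\<bar> \<bar>n\<bar> \<bar>r\<bar> p = of_int (sgn r) * raw_mode l1 l2 a m n r p" for p
    unfolding raw_mode_def c s by (simp add: case_prod_unfold)
  then have cell: "cell_mode l1 l2 a (nat \<bar>m\<bar>, nat \<bar>n\<bar>, r') p = d * (of_int (sgn r) * raw_mode l1 l2 a m n r p)" for p
    unfolding d(2) r' by simp
  have "raw_mode l1 l2 a m n r = (\<lambda>p. of_int (sgn r) / d * cell_mode l1 l2 a (nat \<bar>m\<bar>, nat \<bar>n\<bar>, r') p)"
    using d(1) False unfolding cell by (simp add: sgn_if)
  then show ?thesis using mode_span_cmult[OF mode_span_mode] by metis
qed

lemma cos_product_to_sum: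
  fixes \<theta> :: real
  shows "cos \<theta> * cos (of_int m * \<theta>) = (cos (of_int (m + 1) * \<theta>) + cos (of_int (m - 1) * \<theta>)) / 2"
  "cos \<theta> * sin (of_int m * \<theta>) = (sin (of_int (m + 1) * \<theta>) + sin (of_int (m - 1) * \<theta>)) / 2"
  by (simp_all add: distrib_right left_diff_distrib cos_add cos_diff sin_add sin_diff)

text \<open>
  The continuous multipliers of the span form an algebra by construction, unlike the span itself,
  which contains no constants.  Stone--Weierstrass applies to them.
\<close>

definition span_multiplier :: "real \<Rightarrow> real \<Rightarrow> real \<Rightarrow> (real \<times> real \<times> real \<Rightarrow> real) \<Rightarrow> bool" where
  "span_multiplier l1 l2 a g \<longleftrightarrow> continuous_on UNIV g \<and> (\<forall>f\<in>mode_span l1 l2 a. (\<lambda>p. g p * f p) \<in> mode_span l1 l2 a)"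

lemma span_multiplierI:
  assumes "0 < l1" "0 < l2" "0 < a" and g: "continuous_on UNIV g"
    and raw: "\<And>m n r. (\<lambda>p. g p * raw_mode l1 l2 a m n r p) \<in> mode_span l1 l2 a"
  shows "span_multiplier l1 l2 a g"
  unfolding span_multiplier_def
proof (intro conjI ballI g)
  fix f assume "f \<in> mode_span l1 l2 a"
  then obtain F c where F: "finite F" "f = (\<lambda>p. \<Sum>k\<in>F. c k * cell_mode l1 l2 a k p)"
    by (auto simp: mode_span_def)
  have "(\<lambda>p. g p * cell_mode l1 l2 a k p) \<in> mode_span l1 l2 a" for k
  proof (cases k)
    case (fields m n r)
    obtain d where "cell_mode l1 l2 a (m, n, r) = (\<lambda>p. d * raw_mode l1 l2 a (int m) (int n) (int (Suc r)) p)"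
      using cell_mode_raw[OF assms(1-3)] by blast
    then show ?thesis
      using mode_span_cmult[OF raw, of d "int m" "int n" "int (Suc r)"] by (simp add: fields mult_ac)
  qed
  from mode_span_sum[OF F(1) mode_span_cmult[OF this]]
  have "(\<lambda>p. \<Sum>k\<in>F. c k * (g p * cell_mode l1 l2 a k p)) \<in> mode_span l1 l2 a" .
  also have "(\<lambda>p. \<Sum>k\<in>F. c k * (g p * cell_mode l1 l2 a k p)) = (\<lambda>p. g p * f p)"
    by (simp add: F(2) sum_distrib_left mult_ac)
  finally show "(\<lambda>p. g p * f p) \<in> mode_span l1 l2 a" .
qed

lemma cos_span_multiplier:
  assumes l: "0 < l1" "0 < l2" "0 < a"
  shows "span_multiplier l1 l2 a (\<lambda>p. cos (pi / l1 * fst p))"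
    and "span_multiplier l1 l2 a (\<lambda>p. cos (pi / l2 * fst (snd p)))"
    and "span_multiplier l1 l2 a (\<lambda>p. cos (pi / a * snd (snd p)))"
proof -
  have half: "(\<lambda>p. 1 / 2 * (raw_mode l1 l2 a m n r p + raw_mode l1 l2 a m' n' r' p)) \<in> mode_span l1 l2 a"
    for m n r m' n' r'
    by (intro mode_span_cmult mode_span_add raw_mode_in_span l)
  have expand: "c * (d * Y * Z) = 1 / 2 * (p * Y * Z + q * Y * Z)"
    "c * (Y * d * Z) = 1 / 2 * (Y * p * Z + Y * q * Z)" "c * (Y * Z * d) = 1 / 2 * (Y * Z * p + Y * Z * q)"
    if "c * d = (p + q) / 2" for c d p q Y Z :: real
  proof -
    have "c * (d * Y * Z) = c * d * Y * Z" "c * (Y * d * Z) = c * d * Y * Z" "c * (Y * Z * d) = c * d * Y * Z"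
      by (simp_all only: mult_ac)
    then show "c * (d * Y * Z) = 1 / 2 * (p * Y * Z + q * Y * Z)"
      "c * (Y * d * Z) = 1 / 2 * (Y * p * Z + Y * q * Z)" "c * (Y * Z * d) = 1 / 2 * (Y * Z * p + Y * Z * q)"
      unfolding that by (simp_all add: field_simps)
  qed
  note expand = expand(1)[OF cos_product_to_sum(1)] expand(2)[OF cos_product_to_sum(1)]
    expand(3)[OF cos_product_to_sum(2)]
  have raw: "(\<lambda>p. cos (pi / l1 * fst p) * raw_mode l1 l2 a m n r p)
      = (\<lambda>p. 1 / 2 * (raw_mode l1 l2 a (m + 1) n r p + raw_mode l1 l2 a (m - 1) n r p))"
    "(\<lambda>p. cos (pi / l2 * fst (snd p)) * raw_mode l1 l2 a m n r p)
      = (\<lambda>p. 1 / 2 * (raw_mode l1 l2 a m (n + 1) r p + raw_mode l1 l2 a m (n - 1) r p))"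
    "(\<lambda>p. cos (pi / a * snd (snd p)) * raw_mode l1 l2 a m n r p)
      = (\<lambda>p. 1 / 2 * (raw_mode l1 l2 a m n (r + 1) p + raw_mode l1 l2 a m n (r - 1) p))" for m n r
    unfolding raw_mode_def fun_eq_iff split_paired_All case_prod_conv fst_conv snd_conv
    by (intro allI expand)+
  show "span_multiplier l1 l2 a (\<lambda>p. cos (pi / l1 * fst p))"
    by (rule span_multiplierI[OF l]) (intro continuous_intros, simp only: raw half)
  show "span_multiplier l1 l2 a (\<lambda>p. cos (pi / l2 * fst (snd p)))"
    by (rule span_multiplierI[OF l]) (intro continuous_intros, simp only: raw half)
  show "span_multiplier l1 l2 a (\<lambda>p. cos (pi / a * snd (snd p)))"
    by (rule span_multiplierI[OF l]) (intro continuous_intros, simp only: raw half)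
qed

text \<open>
  The cosines of lowest frequency in the three coordinates are multipliers, and they separate the
  points of the cell because the cosine is injective on \<open>[0, \<pi>]\<close>.
\<close>

lemma span_multiplier_dense:
  assumes l: "0 < l1" "0 < l2" "0 < a" and f: "continuous_on (cell l1 l2 a) f" and e: "0 < \<epsilon>"
  obtains g where "span_multiplier l1 l2 a g" "\<And>p. p \<in> cell l1 l2 a \<Longrightarrow> \<bar>f p - g p\<bar> < \<epsilon>"
proof -
  have inj: "x = y" if "cos (pi / c * x) = cos (pi / c * y)" "0 \<le> x" "x \<le> c" "0 \<le> y" "y \<le> c" "0 < c" for x y c :: real
  proof -
    have le: "pi / c * x \<le> pi" "pi / c * y \<le> pi"
      using that(2-6) by (simp_all add: field_simps)
    have "0 \<le> pi / c * x" "0 \<le> pi / c * y"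
      using that(2-6) by simp_all
    then have "pi / c * x = pi / c * y"
      using le that(1) cos_inj_pi[of "pi / c * x" "pi / c * y"] by blast
    then show ?thesis using that(6) by simp
  qed
  have "\<exists>g. span_multiplier l1 l2 a g \<and> (\<forall>p\<in>cell l1 l2 a. \<bar>f p - g p\<bar> < \<epsilon>)"
  proof (rule Stone_Weierstrass_HOL[OF _ _ _ _ _ _ f e])
    show "compact (cell l1 l2 a)" by (simp add: cell_eq_cbox)
    show "span_multiplier l1 l2 a (\<lambda>x. c)" for c
      by (auto simp: span_multiplier_def intro: mode_span_cmult)
    show "continuous_on (cell l1 l2 a) g" if "span_multiplier l1 l2 a g" for g
      using that continuous_on_subset by (auto simp: span_multiplier_def)
    show "span_multiplier l1 l2 a (\<lambda>x. g x + h x)" if "span_multiplier l1 l2 a g \<and> span_multiplier l1 l2 a h" for g h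
      using that by (auto simp: span_multiplier_def distrib_right intro!: continuous_on_add mode_span_add)
    show "span_multiplier l1 l2 a (\<lambda>x. g x * h x)" if "span_multiplier l1 l2 a g \<and> span_multiplier l1 l2 a h" for g h
      using that by (auto simp: span_multiplier_def mult.assoc intro!: continuous_on_mult)
    show "\<exists>g. span_multiplier l1 l2 a g \<and> g p \<noteq> g q"
      if "p \<in> cell l1 l2 a \<and> q \<in> cell l1 l2 a \<and> p \<noteq> q" for p q
    proof (rule ccontr)
      assume "\<nexists>g. span_multiplier l1 l2 a g \<and> g p \<noteq> g q"
      then have eq: "g p = g q" if "span_multiplier l1 l2 a g" for g using that by blast
      have "fst p = fst q" "fst (snd p) = fst (snd q)" "snd (snd p) = snd (snd q)"
        using eq[OF cos_span_multiplier(1)[OF l]] eq[OF cos_span_multiplier(2)[OF l]]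
          eq[OF cos_span_multiplier(3)[OF l]] that l
        by (auto simp: cell_def intro: inj)
      then show False using that by (simp add: prod_eq_iff)
    qed
  qed
  then show thesis using that by blast
qed

lemma L2_norm_tendsto_dominated:
  fixes u :: "nat \<Rightarrow> 'a \<Rightarrow> real"
  assumes meas: "\<And>n. u n \<in> borel_measurable M" and w: "w \<in> L2_space M"
    and bound: "\<And>n. AE x in M. \<bar>u n x\<bar> \<le> \<bar>w x\<bar>" and lim: "AE x in M. (\<lambda>n. u n x) \<longlonglongrightarrow> 0"
  shows "(\<lambda>n. L2_norm M (u n)) \<longlonglongrightarrow> 0"
proof -
  have "(\<lambda>n. \<integral>x. u n x * u n x \<partial>M) \<longlonglongrightarrow> (\<integral>x. 0 \<partial>M)"
  proof (rule integral_dominated_convergence)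
    show "(\<lambda>x. u n x * u n x) \<in> borel_measurable M" for n using meas by simp
    show "integrable M (\<lambda>x. (w x)\<^sup>2)" using L2_spaceD(2)[OF w] .
    show "AE x in M. (\<lambda>n. u n x * u n x) \<longlonglongrightarrow> 0"
      using lim by eventually_elim (auto intro: tendsto_mult_zero)
    show "AE x in M. norm (u n x * u n x) \<le> (w x)\<^sup>2" for n
      using bound[of n]
    proof eventually_elim
      case (elim x)
      then have "\<bar>u n x\<bar>\<^sup>2 \<le> \<bar>w x\<bar>\<^sup>2" by (rule power_mono) simp
      then show ?case by (simp add: power2_eq_square)
    qed
  qed simp
  then have "(\<lambda>n. sqrt (L2_inner M (u n) (u n))) \<longlonglongrightarrow> sqrt 0"
    by (intro tendsto_real_sqrt) (simp add: L2_inner_def)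
  then show ?thesis by (simp add: L2_norm_def)
qed

text \<open>
  Almost everywhere approximation of a bounded measurable function by continuous functions with
  the same bound; clamping the approximants does not disturb the convergence.
\<close>

lemma continuous_approximation_cbox:
  fixes h :: "'a::euclidean_space \<Rightarrow> real"
  assumes h: "h \<in> borel_measurable (lborel_on (cbox lo hi))"
    and N: "\<And>x. \<bar>h x\<bar> \<le> N"
  obtains c :: "nat \<Rightarrow> 'a \<Rightarrow> real" where "\<And>n. continuous_on UNIV (c n)" "\<And>n x. \<bar>c n x\<bar> \<le> N"
    "AE x in lborel_on (cbox lo hi). (\<lambda>n. c n x) \<longlonglongrightarrow> h x"
proof -
  define h' where "h' x = indicator (cbox lo hi) x *\<^sub>R h x" for x
  have "h' \<in> borel_measurable lborel"
    using h unfolding h'_def by (subst (asm) borel_measurable_restrict_space_iff) auto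
  then have "h' \<in> borel_measurable lebesgue" by (rule measurable_completion)
  then have "h' measurable_on UNIV"
    by (intro lebesgue_measurable_imp_measurable_on_real) auto
  then obtain S g where S: "negligible S" and g: "\<And>n. continuous_on UNIV (g n)"
    and lim: "\<And>x. x \<notin> S \<Longrightarrow> (\<lambda>n. g n x) \<longlonglongrightarrow> h' x"
    by (auto simp: measurable_on_def)
  have N0: "0 \<le> N" using N[of undefined] by linarith
  define c where "c n x = max (- N) (min N (g n x))" for n :: nat and x
  show thesis
  proof (rule that[of c])
    show "continuous_on UNIV (c n)" for n
      unfolding c_def[abs_def] by (intro continuous_intros g)
    show "\<bar>c n x\<bar> \<le> N" for n x using N0 by (auto simp: c_def)
    have "AE x in lebesgue. x \<notin> S"
      using S by (intro AE_not_in) (simp add: negligible_iff_null_sets)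
    then have "AE x in lborel. x \<notin> S" by (simp add: AE_completion_iff)
    then have "AE x in lborel. x \<in> cbox lo hi \<longrightarrow> (\<lambda>n. c n x) \<longlonglongrightarrow> h x"
    proof eventually_elim
      case (elim x)
      have "(\<lambda>n. c n x) \<longlonglongrightarrow> max (- N) (min N (h' x))"
        unfolding c_def by (intro tendsto_intros lim elim)
      then show ?case using N[of x] by (auto simp: h'_def)
    qed
    then show "AE x in lborel_on (cbox lo hi). (\<lambda>n. c n x) \<longlonglongrightarrow> h x"
      by (subst AE_restrict_space_iff) auto
  qed
qed

lemma L2_tendsto_obtain:
  assumes "(\<lambda>n. L2_norm M (u n)) \<longlonglongrightarrow> 0" "0 < \<epsilon>"
  obtains n where "L2_norm M (u n) < \<epsilon>"
  using order_tendstoD(2)[OF assms] by (auto simp: eventually_sequentially)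

text \<open>
  All elements of the span vanish on the plates.  Write \<open>s = sin (\<pi> z / a)\<close>, the lowest mode up to
  a constant.  A function \<open>f\<close> is approximated successively by \<open>s * h\<close>, where \<open>h\<close> is \<open>f / s\<close>
  truncated at a level \<open>N\<close>, by \<open>s * c\<close> with \<open>c\<close> continuous, and by \<open>s * g\<close> with \<open>g\<close> a multiplier
  uniformly close to \<open>c\<close>; the last product lies in the span.
\<close>

lemma cell_modes_dense:
  assumes l: "0 < l1" "0 < l2" "0 < a" and f: "f \<in> L2_space (lborel_on (cell l1 l2 a))" and e: "0 < \<epsilon>"
  obtains g where "g \<in> mode_span l1 l2 a" "L2_norm (lborel_on (cell l1 l2 a)) (\<lambda>p. f p - g p) < \<epsilon>"
proof -
  let ?M = "lborel_on (cell l1 l2 a)"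
  note fin = finite_measure_lborel_on_cbox[of "(0, 0, 0)" "(l1, l2, a)", folded cell_eq_cbox]
  note L2c = continuous_L2_cbox[of _ "(0, 0, 0)" "(l1, l2, a)", folded cell_eq_cbox]
  define s where "s p = sin (pi / a * snd (snd p))" for p :: "real \<times> real \<times> real"
  have s_raw: "s = raw_mode l1 l2 a 0 0 1" by (auto simp: s_def raw_mode_def fun_eq_iff)
  have s_cont: "continuous_on UNIV s" unfolding s_def[abs_def] by (intro continuous_intros)
  have s_meas: "s \<in> borel_measurable ?M"
    by (intro borel_measurable_lborel_on borel_measurable_continuous_onI s_cont)
  have s_le: "\<bar>s p\<bar> \<le> 1" for p by (simp add: s_def)
  have s_pos: "AE p in ?M. 0 < s p"
  proof -
    have "0 < s p" if "p \<in> box (0, 0, 0) (l1, l2, a)" for p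
    proof -
      have "0 < snd (snd p)" "snd (snd p) < a" using that by (auto simp: mem_box Basis_prod_def inner_prod_def)
      then show ?thesis unfolding s_def using l(3) by (intro sin_gt_zero) (auto simp: field_simps)
    qed
    then show ?thesis
      using AE_in_box[of "(0, 0, 0)" "(l1, l2, a)"] unfolding cell_eq_cbox by (auto elim: eventually_mono)
  qed
  have f_meas: "f \<in> borel_measurable ?M" using L2_spaceD(1)[OF f] .
  define h where "h n p = max (- real n) (min (real n) (f p / s p))" for n :: nat and p
  have h_meas: "h n \<in> borel_measurable ?M" for n
    unfolding h_def[abs_def] using f_meas s_meas by (intro borel_measurable_max borel_measurable_min) auto
  have h_bound: "\<bar>h n p\<bar> \<le> real n" for n p by (auto simp: h_def)
  have "(\<lambda>n. L2_norm ?M (\<lambda>p. f p - s p * h n p)) \<longlonglongrightarrow> 0"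
  proof (rule L2_norm_tendsto_dominated[OF _ f])
    show "(\<lambda>p. f p - s p * h n p) \<in> borel_measurable ?M" for n
      using f_meas s_meas h_meas by simp
    show "AE p in ?M. \<bar>f p - s p * h n p\<bar> \<le> \<bar>f p\<bar>" for n
      using s_pos
    proof eventually_elim
      case (elim p)
      have fp: "f p = s p * (f p / s p)" using elim by simp
      have "\<bar>t - max (- real n) (min (real n) t)\<bar> \<le> \<bar>t\<bar>" for t :: real
        by (auto simp: max_def min_def)
      from this[of "f p / s p"] have "\<bar>f p / s p - h n p\<bar> \<le> \<bar>f p / s p\<bar>"
        by (simp only: h_def)
      then have "s p * \<bar>f p / s p - h n p\<bar> \<le> s p * \<bar>f p / s p\<bar>"
        using elim by (intro mult_left_mono) auto
      moreover have "s p * \<bar>f p / s p - h n p\<bar> = \<bar>f p - s p * h n p\<bar>"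
      proof -
        have "f p - s p * h n p = s p * (f p / s p - h n p)"
          using elim by (simp add: right_diff_distrib)
        then show ?thesis using elim by (simp only: abs_mult abs_of_pos)
      qed
      moreover have "s p * \<bar>f p / s p\<bar> = \<bar>f p\<bar>" using elim by simp
      ultimately show ?case by simp
    qed
    show "AE p in ?M. (\<lambda>n. f p - s p * h n p) \<longlonglongrightarrow> 0"
      using s_pos
    proof eventually_elim
      case (elim p)
      obtain N :: nat where N: "\<bar>f p / s p\<bar> \<le> real N" using real_arch_simple by blast
      have "f p - s p * h n p = 0" if "N \<le> n" for n
      proof -
        have "\<bar>f p / s p\<bar> \<le> real n" using N that by linarith
        moreover have "max (- real n) (min (real n) t) = t" if "\<bar>t\<bar> \<le> real n" for t :: real
          using that by (auto simp: max_def min_def)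
        ultimately have "h n p = f p / s p" by (simp only: h_def)
        then show ?thesis using elim by simp
      qed
      then show ?case by (intro tendsto_eventually) (auto simp: eventually_sequentially)
    qed
  qed
  then obtain N where N: "L2_norm ?M (\<lambda>p. f p - s p * h N p) < \<epsilon> / 3"
    using e by (elim L2_tendsto_obtain[where \<epsilon> = "\<epsilon> / 3"]) auto
  obtain c where c_cont: "\<And>n::nat. continuous_on UNIV (c n)" and c_bound: "\<And>n p. \<bar>c n p\<bar> \<le> real N"
    and c_lim: "AE p in ?M. (\<lambda>n. c n p) \<longlonglongrightarrow> h N p"
    using continuous_approximation_cbox[OF h_meas[of N, unfolded cell_eq_cbox] h_bound[of N]]
    unfolding cell_eq_cbox by blast
  have c_meas: "c n \<in> borel_measurable ?M" for n
    by (intro borel_measurable_lborel_on borel_measurable_continuous_onI c_cont)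
  have "(\<lambda>n. L2_norm ?M (\<lambda>p. s p * h N p - s p * c n p)) \<longlonglongrightarrow> 0"
  proof (rule L2_norm_tendsto_dominated[where w = "\<lambda>_. 2 * real N"])
    show "(\<lambda>p. s p * h N p - s p * c n p) \<in> borel_measurable ?M" for n
      using s_meas h_meas c_meas by simp
    show "(\<lambda>_. 2 * real N) \<in> L2_space ?M" by (intro L2c continuous_intros)
    have "\<bar>s p * h N p - s p * c n p\<bar> \<le> \<bar>2 * real N\<bar>" for n p
    proof -
      have "\<bar>s p * h N p - s p * c n p\<bar> = \<bar>s p\<bar> * \<bar>h N p - c n p\<bar>"
        by (simp add: abs_mult right_diff_distrib[symmetric])
      also have "\<dots> \<le> 1 * (2 * real N)"
        using h_bound[of N p] c_bound[of n p] s_le by (intro mult_mono) auto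
      finally show ?thesis by simp
    qed
    then show "AE p in ?M. \<bar>s p * h N p - s p * c n p\<bar> \<le> \<bar>2 * real N\<bar>" for n by simp
    show "AE p in ?M. (\<lambda>n. s p * h N p - s p * c n p) \<longlonglongrightarrow> 0"
      using c_lim
    proof eventually_elim
      case (elim p)
      have "(\<lambda>n. s p * h N p - s p * c n p) \<longlonglongrightarrow> s p * h N p - s p * h N p"
        by (intro tendsto_intros elim)
      then show ?case by simp
    qed
  qed
  then obtain n where n: "L2_norm ?M (\<lambda>p. s p * h N p - s p * c n p) < \<epsilon> / 3"
    using e by (elim L2_tendsto_obtain[where \<epsilon> = "\<epsilon> / 3"]) auto
  \<comment> \<open>The summand 1 keeps the denominator positive and makes the final estimate strict.\<close>
  define \<delta> where "\<delta> = \<epsilon> / 3 / (1 + sqrt (measure ?M (space ?M)))"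
  have \<delta>: "0 < \<delta>" using e by (simp add: \<delta>_def add_pos_nonneg)
  obtain g where g: "span_multiplier l1 l2 a g" and gc: "\<And>p. p \<in> cell l1 l2 a \<Longrightarrow> \<bar>c n p - g p\<bar> < \<delta>"
    using span_multiplier_dense[OF l continuous_on_subset[OF c_cont] \<delta>] by blast
  have g_cont: "continuous_on UNIV g" using g by (simp add: span_multiplier_def)
  have g_meas: "g \<in> borel_measurable ?M"
    by (intro borel_measurable_lborel_on borel_measurable_continuous_onI g_cont)
  have "L2_norm ?M (\<lambda>p. s p * c n p - s p * g p) \<le> \<delta> * sqrt (measure ?M (space ?M))"
  proof (rule L2_norm_le_bound[OF fin])
    show "(\<lambda>p. s p * c n p - s p * g p) \<in> borel_measurable ?M"
      using s_meas c_meas g_meas by simp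
    show "\<bar>s p * c n p - s p * g p\<bar> \<le> \<delta>" if "p \<in> space ?M" for p
    proof -
      have "\<bar>s p * c n p - s p * g p\<bar> = \<bar>s p\<bar> * \<bar>c n p - g p\<bar>"
        by (simp add: abs_mult right_diff_distrib[symmetric])
      also have "\<dots> \<le> 1 * \<delta>"
        using gc[of p] that s_le by (intro mult_mono) (auto simp: space_restrict_space)
      finally show ?thesis by simp
    qed
  qed (use \<delta> in simp)
  also have "\<dots> < \<delta> * (1 + sqrt (measure ?M (space ?M)))"
    using \<delta> by simp
  also have "\<dots> = \<epsilon> / 3"
  proof -
    have "1 + sqrt (measure ?M (space ?M)) \<noteq> 0"
      using real_sqrt_ge_zero[of "measure ?M (space ?M)"] by (simp add: add_nonneg_eq_0_iff)
    from nonzero_eq_divide_eq[OF this, of \<delta> "\<epsilon> / 3"] show ?thesis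
      unfolding \<delta>_def by blast
  qed
  finally have g3: "L2_norm ?M (\<lambda>p. s p * c n p - s p * g p) < \<epsilon> / 3" .
  have sh: "(\<lambda>p. s p * h N p) \<in> L2_space ?M"
    using L2_mult_bounded[OF L2_bounded[OF fin h_meas h_bound] s_meas s_le] .
  have sc: "(\<lambda>p. s p * c n p) \<in> L2_space ?M" and sg: "(\<lambda>p. s p * g p) \<in> L2_space ?M"
    by (intro L2c continuous_on_mult s_cont c_cont g_cont)+
  have "L2_norm ?M (\<lambda>p. f p - s p * g p) < \<epsilon>"
    using L2_norm_diff_triangle[OF f sh sg] L2_norm_diff_triangle[OF sh sc sg] N n g3 by linarith
  moreover have "(\<lambda>p. s p * g p) \<in> mode_span l1 l2 a"
    using g raw_mode_in_span[OF l, of 0 0 1] unfolding s_raw[symmetric]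
    by (auto simp: span_multiplier_def mult.commute[of "s _"])
  ultimately show thesis using that by blast
qed

lemma cell_mode_inj:
  assumes "0 < l1" "0 < l2" "0 < a"
  shows "inj (cell_mode l1 l2 a)"
proof (rule injI, rule ccontr)
  fix j k assume "cell_mode l1 l2 a j = cell_mode l1 l2 a k" "j \<noteq> k"
  then show False
    using cell_mode_orthonormal[OF assms, of j k] cell_mode_orthonormal[OF assms, of k k] by simp
qed

theorem cell_modes_basis:
  assumes l: "0 < l1" "0 < l2" "0 < a"
  shows "L2_orthonormal_basis (lborel_on (cell l1 l2 a)) (range (cell_mode l1 l2 a))"
  unfolding L2_orthonormal_basis_def
proof (intro conjI ballI allI impI)
  show "range (cell_mode l1 l2 a) \<subseteq> L2_space (lborel_on (cell l1 l2 a))"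
    unfolding cell_eq_cbox by (auto intro: continuous_L2_cbox cell_mode_continuous)
  show "L2_inner (lborel_on (cell l1 l2 a)) e e' = (if e = e' then 1 else 0)"
    if "e \<in> range (cell_mode l1 l2 a)" "e' \<in> range (cell_mode l1 l2 a)" for e e'
    using that cell_mode_orthonormal[OF l] cell_mode_inj[OF l] by (auto simp: inj_def)
  fix f \<epsilon> assume "f \<in> L2_space (lborel_on (cell l1 l2 a))" "0 < (\<epsilon>::real)"
  then obtain g where g: "g \<in> mode_span l1 l2 a" and fg: "L2_norm (lborel_on (cell l1 l2 a)) (\<lambda>p. f p - g p) < \<epsilon>"
    using cell_modes_dense[OF l] by blast
  obtain F c where F: "finite F" "g = (\<lambda>p. \<Sum>k\<in>F. c k * cell_mode l1 l2 a k p)"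
    using g by (auto simp: mode_span_def)
  define d where "d e = c (inv (cell_mode l1 l2 a) e)" for e
  have "g = (\<lambda>p. \<Sum>e\<in>cell_mode l1 l2 a ` F. d e * e p)"
    using cell_mode_inj[OF l] inj_on_subset[OF cell_mode_inj[OF l], of F]
    by (simp add: F(2) d_def sum.reindex)
  then show "\<exists>F c. finite F \<and> F \<subseteq> range (cell_mode l1 l2 a) \<and>
      L2_norm (lborel_on (cell l1 l2 a)) (\<lambda>x. f x - (\<Sum>e\<in>F. c e * e x)) < \<epsilon>"
    using F(1) fg by (intro exI[of _ "cell_mode l1 l2 a ` F"] exI[of _ d]) auto
qed

section \<open>Partial derivatives and integration by parts on the cell\<close>

lemma Basis_R3: "(Basis :: (real \<times> real \<times> real) set) = {(1, 0, 0), (0, 1, 0), (0, 0, 1)}"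
  by (auto simp: Basis_prod_def zero_prod_def)

lemma partial_along_line:
  fixes F :: "'a::euclidean_space \<Rightarrow> real"
  assumes F: "smooth F" and c: "(c has_derivative (\<lambda>h. h *\<^sub>R b)) (at t)"
  shows "((\<lambda>t. F (c t)) has_real_derivative frechet_derivative F (at (c t)) b) (at t)"
proof -
  have lin: "linear (frechet_derivative F (at (c t)))"
    by (rule linear_frechet_derivative[OF smooth_differentiable[OF F]])
  have "((\<lambda>t. F (c t)) has_derivative (\<lambda>h. frechet_derivative F (at (c t)) (h *\<^sub>R b))) (at t)"
    by (rule has_derivative_compose[OF c smooth_has_derivative[OF F]])
  also have "(\<lambda>h. frechet_derivative F (at (c t)) (h *\<^sub>R b)) = (*) (frechet_derivative F (at (c t)) b)"
    by (auto simp: linear_cmul[OF lin] mult.commute)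
  finally show ?thesis by (simp add: has_field_derivative_def)
qed

lemma coordinate_derivatives:
  fixes F :: "real \<times> real \<times> real \<Rightarrow> real"
  assumes "smooth F"
  shows "((\<lambda>t. F (t, y, z)) has_real_derivative frechet_derivative F (at (x, y, z)) (1, 0, 0)) (at x)"
    and "((\<lambda>t. F (x, t, z)) has_real_derivative frechet_derivative F (at (x, y, z)) (0, 1, 0)) (at y)"
    and "((\<lambda>t. F (x, y, t)) has_real_derivative frechet_derivative F (at (x, y, z)) (0, 0, 1)) (at z)"
  by (rule partial_along_line[OF assms]; auto intro!: derivative_eq_intros simp: zero_prod_def)+

lemma frechet_derivative_mult_smooth:
  assumes "smooth f" "smooth g"
  shows "frechet_derivative (\<lambda>x. f x * g x) (at x) b
    = f x * frechet_derivative g (at x) b + frechet_derivative f (at x) b * g x"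
  by (intro frechet_derivative_eqI has_derivative_mult smooth_has_derivative assms)

lemma frechet_derivative_add_smooth:
  assumes "smooth f" "smooth g"
  shows "frechet_derivative (\<lambda>x. f x + g x) (at x) b
    = frechet_derivative f (at x) b + frechet_derivative g (at x) b"
  by (intro frechet_derivative_eqI has_derivative_add smooth_has_derivative assms)

lemma frechet_derivative_lincomb_smooth:
  assumes "\<And>k. k \<in> F \<Longrightarrow> smooth (f k)"
  shows "frechet_derivative (\<lambda>x. \<Sum>k\<in>F. c k * f k x) (at x) b
    = (\<Sum>k\<in>F. c k * frechet_derivative (f k) (at x) b)"
  by (intro frechet_derivative_eqI has_derivative_sum has_derivative_mult_right smooth_has_derivative assms)

lemma smooth_inner_ridge: "smooth (\<lambda>x::'a::euclidean_space. x \<bullet> v)"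
proof -
  have "smooth (\<lambda>x::'a. (\<lambda>_::unit. \<lambda>y. y) () (x \<bullet> v + 0))"
    by (rule smooth_ridge[where g' = "\<lambda>_ _. 1"]) (auto intro: fun_algebra.const)
  then show ?thesis by simp
qed

definition neumann_mode_deriv :: "real \<Rightarrow> nat \<Rightarrow> real \<Rightarrow> real" where
  "neumann_mode_deriv l m x
     = - (pi * real m / l) * (sqrt ((if m = 0 then 1 else 2) / l) * sin (pi * real m / l * x))"

definition dirichlet_mode_deriv :: "real \<Rightarrow> nat \<Rightarrow> real \<Rightarrow> real" where
  "dirichlet_mode_deriv l r x
     = pi * real (Suc r) / l * (sqrt (2 / l) * cos (pi * real (Suc r) / l * x))"

lemma mode_derivatives:
  shows "(neumann_mode l m has_real_derivative neumann_mode_deriv l m x) (at x)"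
    and "(neumann_mode_deriv l m has_real_derivative - ((pi * real m / l)\<^sup>2) * neumann_mode l m x) (at x)"
    and "(dirichlet_mode l m has_real_derivative dirichlet_mode_deriv l m x) (at x)"
    and "(dirichlet_mode_deriv l m has_real_derivative - ((pi * real (Suc m) / l)\<^sup>2) * dirichlet_mode l m x) (at x)"
proof -
  have s: "((\<lambda>x. sin (c * x)) has_real_derivative c * cos (c * x)) (at x)"
    and k: "((\<lambda>x. cos (c * x)) has_real_derivative - c * sin (c * x)) (at x)" for c :: real
    by (auto intro!: derivative_eq_intros)
  show "(neumann_mode l m has_real_derivative neumann_mode_deriv l m x) (at x)"
    using DERIV_cmult[OF k, of "sqrt ((if m = 0 then 1 else 2) / l)" "pi * real m / l"]
    by (simp add: neumann_mode_def[abs_def] neumann_mode_deriv_def mult_ac)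
  show "(neumann_mode_deriv l m has_real_derivative - ((pi * real m / l)\<^sup>2) * neumann_mode l m x) (at x)"
    using DERIV_cmult[OF s, of "- (pi * real m / l) * sqrt ((if m = 0 then 1 else 2) / l)" "pi * real m / l"]
    by (simp add: neumann_mode_def neumann_mode_deriv_def[abs_def] power2_eq_square mult_ac)
  show "(dirichlet_mode l m has_real_derivative dirichlet_mode_deriv l m x) (at x)"
    using DERIV_cmult[OF s, of "sqrt (2 / l)" "pi * real (Suc m) / l"]
    by (simp add: dirichlet_mode_def[abs_def] dirichlet_mode_deriv_def mult_ac del: of_nat_Suc)
  show "(dirichlet_mode_deriv l m has_real_derivative - ((pi * real (Suc m) / l)\<^sup>2) * dirichlet_mode l m x) (at x)"
    using DERIV_cmult[OF k, of "pi * real (Suc m) / l * sqrt (2 / l)" "pi * real (Suc m) / l"]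
    by (simp add: dirichlet_mode_def dirichlet_mode_deriv_def[abs_def] power2_eq_square mult_ac del: of_nat_Suc)
qed

lemma mode_boundary:
  assumes "0 < l"
  shows "neumann_mode_deriv l m 0 = 0" "neumann_mode_deriv l m l = 0"
    "dirichlet_mode l m 0 = 0" "dirichlet_mode l m l = 0"
  using assms sin_npi2[of m] sin_npi2[of "Suc m"]
  by (simp_all add: neumann_mode_deriv_def dirichlet_mode_def del: of_nat_Suc)

lemma mode_bounds:
  assumes "0 < l"
  shows "\<bar>neumann_mode l m x\<bar> \<le> sqrt (2 / l)" "\<bar>dirichlet_mode l r x\<bar> \<le> sqrt (2 / l)"
    "\<bar>neumann_mode_deriv l m x\<bar> \<le> sqrt (2 / l) * (pi * real m / l)"
    "\<bar>dirichlet_mode_deriv l r x\<bar> \<le> sqrt (2 / l) * (pi * real (Suc r) / l)"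
proof -
  have c: "sqrt ((if m = 0 then 1 else 2) / l) \<le> sqrt (2 / l)"
    using assms by (auto simp: divide_right_mono)
  have tc: "\<bar>A * cos t\<bar> \<le> B" and ts: "\<bar>A * sin t\<bar> \<le> B" if "0 \<le> A" "A \<le> B" for A B t :: real
    using that mult_mono[of A B "\<bar>cos t\<bar>" 1] mult_mono[of A B "\<bar>sin t\<bar>" 1] by (auto simp: abs_mult)
  show "\<bar>neumann_mode l m x\<bar> \<le> sqrt (2 / l)"
    unfolding neumann_mode_def by (rule tc[OF _ c]) (use assms in auto)
  show "\<bar>dirichlet_mode l r x\<bar> \<le> sqrt (2 / l)"
    unfolding dirichlet_mode_def by (rule ts) (use assms in auto)
  have "\<bar>sqrt ((if m = 0 then 1 else 2) / l) * sin (pi * real m / l * x)\<bar> \<le> sqrt (2 / l)"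
    by (rule ts[OF _ c]) (use assms in auto)
  then have "pi * real m / l * \<bar>sqrt ((if m = 0 then 1 else 2) / l) * sin (pi * real m / l * x)\<bar> \<le> pi * real m / l * sqrt (2 / l)"
    using assms by (intro mult_left_mono) auto
  then show "\<bar>neumann_mode_deriv l m x\<bar> \<le> sqrt (2 / l) * (pi * real m / l)"
    using assms by (simp add: neumann_mode_deriv_def abs_mult mult.commute)
  have "\<bar>sqrt (2 / l) * cos (pi * real (Suc r) / l * x)\<bar> \<le> sqrt (2 / l)"
    by (rule tc) (use assms in auto)
  then have "pi * real (Suc r) / l * \<bar>sqrt (2 / l) * cos (pi * real (Suc r) / l * x)\<bar> \<le> pi * real (Suc r) / l * sqrt (2 / l)"
    using assms by (intro mult_left_mono) auto
  then show "\<bar>dirichlet_mode_deriv l r x\<bar> \<le> sqrt (2 / l) * (pi * real (Suc r) / l)"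
    using assms by (simp add: dirichlet_mode_deriv_def abs_mult mult.commute del: of_nat_Suc)
qed

lemma smooth_cell_mode: "smooth (cell_mode l1 l2 a k)"
proof (cases k)
  case (fields m n r)
  have "smooth (\<lambda>p::real \<times> real \<times> real. (sqrt ((if m = 0 then 1 else 2) / l1) * cos (p \<bullet> (pi * real m / l1, 0, 0)))
    * (sqrt ((if n = 0 then 1 else 2) / l2) * cos (p \<bullet> (0, pi * real n / l2, 0)))
    * (sqrt (2 / a) * sin (p \<bullet> (0, 0, pi * real (Suc r) / a))))"
    by (intro smooth_mult smooth_const smooth_cos_ridge smooth_sin_ridge)
  also have "(\<lambda>p::real \<times> real \<times> real. (sqrt ((if m = 0 then 1 else 2) / l1) * cos (p \<bullet> (pi * real m / l1, 0, 0)))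
    * (sqrt ((if n = 0 then 1 else 2) / l2) * cos (p \<bullet> (0, pi * real n / l2, 0)))
    * (sqrt (2 / a) * sin (p \<bullet> (0, 0, pi * real (Suc r) / a)))) = cell_mode l1 l2 a k"
    by (auto simp: fun_eq_iff fields cell_mode_def neumann_mode_def dirichlet_mode_def inner_prod_def mult.commute
        simp del: of_nat_Suc)
  finally show ?thesis .
qed

abbreviation (input) partial :: "'a::euclidean_space \<Rightarrow> ('a \<Rightarrow> real) \<Rightarrow> 'a \<Rightarrow> real" where
  "partial b F \<equiv> (\<lambda>p. frechet_derivative F (at p) b)"

text \<open>
  Partial derivatives in the sense of \<open>frechet_derivative\<close> are read off from one-dimensional
  derivatives along coordinate lines, by uniqueness.
\<close>

lemma cell_mode_partials:
  shows "partial (1, 0, 0) (cell_mode l1 l2 a (m, n, r)) (x, y, z)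
      = neumann_mode_deriv l1 m x * neumann_mode l2 n y * dirichlet_mode a r z"
    and "partial (0, 1, 0) (cell_mode l1 l2 a (m, n, r)) (x, y, z)
      = neumann_mode l1 m x * neumann_mode_deriv l2 n y * dirichlet_mode a r z"
    and "partial (0, 0, 1) (cell_mode l1 l2 a (m, n, r)) (x, y, z)
      = neumann_mode l1 m x * neumann_mode l2 n y * dirichlet_mode_deriv a r z"
proof -
  note d = coordinate_derivatives[OF smooth_cell_mode[of l1 l2 a "(m, n, r)"]]
  have "((\<lambda>t. cell_mode l1 l2 a (m, n, r) (t, y, z)) has_real_derivative
      neumann_mode_deriv l1 m x * neumann_mode l2 n y * dirichlet_mode a r z) (at x)"
    unfolding cell_mode_def prod.case by (intro DERIV_cmult_right mode_derivatives)
  from DERIV_unique[OF d(1) this] show "partial (1, 0, 0) (cell_mode l1 l2 a (m, n, r)) (x, y, z)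
      = neumann_mode_deriv l1 m x * neumann_mode l2 n y * dirichlet_mode a r z" .
  have "((\<lambda>t. cell_mode l1 l2 a (m, n, r) (x, t, z)) has_real_derivative
      neumann_mode l1 m x * neumann_mode_deriv l2 n y * dirichlet_mode a r z) (at y)"
    unfolding cell_mode_def prod.case by (intro DERIV_cmult_right DERIV_cmult mode_derivatives)
  from DERIV_unique[OF d(2) this] show "partial (0, 1, 0) (cell_mode l1 l2 a (m, n, r)) (x, y, z)
      = neumann_mode l1 m x * neumann_mode_deriv l2 n y * dirichlet_mode a r z" .
  have "((\<lambda>t. cell_mode l1 l2 a (m, n, r) (x, y, t)) has_real_derivative
      neumann_mode l1 m x * neumann_mode l2 n y * dirichlet_mode_deriv a r z) (at z)"
    unfolding cell_mode_def prod.case by (intro DERIV_cmult mode_derivatives)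
  from DERIV_unique[OF d(3) this] show "partial (0, 0, 1) (cell_mode l1 l2 a (m, n, r)) (x, y, z)
      = neumann_mode l1 m x * neumann_mode l2 n y * dirichlet_mode_deriv a r z" .
qed

lemma cell_mode_second_partials:
  fixes p :: "real \<times> real \<times> real"
  shows "partial (1, 0, 0) (partial (1, 0, 0) (cell_mode l1 l2 a (m, n, r))) p
      = - ((pi * real m / l1)\<^sup>2) * cell_mode l1 l2 a (m, n, r) p"
    and "partial (0, 1, 0) (partial (0, 1, 0) (cell_mode l1 l2 a (m, n, r))) p
      = - ((pi * real n / l2)\<^sup>2) * cell_mode l1 l2 a (m, n, r) p"
    and "partial (0, 0, 1) (partial (0, 0, 1) (cell_mode l1 l2 a (m, n, r))) p
      = - ((pi * real (Suc r) / a)\<^sup>2) * cell_mode l1 l2 a (m, n, r) p"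
proof -
  obtain x y z where p: "p = (x, y, z)" by (cases p)
  have B: "(1, 0, 0) \<in> (Basis :: (real \<times> real \<times> real) set)" "(0, 1, 0) \<in> (Basis :: (real \<times> real \<times> real) set)"
    "(0, 0, 1) \<in> (Basis :: (real \<times> real \<times> real) set)" by (simp_all add: Basis_R3)
  note S = smooth_partial[OF smooth_cell_mode[of l1 l2 a "(m, n, r)"]]
  have "((\<lambda>t. partial (1, 0, 0) (cell_mode l1 l2 a (m, n, r)) (t, y, z)) has_real_derivative
      - ((pi * real m / l1)\<^sup>2) * neumann_mode l1 m x * neumann_mode l2 n y * dirichlet_mode a r z) (at x)"
    unfolding cell_mode_partials by (intro DERIV_cmult_right mode_derivatives)
  from DERIV_unique[OF coordinate_derivatives(1)[OF S[OF B(1)]] this]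
  show "partial (1, 0, 0) (partial (1, 0, 0) (cell_mode l1 l2 a (m, n, r))) p
      = - ((pi * real m / l1)\<^sup>2) * cell_mode l1 l2 a (m, n, r) p"
    by (simp add: p cell_mode_def)
  have "((\<lambda>t. partial (0, 1, 0) (cell_mode l1 l2 a (m, n, r)) (x, t, z)) has_real_derivative
      neumann_mode l1 m x * (- ((pi * real n / l2)\<^sup>2) * neumann_mode l2 n y) * dirichlet_mode a r z) (at y)"
    unfolding cell_mode_partials by (intro DERIV_cmult_right DERIV_cmult mode_derivatives)
  from DERIV_unique[OF coordinate_derivatives(2)[OF S[OF B(2)]] this]
  show "partial (0, 1, 0) (partial (0, 1, 0) (cell_mode l1 l2 a (m, n, r))) p
      = - ((pi * real n / l2)\<^sup>2) * cell_mode l1 l2 a (m, n, r) p"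
    by (simp add: p cell_mode_def)
  have "((\<lambda>t. partial (0, 0, 1) (cell_mode l1 l2 a (m, n, r)) (x, y, t)) has_real_derivative
      neumann_mode l1 m x * neumann_mode l2 n y * (- ((pi * real (Suc r) / a)\<^sup>2) * dirichlet_mode a r z)) (at z)"
    unfolding cell_mode_partials by (intro DERIV_cmult mode_derivatives)
  from DERIV_unique[OF coordinate_derivatives(3)[OF S[OF B(3)]] this]
  show "partial (0, 0, 1) (partial (0, 0, 1) (cell_mode l1 l2 a (m, n, r))) p
      = - ((pi * real (Suc r) / a)\<^sup>2) * cell_mode l1 l2 a (m, n, r) p"
    by (simp add: p cell_mode_def del: of_nat_Suc)
qed

lemma abs_triple_mult_le:
  fixes x y z :: real
  assumes "\<bar>x\<bar> \<le> X" "\<bar>y\<bar> \<le> Y" "\<bar>z\<bar> \<le> Z"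
  shows "\<bar>x * y * z\<bar> \<le> X * Y * Z"
  unfolding abs_mult using assms
  by (intro mult_mono) (auto intro: order_trans[OF abs_ge_zero])

locale mixed_cell =
  fixes l1 l2 a :: real
  assumes l1: "0 < l1" and l2: "0 < l2" and a: "0 < a"
begin

abbreviation "S \<equiv> cell l1 l2 a"
abbreviation "M \<equiv> lborel_on (cell l1 l2 a)"
abbreviation "R \<equiv> {0..l1} \<times> {0..l2}"
abbreviation "mode \<equiv> cell_mode l1 l2 a"
abbreviation "lam \<equiv> cell_eigenvalue l1 l2 a"

lemma finite_M: "finite_measure M"
  unfolding cell_eq_cbox by (rule finite_measure_lborel_on_cbox)

lemma R_cbox: "R = cbox (0, 0) (l1, l2)"
  by (simp add: cbox_Pair_eq)

lemma smooth_L2: "smooth F \<Longrightarrow> F \<in> L2_space M"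
  unfolding cell_eq_cbox by (intro continuous_L2_cbox smooth_continuous_on)

lemma smooth_L2_inner: "smooth F \<Longrightarrow> smooth G \<Longrightarrow> L2_inner M F G = integral S (\<lambda>p. F p * G p)"
  unfolding cell_eq_cbox by (intro L2_inner_cbox smooth_continuous_on)

lemma integral_partial_z:
  assumes P: "smooth P"
  shows "integral S (partial (0, 0, 1) P) = integral R (\<lambda>(x, y). P (x, y, a) - P (x, y, 0))"
proof -
  have D: "continuous_on T (partial (0, 0, 1) P)" for T
    by (intro smooth_continuous_on smooth_partial P) (simp add: Basis_R3)
  have ftc: "integral {0..a} (\<lambda>z. partial (0, 0, 1) P (x, y, z)) = P (x, y, a) - P (x, y, 0)" for x y
    using a coordinate_derivatives(3)[OF P]
    by (intro integral_unique fundamental_theorem_of_calculus)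
       (auto simp: has_real_derivative_iff_has_vector_derivative[symmetric] intro: DERIV_subset)
  have Pc: "continuous_on T (\<lambda>q. P (fst q, snd q, c))" for T c
    by (rule continuous_on_compose2[OF smooth_continuous_on[OF P, of UNIV]]) (auto intro!: continuous_intros)
  have Dx: "continuous_on T (\<lambda>q. partial (0, 0, 1) P (x, q))" for T x
    by (rule continuous_on_compose2[OF D[of UNIV]]) (auto intro!: continuous_intros)
  have "integral S (partial (0, 0, 1) P)
      = integral {0..l1} (\<lambda>x. integral (cbox (0, 0) (l2, a)) (\<lambda>q. partial (0, 0, 1) P (x, q)))"
    unfolding cell_eq_cbox by (subst integral_prod_continuous[OF D]) simp
  also have "\<dots> = integral {0..l1} (\<lambda>x. integral {0..l2} (\<lambda>y. P (x, y, a) - P (x, y, 0)))"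
    by (subst integral_prod_continuous[OF Dx]) (simp add: ftc)
  also have "\<dots> = integral R (\<lambda>(x, y). P (x, y, a) - P (x, y, 0))"
    unfolding R_cbox
    by (subst integral_prod_continuous) (auto simp: case_prod_unfold intro!: continuous_on_diff Pc)
  finally show ?thesis .
qed

text \<open>
  Fubini's theorem with the coordinate \<open>b\<close> innermost and the fundamental theorem of calculus.
\<close>

lemma integral_partial_zero:
  assumes P: "smooth P" and b: "b \<in> Basis"
    and zero: "\<And>p. p \<bullet> b = 0 \<or> p \<bullet> b = (l1, l2, a) \<bullet> b \<Longrightarrow> P p = 0"
  shows "integral S (partial b P) = 0"
proof -
  have D: "continuous_on T (partial b P)" for T
    by (intro smooth_continuous_on smooth_partial P b)
  have Dx: "continuous_on T (\<lambda>q. partial b P (x, q))" for T x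
    by (rule continuous_on_compose2[OF D[of UNIV]]) (auto intro!: continuous_intros)
  consider "b = (1, 0, 0)" | "b = (0, 1, 0)" | "b = (0, 0, 1)"
    using b by (auto simp: Basis_R3)
  then show ?thesis
  proof cases
    case 1
    have ftc: "integral {0..l1} (\<lambda>x. partial b P (x, q)) = 0" for q
    proof -
      obtain y z where q: "q = (y, z)" by (cases q)
      have "integral {0..l1} (\<lambda>x. partial b P (x, y, z)) = P (l1, y, z) - P (0, y, z)"
        using l1 coordinate_derivatives(1)[OF P]
        by (intro integral_unique fundamental_theorem_of_calculus)
           (auto simp: 1 has_real_derivative_iff_has_vector_derivative[symmetric] intro: DERIV_subset)
      then show ?thesis using zero by (simp add: 1 q inner_prod_def)
    qed
    have "integral S (partial b P)
        = integral (cbox 0 l1) (\<lambda>x. integral (cbox (0, 0) (l2, a)) (\<lambda>q. partial b P (x, q)))"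
      unfolding cell_eq_cbox by (rule integral_prod_continuous[OF D])
    also have "\<dots> = integral (cbox (0, 0) (l2, a)) (\<lambda>q. integral (cbox 0 l1) (\<lambda>x. partial b P (x, q)))"
      by (rule integral_swap_continuous[where f = "\<lambda>x q. partial b P (x, q)"]) (use D in \<open>simp add: case_prod_unfold\<close>)
    also have "\<dots> = 0" using ftc by simp
    finally show ?thesis .
  next
    case 2
    have ftc: "integral {0..l2} (\<lambda>y. partial b P (x, y, z)) = 0" for x z
    proof -
      have "integral {0..l2} (\<lambda>y. partial b P (x, y, z)) = P (x, l2, z) - P (x, 0, z)"
        using l2 coordinate_derivatives(2)[OF P]
        by (intro integral_unique fundamental_theorem_of_calculus)
           (auto simp: 2 has_real_derivative_iff_has_vector_derivative[symmetric] intro: DERIV_subset)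
      then show ?thesis using zero by (simp add: 2 inner_prod_def)
    qed
    have "integral S (partial b P)
        = integral (cbox 0 l1) (\<lambda>x. integral (cbox (0, 0) (l2, a)) (\<lambda>q. partial b P (x, q)))"
      unfolding cell_eq_cbox by (rule integral_prod_continuous[OF D])
    also have "\<dots> = integral (cbox 0 l1) (\<lambda>x. 0)"
    proof (rule Henstock_Kurzweil_Integration.integral_cong)
      fix x
      have "integral (cbox (0, 0) (l2, a)) (\<lambda>q. partial b P (x, q))
          = integral (cbox 0 l2) (\<lambda>y. integral (cbox 0 a) (\<lambda>z. partial b P (x, y, z)))"
        by (rule integral_prod_continuous[OF Dx])
      also have "\<dots> = integral (cbox 0 a) (\<lambda>z. integral (cbox 0 l2) (\<lambda>y. partial b P (x, y, z)))"
        by (rule integral_swap_continuous[where f = "\<lambda>y z. partial b P (x, y, z)"]) (use Dx in \<open>simp add: case_prod_unfold\<close>)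
      also have "\<dots> = 0" using ftc by simp
      finally show "integral (cbox (0, 0) (l2, a)) (\<lambda>q. partial b P (x, q)) = 0" .
    qed
    finally show ?thesis by simp
  next
    case 3
    then have "P (x, y, a) - P (x, y, 0) = 0" for x y
      using zero[of "(x, y, a)"] zero[of "(x, y, 0)"] by (simp add: inner_prod_def)
    then show ?thesis
      using integral_partial_z[OF P] by (simp add: 3 case_prod_unfold)
  qed
qed

lemma integral_partial_mult:
  assumes F: "smooth F" and G: "smooth G" and b: "b \<in> Basis"
  shows "integral S (partial b (\<lambda>p. F p * G p)) = L2_inner M F (partial b G) + L2_inner M (partial b F) G"
proof -
  have S: "smooth (partial b F)" "smooth (partial b G)" using F G b by (auto intro: smooth_partial)
  have "(\<lambda>p. F p * partial b G p) integrable_on S" "(\<lambda>p. partial b F p * G p) integrable_on S"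
    unfolding cell_eq_cbox by (intro integrable_continuous smooth_continuous_on smooth_mult F G S)+
  then show ?thesis
    using F G S by (simp add: smooth_L2_inner frechet_derivative_mult_smooth Henstock_Kurzweil_Integration.integral_add)
qed

lemma integration_by_parts:
  assumes F: "smooth F" and G: "smooth G" and b: "b \<in> Basis"
    and zero: "\<And>p. p \<bullet> b = 0 \<or> p \<bullet> b = (l1, l2, a) \<bullet> b \<Longrightarrow> F p * G p = 0"
  shows "L2_inner M F (partial b G) = - L2_inner M (partial b F) G"
  using integral_partial_mult[OF F G b] integral_partial_zero[OF smooth_mult[OF F G] b zero] by simp

section \<open>Weak derivatives on the cell\<close>

lemma mode_L2: "mode k \<in> L2_space M"
  by (rule smooth_L2[OF smooth_cell_mode])

lemma AE_zero_if_orthogonal_to_modes: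
  assumes g: "g \<in> L2_space M" and orth: "\<And>k. L2_inner M g (mode k) = 0"
  shows "AE p in M. g p = 0"
proof -
  have "((\<lambda>e. (L2_inner M g e)\<^sup>2) has_sum L2_inner M g g) (range mode)"
    by (rule L2_Parseval[OF cell_modes_basis[OF l1 l2 a] g])
  moreover have "((\<lambda>e. (L2_inner M g e)\<^sup>2) has_sum 0) (range mode)"
    by (rule has_sum_0) (use orth in auto)
  ultimately have "L2_inner M g g = 0" by (rule has_sum_unique)
  then show ?thesis using L2_norm_eq_0_iff_AE[OF g] by (simp add: L2_norm_def)
qed

text \<open>
  Multiplying a mode by a cutoff gives a test function, so the product of \<open>g\<close> and the cutoff is
  orthogonal to all modes and vanishes by their completeness.  The cutoffs for \<open>\<delta> = 1 / (n + 1)\<close>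
  together are nonzero at every interior point.
\<close>

lemma AE_zero_if_orthogonal_to_test_functions:
  assumes g: "g \<in> L2_space M" and orth: "\<And>\<psi>. test_function S \<psi> \<Longrightarrow> L2_inner M g \<psi> = 0"
  shows "AE p in M. g p = 0"
proof -
  let ?\<chi> = "\<lambda>n::nat. cutoff (0, 0, 0) (l1, l2, a) (inverse (real (Suc n)))"
  have meas: "?\<chi> n \<in> borel_measurable M" for n
    by (intro borel_measurable_lborel_on smooth_measurable smooth_cutoff)
  have "AE p in M. ?\<chi> n p * g p = 0" for n
  proof (rule AE_zero_if_orthogonal_to_modes)
    show "(\<lambda>p. ?\<chi> n p * g p) \<in> L2_space M"
      by (rule L2_mult_bounded[OF g meas, of _ 1]) (simp add: abs_of_nonneg cutoff_bounds)
    fix k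
    have "test_function S (\<lambda>p. ?\<chi> n p * mode k p)"
      unfolding cell_eq_cbox by (intro test_function_cutoff_mult smooth_cell_mode) simp
    from orth[OF this] show "L2_inner M (\<lambda>p. ?\<chi> n p * g p) (mode k) = 0"
      by (simp add: L2_inner_def mult_ac)
  qed
  then have "AE p in M. \<forall>n. ?\<chi> n p * g p = 0" by (subst AE_all_countable) blast
  then show ?thesis
    using AE_in_box[of "(0, 0, 0)" "(l1, l2, a)", folded cell_eq_cbox]
  proof eventually_elim
    case (elim p)
    have "\<forall>\<^sub>F n in sequentially. \<forall>b\<in>Basis. (0, 0, 0) \<bullet> b + inverse (real (Suc n)) < p \<bullet> b
        \<and> p \<bullet> b < (l1, l2, a) \<bullet> b - inverse (real (Suc n))"
    proof (rule eventually_ball_finite[OF finite_Basis], intro ballI)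
      fix b :: "real \<times> real \<times> real" assume b: "b \<in> Basis"
      let ?e = "min (p \<bullet> b - (0, 0, 0) \<bullet> b) ((l1, l2, a) \<bullet> b - p \<bullet> b)"
      have "0 < ?e" using elim(2) b by (auto simp: mem_box)
      from order_tendstoD(2)[OF LIMSEQ_inverse_real_of_nat this]
      show "\<forall>\<^sub>F n in sequentially. (0, 0, 0) \<bullet> b + inverse (real (Suc n)) < p \<bullet> b
          \<and> p \<bullet> b < (l1, l2, a) \<bullet> b - inverse (real (Suc n))"
        by eventually_elim linarith
    qed
    then obtain n where "?\<chi> n p \<noteq> 0"
      unfolding cutoff_nonzero_iff by (auto simp: eventually_sequentially)
    then show ?case using elim(1) by (metis mult_eq_0_iff)
  qed
qed

lemma test_function_smooth: "test_function S \<psi> \<Longrightarrow> smooth \<psi>"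
  by (simp add: test_function_def)

lemma test_function_boundary:
  assumes \<psi>: "test_function S \<psi>" and b: "b \<in> Basis" and p: "p \<bullet> b = 0 \<or> p \<bullet> b = (l1, l2, a) \<bullet> b"
  shows "\<psi> p = 0"
proof -
  have "p \<notin> box (0, 0, 0) (l1, l2, a)"
    using b p by (auto simp: mem_box Basis_R3 inner_prod_def)
  then show ?thesis
    using \<psi> unfolding test_function_def cell_eq_cbox interior_cbox by blast
qed

lemma weak_partial_unique:
  assumes "has_weak_partial S b u g" "has_weak_partial S b u h"
  shows "AE p in M. g p = h p"
proof -
  have gh: "g \<in> L2_space M" "h \<in> L2_space M" using assms by (auto simp: has_weak_partial_def)
  have "AE p in M. g p - h p = 0"
  proof (rule AE_zero_if_orthogonal_to_test_functions[OF L2_diff[OF gh]])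
    fix \<psi> assume \<psi>: "test_function S \<psi>"
    then have "L2_inner M g \<psi> = L2_inner M h \<psi>"
      using assms by (auto simp: has_weak_partial_def)
    then show "L2_inner M (\<lambda>p. g p - h p) \<psi> = 0"
      using gh smooth_L2[OF test_function_smooth[OF \<psi>]] by (simp add: L2_inner_diff_left)
  qed
  then show ?thesis by simp
qed

lemma has_weak_partial_weak_partial:
  assumes "has_weak_partial S b u g"
  shows "has_weak_partial S b u (weak_partial S b u)"
  unfolding weak_partial_def using assms by (rule someI[of "has_weak_partial S b u"])

lemma weak_partial_AE:
  assumes "has_weak_partial S b u g"
  shows "AE p in M. weak_partial S b u p = g p"
  by (rule weak_partial_unique[OF has_weak_partial_weak_partial[OF assms] assms])

lemma weak_partial_L2:
  assumes "u \<in> H1 S" "b \<in> Basis"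
  shows "weak_partial S b u \<in> L2_space M"
proof -
  obtain g where "has_weak_partial S b u g" using assms by (auto simp: H1_def)
  from has_weak_partial_weak_partial[OF this] show ?thesis by (simp add: has_weak_partial_def)
qed

section \<open>The form domain\<close>

text \<open>
  Integration by parts against a test function passes to the limit, which identifies the weak
  derivatives; the sequence \<open>U\<close> itself witnesses the zero traces on both plates.
\<close>

lemma form_domain_closure:
  assumes U: "\<And>n. smooth (U n)" and plates: "\<And>n x y. U n (x, y, 0) = 0 \<and> U n (x, y, a) = 0"
    and u: "u \<in> L2_space M" and g: "\<And>b. b \<in> Basis \<Longrightarrow> g b \<in> L2_space M"
    and Uu: "(\<lambda>n. L2_norm M (\<lambda>p. U n p - u p)) \<longlonglongrightarrow> 0"
    and Ug: "\<And>b. b \<in> Basis \<Longrightarrow> (\<lambda>n. L2_norm M (\<lambda>p. partial b (U n) p - g b p)) \<longlonglongrightarrow> 0"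
  shows "u \<in> cell_form_domain l1 l2 a" and "\<And>b. b \<in> Basis \<Longrightarrow> has_weak_partial S b u (g b)"
proof -
  show weak: "has_weak_partial S b u (g b)" if b: "b \<in> Basis" for b
    unfolding has_weak_partial_def
  proof (intro conjI allI impI g b)
    fix \<psi> assume \<psi>: "test_function S \<psi>"
    have s: "smooth \<psi>" by (rule test_function_smooth[OF \<psi>])
    have sb: "smooth (partial b \<psi>)" by (rule smooth_partial[OF s b])
    have 1: "(\<lambda>n. L2_inner M (U n) (partial b \<psi>)) \<longlonglongrightarrow> L2_inner M u (partial b \<psi>)"
      by (rule L2_inner_tendsto[OF _ u smooth_L2[OF sb] Uu]) (simp add: smooth_L2 U)
    have "(\<lambda>n. L2_inner M (partial b (U n)) \<psi>) \<longlonglongrightarrow> L2_inner M (g b) \<psi>"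
      by (rule L2_inner_tendsto[OF _ g[OF b] smooth_L2[OF s] Ug[OF b]])
         (simp add: smooth_L2 smooth_partial U b)
    moreover have "L2_inner M (U n) (partial b \<psi>) = - L2_inner M (partial b (U n)) \<psi>" for n
      by (rule integration_by_parts[OF U s b]) (use test_function_boundary[OF \<psi> b] in auto)
    ultimately have 2: "(\<lambda>n. L2_inner M (U n) (partial b \<psi>)) \<longlonglongrightarrow> - L2_inner M (g b) \<psi>"
      by (simp add: tendsto_minus)
    show "L2_inner M u (partial b \<psi>) = - L2_inner M (g b) \<psi>"
      by (rule LIMSEQ_unique[OF 1 2])
  qed
  have H: "u \<in> H1 S" using weak u by (auto simp: H1_def)
  have "L2_norm M (\<lambda>p. partial b (U n) p - weak_partial S b u p) = L2_norm M (\<lambda>p. partial b (U n) p - g b p)"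
    if b: "b \<in> Basis" for b n
  proof (rule L2_norm_cong_AE)
    have "partial b (U n) \<in> borel_measurable M"
      using L2_spaceD(1)[OF smooth_L2[OF smooth_partial[OF U b]]] .
    then show "(\<lambda>p. partial b (U n) p - weak_partial S b u p) \<in> borel_measurable M"
      "(\<lambda>p. partial b (U n) p - g b p) \<in> borel_measurable M"
      using L2_spaceD(1)[OF weak_partial_L2[OF H b]] L2_spaceD(1)[OF g[OF b]] by auto
    show "AE p in M. partial b (U n) p - weak_partial S b u p = partial b (U n) p - g b p"
      using weak_partial_AE[OF weak[OF b]] by eventually_elim simp
  qed
  then have lim: "(\<lambda>n. L2_norm M (\<lambda>p. partial b (U n) p - weak_partial S b u p)) \<longlonglongrightarrow> 0" if "b \<in> Basis" for b
    using Ug that by simp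
  have zero: "L2_norm (lborel_on R) (\<lambda>(x, y). U n (x, y, c) - 0) = 0" if "c = 0 \<or> c = a" for n c
    using that plates[of n] by (auto simp: L2_norm_def L2_inner_def case_prod_unfold)
  have "has_plate_trace l1 l2 a c u (\<lambda>_. 0)" if "c = 0 \<or> c = a" for c
    unfolding has_plate_trace_def
    using H U Uu lim zero[OF that] by (intro conjI exI[of _ U] ballI allI) (auto simp: L2_zero case_prod_unfold)
  then show "u \<in> cell_form_domain l1 l2 a"
    using H by (simp add: cell_form_domain_def)
qed

lemma mode_plates: "mode k (x, y, 0) = 0 \<and> mode k (x, y, a) = 0"
  using mode_boundary[OF a] by (cases k) (simp add: cell_mode_def)

lemma mode_form_domain: "mode k \<in> cell_form_domain l1 l2 a"
  and mode_weak_partial: "b \<in> Basis \<Longrightarrow> has_weak_partial S b (mode k) (partial b (mode k))"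
proof -
  note c = form_domain_closure[of "\<lambda>_. mode k" "mode k" "\<lambda>b. partial b (mode k)",
      OF smooth_cell_mode mode_plates mode_L2]
  have 0: "L2_norm M (\<lambda>p. 0) = 0" by (simp add: L2_norm_def L2_inner_def)
  show "mode k \<in> cell_form_domain l1 l2 a"
    by (rule c(1)) (auto simp: 0 intro!: smooth_L2 smooth_partial smooth_cell_mode)
  show "b \<in> Basis \<Longrightarrow> has_weak_partial S b (mode k) (partial b (mode k))"
    by (rule c(2)) (auto simp: 0 intro!: smooth_L2 smooth_partial smooth_cell_mode)
qed

lemma domain_H1: "v \<in> cell_form_domain l1 l2 a \<Longrightarrow> v \<in> H1 S"
  by (simp add: cell_form_domain_def)

lemma domain_L2: "v \<in> cell_form_domain l1 l2 a \<Longrightarrow> v \<in> L2_space M"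
  by (auto dest: domain_H1 simp: H1_def)

lemma dirichlet_form_eq:
  assumes "u \<in> H1 S" "v \<in> H1 S"
  shows "dirichlet_form S u v = (\<Sum>b\<in>Basis. L2_inner M (weak_partial S b u) (weak_partial S b v))"
  unfolding dirichlet_form_def L2_inner_def
  by (intro Bochner_Integration.integral_sum L2_integrable_mult weak_partial_L2 assms)

text \<open>
  The form domain does not restrict \<open>v\<close> on the lateral faces, so the boundary terms have to vanish
  through \<open>h\<close>.  For the derivative of a mode this is the Neumann condition.
\<close>

lemma lateral_green:
  assumes v: "v \<in> cell_form_domain l1 l2 a" and h: "smooth h" and b: "b \<in> Basis"
    and zero: "\<And>p. p \<bullet> b = 0 \<or> p \<bullet> b = (l1, l2, a) \<bullet> b \<Longrightarrow> h p = 0"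
  shows "L2_inner M h (weak_partial S b v) = - L2_inner M (partial b h) v"
proof -
  obtain U where U: "\<And>n. smooth (U n)" and Uv: "(\<lambda>n. L2_norm M (\<lambda>p. U n p - v p)) \<longlonglongrightarrow> 0"
    and Ub: "(\<lambda>n. L2_norm M (\<lambda>p. partial b (U n) p - weak_partial S b v p)) \<longlonglongrightarrow> 0"
    using v b unfolding cell_form_domain_def has_plate_trace_def by blast
  have hb: "smooth (partial b h)" by (rule smooth_partial[OF h b])
  have 1: "(\<lambda>n. L2_inner M (partial b (U n)) h) \<longlonglongrightarrow> L2_inner M (weak_partial S b v) h"
    by (rule L2_inner_tendsto[OF _ weak_partial_L2[OF domain_H1[OF v] b] smooth_L2[OF h] Ub])
       (simp add: smooth_L2 smooth_partial U b)
  have "(\<lambda>n. L2_inner M (U n) (partial b h)) \<longlonglongrightarrow> L2_inner M v (partial b h)"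
    by (rule L2_inner_tendsto[OF _ domain_L2[OF v] smooth_L2[OF hb] Uv]) (simp add: smooth_L2 U)
  moreover have "L2_inner M (partial b (U n)) h = - L2_inner M (U n) (partial b h)" for n
    using integration_by_parts[OF h U b, of n] zero by (simp add: L2_inner_commute)
  ultimately have 2: "(\<lambda>n. L2_inner M (partial b (U n)) h) \<longlonglongrightarrow> - L2_inner M v (partial b h)"
    by (simp add: tendsto_minus)
  show ?thesis
    using LIMSEQ_unique[OF 1 2] by (simp add: L2_inner_commute)
qed

text \<open>
  The sequence that witnesses the trace of \<open>v\<close> on one plate carries no information on the other
  plate, so \<open>G\<close> has to vanish on the other plate, at height \<open>a - c\<close>.
\<close>

lemma one_plate_green:
  assumes v: "v \<in> cell_form_domain l1 l2 a" and G: "smooth G" and c: "c = 0 \<or> c = a"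
    and zero: "\<And>x y. G (x, y, a - c) = 0"
  shows "L2_inner M G (weak_partial S (0, 0, 1) v) = - L2_inner M (partial (0, 0, 1) G) v"
proof -
  let ?b = "(0, 0, 1) :: real \<times> real \<times> real"
  have b: "?b \<in> Basis" by (simp add: Basis_R3)
  have "has_plate_trace l1 l2 a c v (\<lambda>_. 0)"
    using v c by (auto simp: cell_form_domain_def)
  then obtain U where U: "\<And>n. smooth (U n)" and Uv: "(\<lambda>n. L2_norm M (\<lambda>p. U n p - v p)) \<longlonglongrightarrow> 0"
    and Ub: "(\<lambda>n. L2_norm M (\<lambda>p. partial ?b (U n) p - weak_partial S ?b v p)) \<longlonglongrightarrow> 0"
    and Uc: "(\<lambda>n. L2_norm (lborel_on R) (\<lambda>(x, y). U n (x, y, c) - 0)) \<longlonglongrightarrow> 0"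
    using b unfolding has_plate_trace_def by blast
  have Gb: "smooth (partial ?b G)" by (rule smooth_partial[OF G b])
  have face: "continuous_on T (\<lambda>q. F (fst q, snd q, c))" if "smooth F" for T and F :: "real \<times> real \<times> real \<Rightarrow> real"
    by (rule continuous_on_compose2[OF smooth_continuous_on[OF that, of UNIV]]) (auto intro!: continuous_intros)
  have faceL2: "(\<lambda>q. F (fst q, snd q, c)) \<in> L2_space (lborel_on R)" if "smooth F" for F :: "real \<times> real \<times> real \<Rightarrow> real"
    unfolding R_cbox by (intro continuous_L2_cbox face that)
  define B where "B n = L2_inner (lborel_on R) (\<lambda>q. U n (fst q, snd q, c)) (\<lambda>q. G (fst q, snd q, c))" for n
  have "B \<longlonglongrightarrow> L2_inner (lborel_on R) (\<lambda>q. 0) (\<lambda>q. G (fst q, snd q, c))"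
    unfolding B_def
    by (rule L2_inner_tendsto[OF _ L2_zero faceL2[OF G]])
       (use Uc faceL2 U in \<open>auto simp: case_prod_unfold\<close>)
  then have B: "B \<longlonglongrightarrow> 0" by (simp add: L2_inner_def)
  have "B n = integral R (\<lambda>q. U n (fst q, snd q, c) * G (fst q, snd q, c))" for n
    unfolding B_def R_cbox by (intro L2_inner_cbox face U G)
  moreover have "integral S (partial ?b (\<lambda>p. G p * U n p)) = (if c = 0 then -1 else 1) *
      integral R (\<lambda>q. U n (fst q, snd q, c) * G (fst q, snd q, c))" for n
  proof -
    have "(\<lambda>(x, y). G (x, y, a) * U n (x, y, a) - G (x, y, 0) * U n (x, y, 0))
       = (\<lambda>q. (if c = 0 then -1 else 1) * (U n (fst q, snd q, c) * G (fst q, snd q, c)))"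
      using c zero a by (auto simp: fun_eq_iff)
    then show ?thesis
      unfolding integral_partial_z[OF smooth_mult[OF G U]] by simp
  qed
  ultimately have eq: "L2_inner M (partial ?b (U n)) G
      = (if c = 0 then -1 else 1) * B n - L2_inner M (U n) (partial ?b G)" for n
    using integral_partial_mult[OF G U b, of n] by (simp add: L2_inner_commute)
  have 1: "(\<lambda>n. L2_inner M (partial ?b (U n)) G) \<longlonglongrightarrow> L2_inner M (weak_partial S ?b v) G"
    by (rule L2_inner_tendsto[OF _ weak_partial_L2[OF domain_H1[OF v] b] smooth_L2[OF G] Ub])
       (simp add: smooth_L2 smooth_partial U b)
  have "(\<lambda>n. L2_inner M (U n) (partial ?b G)) \<longlonglongrightarrow> L2_inner M v (partial ?b G)"
    by (rule L2_inner_tendsto[OF _ domain_L2[OF v] smooth_L2[OF Gb] Uv]) (simp add: smooth_L2 U)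
  then have 2: "(\<lambda>n. L2_inner M (partial ?b (U n)) G) \<longlonglongrightarrow>
      (if c = 0 then -1 else 1) * 0 - L2_inner M v (partial ?b G)"
    unfolding eq by (intro tendsto_intros B)
  show ?thesis
    using LIMSEQ_unique[OF 1 2] by (simp add: L2_inner_commute)
qed

text \<open>
  The splitting \<open>h = h * z / a + h * (1 - z / a)\<close> gives two functions that vanish on one plate
  each.
\<close>

lemma plate_green:
  assumes v: "v \<in> cell_form_domain l1 l2 a" and h: "smooth h"
  shows "L2_inner M h (weak_partial S (0, 0, 1) v) = - L2_inner M (partial (0, 0, 1) h) v"
proof -
  let ?b = "(0, 0, 1) :: real \<times> real \<times> real"
  let ?w = "weak_partial S ?b v"
  have b: "?b \<in> Basis" by (simp add: Basis_R3)
  define Q where "Q p = p \<bullet> (0, 0, 1 / a)" for p :: "real \<times> real \<times> real"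
  have Q: "smooth Q" unfolding Q_def[abs_def] by (rule smooth_inner_ridge)
  have Q': "smooth (\<lambda>p. 1 + - 1 * Q p)" by (intro smooth_add smooth_mult smooth_const Q)
  have hQ: "smooth (\<lambda>p. h p * Q p)" and hQ': "smooth (\<lambda>p. h p * (1 + - 1 * Q p))"
    by (intro smooth_mult h Q Q')+
  have w: "?w \<in> L2_space M" by (rule weak_partial_L2[OF domain_H1[OF v] b])
  have 1: "L2_inner M (\<lambda>p. h p * Q p) ?w = - L2_inner M (partial ?b (\<lambda>p. h p * Q p)) v"
    using a by (intro one_plate_green[OF v hQ, of a]) (auto simp: Q_def inner_prod_def)
  have 2: "L2_inner M (\<lambda>p. h p * (1 + - 1 * Q p)) ?w = - L2_inner M (partial ?b (\<lambda>p. h p * (1 + - 1 * Q p))) v"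
    using a by (intro one_plate_green[OF v hQ', of 0]) (auto simp: Q_def inner_prod_def)
  have sum: "(\<lambda>p. h p * Q p + h p * (1 + - 1 * Q p)) = h" by (auto simp: algebra_simps)
  have "L2_inner M h ?w = L2_inner M (\<lambda>p. h p * Q p) ?w + L2_inner M (\<lambda>p. h p * (1 + - 1 * Q p)) ?w"
    using L2_inner_add_left[OF smooth_L2[OF hQ] smooth_L2[OF hQ'] w] unfolding sum .
  also have "\<dots> = - L2_inner M (\<lambda>p. partial ?b (\<lambda>p. h p * Q p) p + partial ?b (\<lambda>p. h p * (1 + - 1 * Q p)) p) v"
    using L2_inner_add_left[OF smooth_L2[OF smooth_partial[OF hQ b]] smooth_L2[OF smooth_partial[OF hQ' b]] domain_L2[OF v]]
    unfolding 1 2 by simp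
  also have "(\<lambda>p. partial ?b (\<lambda>p. h p * Q p) p + partial ?b (\<lambda>p. h p * (1 + - 1 * Q p)) p) = partial ?b h"
    using frechet_derivative_add_smooth[OF hQ hQ'] unfolding sum by simp
  finally show ?thesis .
qed

text \<open>
  Each coordinate contributes its squared frequency.  The Neumann condition on the mode removes the
  boundary terms on the lateral faces, the Dirichlet condition on \<open>v\<close> those on the plates.
\<close>

lemma mode_green:
  assumes v: "v \<in> cell_form_domain l1 l2 a"
  shows "(\<Sum>b\<in>Basis. L2_inner M (partial b (mode k)) (weak_partial S b v)) = lam k * L2_inner M (mode k) v"
proof -
  obtain m n r where k: "k = (m, n, r)" by (cases k)
  have B: "(1, 0, 0) \<in> (Basis :: (real \<times> real \<times> real) set)" "(0, 1, 0) \<in> (Basis :: (real \<times> real \<times> real) set)"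
    "(0, 0, 1) \<in> (Basis :: (real \<times> real \<times> real) set)" by (simp_all add: Basis_R3)
  note S = smooth_partial[OF smooth_cell_mode[of l1 l2 a k]]
  have eig: "L2_inner M (partial b (mode k)) (weak_partial S b v) = c * L2_inner M (mode k) v"
    if "L2_inner M (partial b (mode k)) (weak_partial S b v) = - L2_inner M (partial b (partial b (mode k))) v"
      and "\<And>p. partial b (partial b (mode k)) p = - c * mode k p" for b c
    using that(1) unfolding that(2) L2_inner_cmult_left by simp
  have x: "L2_inner M (partial (1, 0, 0) (mode k)) (weak_partial S (1, 0, 0) v) = (pi * real m / l1)\<^sup>2 * L2_inner M (mode k) v"
  proof (rule eig[OF lateral_green[OF v S[OF B(1)] B(1)]])
    show "partial (1, 0, 0) (mode k) p = 0" if "p \<bullet> (1, 0, 0) = 0 \<or> p \<bullet> (1, 0, 0) = (l1, l2, a) \<bullet> (1, 0, 0)" for p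
      using that by (cases p) (auto simp: k cell_mode_partials inner_prod_def mode_boundary[OF l1])
  qed (simp only: k cell_mode_second_partials)
  have y: "L2_inner M (partial (0, 1, 0) (mode k)) (weak_partial S (0, 1, 0) v) = (pi * real n / l2)\<^sup>2 * L2_inner M (mode k) v"
  proof (rule eig[OF lateral_green[OF v S[OF B(2)] B(2)]])
    show "partial (0, 1, 0) (mode k) p = 0" if "p \<bullet> (0, 1, 0) = 0 \<or> p \<bullet> (0, 1, 0) = (l1, l2, a) \<bullet> (0, 1, 0)" for p
      using that by (cases p) (auto simp: k cell_mode_partials inner_prod_def mode_boundary[OF l2])
  qed (simp only: k cell_mode_second_partials)
  have z: "L2_inner M (partial (0, 0, 1) (mode k)) (weak_partial S (0, 0, 1) v) = (pi * real (Suc r) / a)\<^sup>2 * L2_inner M (mode k) v"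
    by (rule eig[OF plate_green[OF v S[OF B(3)]]]) (simp only: k cell_mode_second_partials)
  show ?thesis
    unfolding Basis_R3 using x y z by (simp add: k cell_eigenvalue_def distrib_right del: of_nat_Suc)
qed

end

context mixed_cell
begin

section \<open>The operator of the cell has the product modes as an eigenbasis\<close>

definition mode_bound :: real where
  "mode_bound = sqrt (2 / l1) * sqrt (2 / l2) * sqrt (2 / a)"

lemma lam_nonneg: "0 \<le> lam k"
  by (cases k) (simp add: cell_eigenvalue_def)

lemma mode_le_bound: "\<bar>mode k p\<bar> \<le> mode_bound"
proof -
  obtain m n r where k: "k = (m, n, r)" by (cases k)
  obtain x y z where p: "p = (x, y, z)" by (cases p)
  show ?thesis
    using abs_triple_mult_le[OF mode_bounds(1)[OF l1] mode_bounds(1)[OF l2] mode_bounds(2)[OF a]]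
    by (simp add: k p cell_mode_def mode_bound_def)
qed

text \<open>
  A frequency \<open>\<alpha>\<close> is bounded by \<open>1 + \<alpha>\<^sup>2\<close>, so the weight of the series in \<open>L2_eigenbasis\<close> controls
  the first derivatives as well as the eigenvalues.
\<close>

lemma mode_partial_bound:
  assumes b: "b \<in> Basis"
  shows "\<bar>partial b (mode k) p\<bar> \<le> mode_bound * (1 + lam k)"
proof -
  obtain m n r where k: "k = (m, n, r)" by (cases k)
  obtain x y z where p: "p = (x, y, z)" by (cases p)
  have le: "\<alpha> \<le> 1 + \<alpha>\<^sup>2" for \<alpha> :: real
  proof -
    have "2 * \<alpha> \<le> \<alpha>\<^sup>2 + 1" using sum_squares_bound[of \<alpha> 1] by simp
    then show ?thesis using zero_le_power2[of \<alpha>] by linarith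
  qed
  have K: "0 \<le> mode_bound" using l1 l2 a by (simp add: mode_bound_def)
  have "pi * real m / l1 \<le> 1 + lam k" "pi * real n / l2 \<le> 1 + lam k" "pi * real (Suc r) / a \<le> 1 + lam k"
    using le[of "pi * real m / l1"] le[of "pi * real n / l2"] le[of "pi * real (Suc r) / a"]
      zero_le_power2[of "pi * real m / l1"] zero_le_power2[of "pi * real n / l2"] zero_le_power2[of "pi * real (Suc r) / a"]
    unfolding k cell_eigenvalue_def prod.case by linarith+
  then have w: "mode_bound * (pi * real m / l1) \<le> mode_bound * (1 + lam k)"
    "mode_bound * (pi * real n / l2) \<le> mode_bound * (1 + lam k)"
    "mode_bound * (pi * real (Suc r) / a) \<le> mode_bound * (1 + lam k)"
    using mult_left_mono[OF _ K] by blast+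
  consider "b = (1, 0, 0)" | "b = (0, 1, 0)" | "b = (0, 0, 1)"
    using b by (auto simp: Basis_R3)
  then show ?thesis
  proof cases
    case 1
    have "\<bar>partial b (mode k) p\<bar> \<le> sqrt (2 / l1) * (pi * real m / l1) * sqrt (2 / l2) * sqrt (2 / a)"
      unfolding 1 k p cell_mode_partials
      by (intro abs_triple_mult_le mode_bounds l1 l2 a)
    with w(1) show ?thesis by (simp add: mode_bound_def mult_ac)
  next
    case 2
    have "\<bar>partial b (mode k) p\<bar> \<le> sqrt (2 / l1) * (sqrt (2 / l2) * (pi * real n / l2)) * sqrt (2 / a)"
      unfolding 2 k p cell_mode_partials
      by (intro abs_triple_mult_le mode_bounds l1 l2 a)
    with w(2) show ?thesis by (simp add: mode_bound_def mult_ac)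
  next
    case 3
    have "\<bar>partial b (mode k) p\<bar> \<le> sqrt (2 / l1) * sqrt (2 / l2) * (sqrt (2 / a) * (pi * real (Suc r) / a))"
      unfolding 3 k p cell_mode_partials
      by (intro abs_triple_mult_le mode_bounds l1 l2 a)
    with w(3) show ?thesis by (simp add: mode_bound_def mult_ac del: of_nat_Suc)
  qed
qed

lemma heat_has_sum:
  assumes t: "0 < t"
  shows "((\<lambda>k. exp (- t * lam k)) has_sum neumann_trace l1 t * neumann_trace l2 t * dirichlet_trace a t) UNIV"
proof -
  have N: "((\<lambda>m::nat. exp (- t * (pi * real m / l)\<^sup>2)) has_sum neumann_trace l t) UNIV" if "0 < l" for l
    unfolding neumann_trace_def by (rule has_sum_infsum[OF neumann_summable[OF that t]])
  have D: "((\<lambda>m::nat. exp (- t * (pi * real (Suc m) / a)\<^sup>2)) has_sum dirichlet_trace a t) UNIV"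
    unfolding dirichlet_trace_def by (rule has_sum_infsum[OF dirichlet_summable[OF a t]])
  have "((\<lambda>(m, n, r). exp (- t * (pi * real m / l1)\<^sup>2) * (exp (- t * (pi * real n / l2)\<^sup>2) * exp (- t * (pi * real (Suc r) / a)\<^sup>2)))
      has_sum neumann_trace l1 t * (neumann_trace l2 t * dirichlet_trace a t)) UNIV"
    using has_sum_times[OF N[OF l1] has_sum_times[OF N[OF l2] D]]
    by (simp add: case_prod_unfold del: of_nat_Suc)
  also have "(\<lambda>(m, n, r). exp (- t * (pi * real m / l1)\<^sup>2) * (exp (- t * (pi * real n / l2)\<^sup>2) * exp (- t * (pi * real (Suc r) / a)\<^sup>2)))
      = (\<lambda>k. exp (- t * lam k))"
    by (simp add: fun_eq_iff cell_eigenvalue_def exp_add[symmetric] algebra_simps del: of_nat_Suc)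
  finally show ?thesis by (simp add: mult.assoc)
qed

lemma cell_operatorD:
  assumes "(u, w) \<in> cell_operator l1 l2 a"
  shows "u \<in> cell_form_domain l1 l2 a" "w \<in> L2_space M"
    "\<And>v. v \<in> cell_form_domain l1 l2 a \<Longrightarrow> dirichlet_form S u v = L2_inner M w v"
  using assms by (auto simp: cell_operator_def form_operator_def)

lemma cell_operator_inner:
  assumes "(u, w) \<in> cell_operator l1 l2 a"
  shows "L2_inner M w (mode k) = lam k * L2_inner M u (mode k)"
proof -
  note u = cell_operatorD[OF assms]
  have "L2_inner M w (mode k) = dirichlet_form S u (mode k)"
    using u(3)[OF mode_form_domain] by simp
  also have "\<dots> = (\<Sum>b\<in>Basis. L2_inner M (weak_partial S b u) (weak_partial S b (mode k)))"
    by (intro dirichlet_form_eq domain_H1 u(1) mode_form_domain)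
  also have "\<dots> = (\<Sum>b\<in>Basis. L2_inner M (partial b (mode k)) (weak_partial S b u))"
  proof (rule sum.cong[OF refl])
    fix b :: "real \<times> real \<times> real" assume b: "b \<in> Basis"
    have "L2_inner M (weak_partial S b (mode k)) (weak_partial S b u)
        = L2_inner M (partial b (mode k)) (weak_partial S b u)"
    proof (rule L2_inner_cong_AE[OF _ _ _ weak_partial_AE[OF mode_weak_partial[OF b]]])
      show "weak_partial S b (mode k) \<in> borel_measurable M" "weak_partial S b u \<in> borel_measurable M"
        by (intro L2_spaceD(1)[OF weak_partial_L2] domain_H1 mode_form_domain u(1) b)+
      show "partial b (mode k) \<in> borel_measurable M"
        by (intro L2_spaceD(1)[OF smooth_L2] smooth_partial smooth_cell_mode b)
    qed
    then show "L2_inner M (weak_partial S b u) (weak_partial S b (mode k))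
        = L2_inner M (partial b (mode k)) (weak_partial S b u)"
      by (simp add: L2_inner_commute)
  qed
  also have "\<dots> = lam k * L2_inner M u (mode k)"
    using mode_green[OF u(1)] by (simp add: L2_inner_commute)
  finally show ?thesis .
qed

text \<open>
  The partial sums are smooth, vanish on the plates and converge uniformly with their first
  derivatives, so the sum lies in the form domain.  For the partial sums the form is evaluated
  termwise by the weak eigenvalue equation, and both sides pass to the limit.
\<close>

lemma cell_operator_series:
  assumes c: "(\<lambda>k. \<bar>c k\<bar> * (1 + lam k)) summable_on UNIV"
  shows "((\<lambda>p. \<Sum>\<^sub>\<infinity>k. c k * mode k p), (\<lambda>p. \<Sum>\<^sub>\<infinity>k. lam k * c k * mode k p)) \<in> cell_operator l1 l2 a"
proof -
  define d where "d k = mode_bound * (\<bar>c k\<bar> * (1 + lam k))" for k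
  have d: "d summable_on UNIV" unfolding d_def[abs_def] by (rule summable_on_cmult_right[OF c])
  obtain G :: "nat \<Rightarrow> (nat \<times> nat \<times> nat) set" where G: "\<And>n. finite (G n)"
    and lim: "(\<lambda>n. infsum d UNIV - sum d (G n)) \<longlonglongrightarrow> 0"
    using summable_exhaustion[OF d] by blast
  have K: "0 \<le> mode_bound" using l1 l2 a by (simp add: mode_bound_def)
  have b0: "\<bar>c k * mode k p\<bar> \<le> d k" for k p
  proof -
    have "\<bar>c k\<bar> * \<bar>mode k p\<bar> \<le> (\<bar>c k\<bar> * (1 + lam k)) * mode_bound"
      using mode_le_bound lam_nonneg[of k] by (intro mult_mono) (auto simp: algebra_simps)
    then show ?thesis by (simp add: d_def abs_mult mult_ac)
  qed
  have bl: "\<bar>lam k * c k * mode k p\<bar> \<le> d k" for k p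
  proof -
    have "lam k * \<bar>c k\<bar> * \<bar>mode k p\<bar> \<le> (\<bar>c k\<bar> * (1 + lam k)) * mode_bound"
      by (rule mult_mono) (use mode_le_bound lam_nonneg[of k] in \<open>auto simp: algebra_simps\<close>)
    then show ?thesis using lam_nonneg[of k] by (simp add: d_def abs_mult mult_ac)
  qed
  have b1: "\<bar>c k * partial b (mode k) p\<bar> \<le> d k" if "b \<in> Basis" for b k p
    using mult_left_mono[OF mode_partial_bound[OF that, of k p], of "\<bar>c k\<bar>"]
    by (simp add: d_def abs_mult mult_ac)
  have meas: "(\<lambda>p. x * mode k p) \<in> borel_measurable M" for k x
    using L2_spaceD(1)[OF mode_L2[of k]] by simp
  have meas1: "(\<lambda>p. x * partial b (mode k) p) \<in> borel_measurable M" if "b \<in> Basis" for b k x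
    using L2_spaceD(1)[OF smooth_L2[OF smooth_partial[OF smooth_cell_mode that]]] by simp
  define u where "u p = (\<Sum>\<^sub>\<infinity>k. c k * mode k p)" for p
  define w where "w p = (\<Sum>\<^sub>\<infinity>k. lam k * c k * mode k p)" for p
  define g where "g b p = (\<Sum>\<^sub>\<infinity>k. c k * partial b (mode k) p)" for b p
  define U where "U n p = (\<Sum>k\<in>G n. c k * mode k p)" for n p
  have U: "smooth (U n)" for n
    unfolding U_def[abs_def] by (intro smooth_sum smooth_mult smooth_const smooth_cell_mode)
  have Ub: "partial b (U n) p = (\<Sum>k\<in>G n. c k * partial b (mode k) p)" for b n p
    unfolding U_def[abs_def] by (rule frechet_derivative_lincomb_smooth[OF smooth_cell_mode])
  have u: "u \<in> L2_space M" "(\<lambda>n. L2_norm M (\<lambda>p. U n p - u p)) \<longlonglongrightarrow> 0"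
    unfolding u_def[abs_def] U_def
    using dominated_series_L2[of M "\<lambda>k p. c k * mode k p", OF finite_M meas d b0 G lim] by auto
  have w: "w \<in> L2_space M" "(\<lambda>n. L2_norm M (\<lambda>p. (\<Sum>k\<in>G n. lam k * c k * mode k p) - w p)) \<longlonglongrightarrow> 0"
    unfolding w_def[abs_def]
    using dominated_series_L2[of M "\<lambda>k p. lam k * c k * mode k p", OF finite_M meas d bl G lim] by auto
  have g: "g b \<in> L2_space M" "(\<lambda>n. L2_norm M (\<lambda>p. partial b (U n) p - g b p)) \<longlonglongrightarrow> 0" if b: "b \<in> Basis" for b
    unfolding g_def[abs_def] Ub
    using dominated_series_L2[of M "\<lambda>k p. c k * partial b (mode k) p", OF finite_M meas1[OF b] d b1[OF b] G lim]
    by auto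
  have plates: "U n (x, y, 0) = 0 \<and> U n (x, y, a) = 0" for n x y
    by (simp add: U_def mode_plates)
  have dom: "u \<in> cell_form_domain l1 l2 a"
    by (rule form_domain_closure(1)[OF U plates u(1) g(1) u(2) g(2)])
  have ug: "has_weak_partial S b u (g b)" if "b \<in> Basis" for b
    by (rule form_domain_closure(2)[OF U plates u(1) g(1) u(2) g(2) that])
  have "dirichlet_form S u v = L2_inner M w v" if v: "v \<in> cell_form_domain l1 l2 a" for v
  proof -
    have wv: "weak_partial S b v \<in> L2_space M" if "b \<in> Basis" for b
      by (rule weak_partial_L2[OF domain_H1[OF v] that])
    have "dirichlet_form S u v = (\<Sum>b\<in>Basis. L2_inner M (weak_partial S b u) (weak_partial S b v))"
      by (intro dirichlet_form_eq domain_H1 dom v)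
    also have "\<dots> = (\<Sum>b\<in>Basis. L2_inner M (g b) (weak_partial S b v))"
    proof (rule sum.cong[OF refl])
      fix b :: "real \<times> real \<times> real" assume b: "b \<in> Basis"
      show "L2_inner M (weak_partial S b u) (weak_partial S b v) = L2_inner M (g b) (weak_partial S b v)"
        by (rule L2_inner_cong_AE[OF _ _ _ weak_partial_AE[OF ug[OF b]]])
           (intro L2_spaceD(1) weak_partial_L2 domain_H1 dom v g(1) b)+
    qed
    finally have q: "dirichlet_form S u v = (\<Sum>b\<in>Basis. L2_inner M (g b) (weak_partial S b v))" .
    have "(\<lambda>n. \<Sum>b\<in>Basis. L2_inner M (partial b (U n)) (weak_partial S b v)) \<longlonglongrightarrow> dirichlet_form S u v"
      unfolding q
      by (intro tendsto_sum L2_inner_tendsto g wv always_eventually allI smooth_L2 smooth_partial U)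
    moreover have "(\<Sum>b\<in>Basis. L2_inner M (partial b (U n)) (weak_partial S b v))
        = L2_inner M (\<lambda>p. \<Sum>k\<in>G n. lam k * c k * mode k p) v" for n
    proof -
      have "(\<Sum>b\<in>Basis. L2_inner M (partial b (U n)) (weak_partial S b v))
          = (\<Sum>b\<in>Basis. \<Sum>k\<in>G n. c k * L2_inner M (partial b (mode k)) (weak_partial S b v))"
      proof (rule sum.cong[OF refl])
        fix b :: "real \<times> real \<times> real" assume b: "b \<in> Basis"
        have "L2_inner M (partial b (U n)) (weak_partial S b v)
            = L2_inner M (\<lambda>p. \<Sum>k\<in>G n. c k * partial b (mode k) p) (weak_partial S b v)"
          by (simp only: Ub)
        also have "\<dots> = (\<Sum>k\<in>G n. L2_inner M (\<lambda>p. c k * partial b (mode k) p) (weak_partial S b v))"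
          by (intro L2_inner_sum_left L2_cmult smooth_L2 smooth_partial smooth_cell_mode b wv)
        finally show "L2_inner M (partial b (U n)) (weak_partial S b v)
            = (\<Sum>k\<in>G n. c k * L2_inner M (partial b (mode k)) (weak_partial S b v))"
          by (simp only: L2_inner_cmult_left)
      qed
      also have "\<dots> = (\<Sum>k\<in>G n. c k * (lam k * L2_inner M (mode k) v))"
        by (subst sum.swap) (simp only: sum_distrib_left[symmetric] mode_green[OF v])
      also have "\<dots> = (\<Sum>k\<in>G n. L2_inner M (\<lambda>p. lam k * c k * mode k p) v)"
        by (simp only: L2_inner_cmult_left mult_ac)
      also have "\<dots> = L2_inner M (\<lambda>p. \<Sum>k\<in>G n. lam k * c k * mode k p) v"
        by (intro L2_inner_sum_left[symmetric] L2_cmult mode_L2 domain_L2 v)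
      finally show ?thesis .
    qed
    moreover have "(\<lambda>n. L2_inner M (\<lambda>p. \<Sum>k\<in>G n. lam k * c k * mode k p) v) \<longlonglongrightarrow> L2_inner M w v"
      by (intro L2_inner_tendsto w domain_L2 v always_eventually allI L2_sum L2_cmult mode_L2)
    ultimately show ?thesis using LIMSEQ_unique by simp
  qed
  then show ?thesis
    using dom w(1) by (simp add: cell_operator_def form_operator_def u_def[abs_def] w_def[abs_def])
qed

theorem cell_eigenbasis: "L2_eigenbasis M (cell_operator l1 l2 a) mode lam mode_bound"
proof (rule L2_eigenbasis.intro)
  show "finite_measure M" by (rule finite_M)
  show "inj mode" by (rule cell_mode_inj[OF l1 l2 a])
  show "L2_orthonormal_basis M (range mode)" by (rule cell_modes_basis[OF l1 l2 a])
  show "\<bar>mode k p\<bar> \<le> mode_bound" for k p by (rule mode_le_bound)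
  show "0 \<le> lam k" for k by (rule lam_nonneg)
  show "(\<lambda>k. exp (- t * lam k)) summable_on UNIV" if "0 < t" for t
    using heat_has_sum[OF that] by (rule has_sum_imp_summable)
  show "u \<in> L2_space M \<and> w \<in> L2_space M" if "(u, w) \<in> cell_operator l1 l2 a" for u w
    using cell_operatorD(1,2)[OF that] domain_L2 by blast
  show "L2_inner M w (mode k) = lam k * L2_inner M u (mode k)" if "(u, w) \<in> cell_operator l1 l2 a" for u w k
    by (rule cell_operator_inner[OF that])
  show "((\<lambda>p. \<Sum>\<^sub>\<infinity>k. c k * mode k p), (\<lambda>p. \<Sum>\<^sub>\<infinity>k. lam k * c k * mode k p)) \<in> cell_operator l1 l2 a"
    if "(\<lambda>k. \<bar>c k\<bar> * (1 + lam k)) summable_on UNIV" for c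
    by (rule cell_operator_series[OF that])
qed

theorem cell_heat_trace_eq:
  assumes "0 < t"
  shows "cell_heat_trace l1 l2 a t = neumann_trace l1 t * neumann_trace l2 t * dirichlet_trace a t"
  unfolding cell_heat_trace_def L2_eigenbasis.trace_exp_neg[OF cell_eigenbasis assms]
  by (rule infsumI[OF heat_has_sum[OF assms]])

end

section \<open>The heat trace of the mixed cell\<close>

theorem cell_heat_trace_asymptotics:
  assumes "0 < l1" "0 < l2" "0 < a"
  shows "(\<lambda>t. cell_heat_trace l1 l2 a t
          - (l1 * l2 * a / (8 * pi powr (3/2)) * t powr (-3/2)
             + (a * (l1 + l2) - l1 * l2) / (8 * pi) * t powr (-1)))
        \<in> O[at_right 0](\<lambda>t. t powr (-1/2))"
proof -
  interpret mixed_cell l1 l2 a by standard (use assms in auto)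
  have "\<forall>\<^sub>F t in at_right 0. cell_heat_trace l1 l2 a t
          - (l1 * l2 * a / (8 * pi powr (3/2)) * t powr (-3/2)
             + (a * (l1 + l2) - l1 * l2) / (8 * pi) * t powr (-1))
      = neumann_trace l1 t * neumann_trace l2 t * dirichlet_trace a t
          - (l1 * l2 * a / (8 * pi powr (3/2)) * t powr (-3/2)
             + (a * (l1 + l2) - l1 * l2) / (8 * pi) * t powr (-1))"
    using eventually_at_right_less[of "0::real"]
    by eventually_elim (simp add: cell_heat_trace_eq)
  from landau_o.big.in_cong[OF this] show ?thesis
    using cell_trace_asymptotics[OF assms] by blast
qed

theorem proposition8p5:
  fixes l1 l2 a :: real
  assumes "l1 > 0" and "l2 > 0" and "a > 0"
  shows
    "(\<lambda>t. cell_heat_trace l1 l2 a t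
          - (l1 * l2 * a / (8 * pi powr (3/2)) * t powr (-3/2)
             + (a * (l1 + l2) - l1 * l2) / (8 * pi) * t powr (-1)))
        \<in> O[at_right 0](\<lambda>t. t powr (-1/2))
     \<and> (l1 * l2 = a\<^sup>2 \<longrightarrow>
          (\<lambda>t. cell_heat_trace l1 l2 a t
             - (a ^ 3 / (8 * pi powr (3/2)) * t powr (-3/2) + B_coeff l1 l2 a * t powr (-1)))
           \<in> O[at_right 0](\<lambda>t. t powr (-1/2)))
     \<and> (is_arg_min (\<lambda>(x, y). B_coeff x y a) (admissible a) (l1, l2) \<longleftrightarrow> l1 = a \<and> l2 = a)
     \<and> B_coeff a a a = a\<^sup>2 / (8 * pi)
     \<and> (is_arg_min (\<lambda>(x, y). B_lat x y a) (admissible a) (l1, l2) \<longleftrightarrow> l1 = a \<and> l2 = a)"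
proof (intro conjI impI)
  note main = cell_heat_trace_asymptotics[OF assms]
  show "(\<lambda>t. cell_heat_trace l1 l2 a t
          - (l1 * l2 * a / (8 * pi powr (3/2)) * t powr (-3/2)
             + (a * (l1 + l2) - l1 * l2) / (8 * pi) * t powr (-1)))
        \<in> O[at_right 0](\<lambda>t. t powr (-1/2))"
    by (rule main)
  show "(\<lambda>t. cell_heat_trace l1 l2 a t
             - (a ^ 3 / (8 * pi powr (3/2)) * t powr (-3/2) + B_coeff l1 l2 a * t powr (-1)))
           \<in> O[at_right 0](\<lambda>t. t powr (-1/2))" if c: "l1 * l2 = a\<^sup>2"
  proof -
    have "l1 * l2 * a = a ^ 3" unfolding c by (simp add: power2_eq_square power3_eq_cube)
    then show ?thesis using main unfolding B_coeff_def c by simp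
  qed
  show "is_arg_min (\<lambda>(x, y). B_coeff x y a) (admissible a) (l1, l2) \<longleftrightarrow> l1 = a \<and> l2 = a"
    by (rule is_arg_min_cube[where c = "a / (8 * pi)" and d = "- a\<^sup>2 / (8 * pi)"])
       (use assms in \<open>auto simp: B_coeff_def diff_divide_distrib\<close>)
  show "B_coeff a a a = a\<^sup>2 / (8 * pi)"
    by (simp add: B_coeff_def power2_eq_square algebra_simps)
  show "is_arg_min (\<lambda>(x, y). B_lat x y a) (admissible a) (l1, l2) \<longleftrightarrow> l1 = a \<and> l2 = a"
    by (rule is_arg_min_cube[where c = "a / (8 * pi)" and d = 0])
       (use assms in \<open>auto simp: B_lat_def\<close>)
qed

end
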